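(* Let $G$ be a DAG with vertices $V$ and let $\mathrm{BN}_G^{\mathrm{eqb}}$ be the class of equicontinuous and bounded Bayesian networks induced by a tuple $(K,\omega,\mu)$ (as in the context). Let $M_G^{\mathrm{eqb}}=D(\mathrm{BN}_G^{\mathrm{eqb}})$ and $F_G^{\mathrm{eqb}}=M_G^{\mathrm{eqb}}\cap F_G$. If there is at least one faithful model in $\mathrm{BN}_G^{\mathrm{eqb}}$, then $F_G^{\mathrm{eqb}}$ is open and dense in $M_G^{\mathrm{eqb}}$, both in the weak topology and in the total variation metric.
   Context: A DAG $G=(V,E)$ has a finite vertex set $V$ and no directed cycles; $\mathrm{pa}(v)=\{w: w\to v\in E\}$. The ancestors of $v$ are $v$ itself and all $w$ with a directed path from $w$ to $v$; an ancestor of a set $C$ is an ancestor of some element of $C$. A collider on a path is a vertex $v$ with $\cdots\to v\leftarrow\cdots$ on the path; other vertices of the path (including endpoints) are non-colliders. For (not necessarily disjoint) $A,B,C\subseteq V$, $A\perp^d_G B\mid C$ means that every path between some $a\in A$ and some $b\in B$ contains a collider that is not an ancestor of $C$, or a non-collider in $C$; for $a=b$ the trivial path $a$ counts as a path, blocked precisely when $a\in C$. $A\not\perp^d_G B\mid C$ is the negation. For each $v\in V$, $\mathcal X_v$ is a separable complete metric space with at least two points and its Borel $\sigma$-algebra; $\mathcal X_A=\prod_{v\in A}\mathcal X_v$ carries the Euclidean product metric $d(x,x')=(\sum_{v\in A}d_v(x_v,x_v')^2)^{1/2}$. $X_A\perp\!\!\!\perp_{\mathbb P}X_B\mid X_C$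 means $\mathbb P(X_A\in E_A,X_B\in E_B\mid X_C)=\mathbb P(X_A\in E_A\mid X_C)\mathbb P(X_B\in E_B\mid X_C)$ a.s. for all Borel $E_A,E_B$. $M_G$ is the set of Borel probability measures $\mathbb P$ on $\mathcal X_V$ with $A\perp^d_G B\mid C\Rightarrow X_A\perp\!\!\!\perp_{\mathbb P}X_B\mid X_C$ for all $A,B,C\subseteq V$; $F_G$ is the set of $\mathbb P\in M_G$ such that $A\not\perp^d_G B\mid C$ implies that $X_A\perp\!\!\!\perp_{\mathbb P}X_B\mid X_C$ fails, for all $A,B,C\subseteq V$. $\mathrm{BN}_G$ is the set of tuples $(\mathbb P(X_v\mid X_{\mathrm{pa}(v)}))_{v\in V}$ of Markov kernels $\mathcal X_{\mathrm{pa}(v)}\to\mathcal P(\mathcal X_v)$; the distribution map $D:\mathrm{BN}_G\to M_G$ sends such a tuple to the product of kernels $\bigotimes_{v}\mathbb P(X_v\mid X_{\mathrm{pa}(v)})$. A model $m$ is faithful if $D(m)\in F_G$. The total variation metric is $d_{TV}(\mathbb P,\mathbb Q)=\sup_E|\mathbb P(E)-\mathbb Q(E)|$ over Borel $E$; the weak topology is that of convergence in distribution (against bounded continuous functions). A modulus of continuity is a nonzero function $\omega:[0,\infty)\to[0,\infty)$ with $\lim_{t\downarrow0}\omega(t)=\omega(0)=0$, throughout assumed concave; $f$ admits the modulus $\omega$ if $|f(x)-f(x')|\le\omega(d(x,x'))$ for all $x,x'$. Given $K>0$, a modulus $\omega$ and locally finite measures $\mu_v$ on $\mathcal X_v$ ($v\in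 V$), with $\mu=\bigotimes_v\mu_v$, the class $\mathrm{BN}_G^{\mathrm{eqb}}\subseteq\mathrm{BN}_G$ induced by $(K,\omega,\mu)$ consists of the Bayesian networks such that for each $v$ the kernel has a conditional density $(x_v,x_{\mathrm{pa}(v)})\mapsto p(x_v\mid x_{\mathrm{pa}(v)})$ with respect to $\mu_v$ that is bounded by $K$ and admits the modulus $\omega$ on $\mathcal X_v\times\mathcal X_{\mathrm{pa}(v)}$. *)

theory Defs
  imports "HOL-Probability.Probability"
begin

definition dag :: "'v set \<Rightarrow> ('v \<times> 'v) set \<Rightarrow> bool" where
  "dag V E \<longleftrightarrow> finite V \<and> E \<subseteq> V \<times> V \<and> acyclic E"

definition pa :: "('v \<times> 'v) set \<Rightarrow> 'v \<Rightarrow> 'v set" where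
  "pa E v = {w. (w, v) \<in> E}"

definition ancestors :: "('v \<times> 'v) set \<Rightarrow> 'v set \<Rightarrow> 'v set" where
  "ancestors E C = {w. \<exists>c\<in>C. (w, c) \<in> E\<^sup>*}"

text \<open>In an acyclic graph two adjacent vertices are joined by exactly one edge, so a path
  is determined by its list of vertices. The list \<open>[a]\<close> is the trivial path.\<close>

definition is_path :: "'v set \<Rightarrow> ('v \<times> 'v) set \<Rightarrow> 'v list \<Rightarrow> bool" where
  "is_path V E p \<longleftrightarrow> p \<noteq> [] \<and> distinct p \<and> set p \<subseteq> V \<and>
     successively (\<lambda>u v. (u, v) \<in> E \<or> (v, u) \<in> E) p"

definition collider :: "('v \<times> 'v) set \<Rightarrow> 'v list \<Rightarrow> nat \<Rightarrow> bool" where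
  "collider E p i \<longleftrightarrow> 0 < i \<and> i + 1 < length p \<and>
     (p ! (i - 1), p ! i) \<in> E \<and> (p ! (i + 1), p ! i) \<in> E"

definition blocked :: "('v \<times> 'v) set \<Rightarrow> 'v set \<Rightarrow> 'v list \<Rightarrow> bool" where
  "blocked E C p \<longleftrightarrow> (\<exists>i<length p.
     collider E p i \<and> p ! i \<notin> ancestors E C \<or> \<not> collider E p i \<and> p ! i \<in> C)"

definition d_separated ::
  "'v set \<Rightarrow> ('v \<times> 'v) set \<Rightarrow> 'v set \<Rightarrow> 'v set \<Rightarrow> 'v set \<Rightarrow> bool" where
  "d_separated V E A B C \<longleftrightarrow>
     (\<forall>p. is_path V E p \<and> hd p \<in> A \<and> last p \<in> B \<longrightarrow> blocked E C p)"

definition borel_space :: "'a metric \<Rightarrow> 'a measure" where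
  "borel_space m = sigma (mspace m) {U. openin (mtopology_of m) U}"

definition prod_space :: "('v \<Rightarrow> 'a metric) \<Rightarrow> 'v set \<Rightarrow> ('v \<Rightarrow> 'a) metric" where
  "prod_space X A = metric (\<Pi>\<^sub>E v\<in>A. mspace (X v),
     \<lambda>x y. L2_set (\<lambda>v. mdist (X v) (x v) (y v)) A)"

lemma Metric_space_prod_space:
  assumes "finite A"
  shows "Metric_space (\<Pi>\<^sub>E v\<in>A. mspace (X v)) (\<lambda>x y. L2_set (\<lambda>v. mdist (X v) (x v) (y v)) A)"
proof
  fix x y
  show "0 \<le> L2_set (\<lambda>v. mdist (X v) (x v) (y v)) A"
    by (rule L2_set_nonneg)
  show "L2_set (\<lambda>v. mdist (X v) (x v) (y v)) A = L2_set (\<lambda>v. mdist (X v) (y v) (x v)) A"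
    by (simp add: mdist_commute)
next
  fix x y assume xy: "x \<in> (\<Pi>\<^sub>E v\<in>A. mspace (X v))" "y \<in> (\<Pi>\<^sub>E v\<in>A. mspace (X v))"
  show "(L2_set (\<lambda>v. mdist (X v) (x v) (y v)) A = 0) = (x = y)"
  proof
    assume "L2_set (\<lambda>v. mdist (X v) (x v) (y v)) A = 0"
    then have "\<forall>v\<in>A. mdist (X v) (x v) (y v) = 0"
      using assms by (simp add: L2_set_eq_0_iff)
    then have "\<And>v. v \<in> A \<Longrightarrow> x v = y v"
      using xy by (metis PiE_mem mdist_zero)
    then show "x = y" using xy by (metis PiE_ext)
  next
    assume "x = y"
    then have "\<forall>v\<in>A. mdist (X v) (x v) (y v) = 0"
      using xy by (metis PiE_mem mdist_zero)
    then show "L2_set (\<lambda>v. mdist (X v) (x v) (y v)) A = 0"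
      using assms by (simp add: L2_set_eq_0_iff)
  qed
next
  fix x y z
  assume xyz: "x \<in> (\<Pi>\<^sub>E v\<in>A. mspace (X v))" "y \<in> (\<Pi>\<^sub>E v\<in>A. mspace (X v))"
    "z \<in> (\<Pi>\<^sub>E v\<in>A. mspace (X v))"
  have "L2_set (\<lambda>v. mdist (X v) (x v) (z v)) A
      \<le> L2_set (\<lambda>v. mdist (X v) (x v) (y v) + mdist (X v) (y v) (z v)) A"
    using xyz by (intro L2_set_mono) (auto intro!: mdist_triangle simp: PiE_mem)
  also have "\<dots> \<le> L2_set (\<lambda>v. mdist (X v) (x v) (y v)) A
      + L2_set (\<lambda>v. mdist (X v) (y v) (z v)) A"
    by (rule L2_set_triangle_ineq)
  finally show "L2_set (\<lambda>v. mdist (X v) (x v) (z v)) A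
      \<le> L2_set (\<lambda>v. mdist (X v) (x v) (y v)) A + L2_set (\<lambda>v. mdist (X v) (y v) (z v)) A" .
qed

lemma mspace_prod_space: "finite A \<Longrightarrow> mspace (prod_space X A) = (\<Pi>\<^sub>E v\<in>A. mspace (X v))"
  by (simp add: prod_space_def Metric_space.mspace_metric Metric_space_prod_space)

lemma mdist_prod_space:
  "finite A \<Longrightarrow> mdist (prod_space X A) x y = sqrt (\<Sum>v\<in>A. (mdist (X v) (x v) (y v))\<^sup>2)"
  by (simp add: prod_space_def Metric_space.mdist_metric[OF Metric_space_prod_space])
    (simp add: L2_set_def)

definition sigma_coord ::
  "('v \<Rightarrow> 'a metric) \<Rightarrow> ('v \<Rightarrow> 'a) measure \<Rightarrow> 'v set \<Rightarrow> ('v \<Rightarrow> 'a) measure" where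
  "sigma_coord X P C =
     vimage_algebra (space P) (\<lambda>x. restrict x C) (borel_space (prod_space X C))"

definition cond_indep ::
  "('v \<Rightarrow> 'a metric) \<Rightarrow> ('v \<Rightarrow> 'a) measure \<Rightarrow> 'v set \<Rightarrow> 'v set \<Rightarrow> 'v set \<Rightarrow> bool" where
  "cond_indep X P A B C \<longleftrightarrow>
     (\<forall>S\<in>sets (borel_space (prod_space X A)). \<forall>T\<in>sets (borel_space (prod_space X B)).
       AE x in P.
         real_cond_exp P (sigma_coord X P C)
           (indicator {z \<in> space P. restrict z A \<in> S \<and> restrict z B \<in> T}) x
         = real_cond_exp P (sigma_coord X P C) (indicator {z \<in> space P. restrict z A \<in> S}) x
           * real_cond_exp P (sigma_coord X P C) (indicator {z \<in> space P. restrict z B \<in> T}) x)"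

definition borel_probs :: "'a metric \<Rightarrow> 'a measure set" where
  "borel_probs m = space (prob_algebra (borel_space m))"

definition markov_dists ::
  "'v set \<Rightarrow> ('v \<times> 'v) set \<Rightarrow> ('v \<Rightarrow> 'a metric) \<Rightarrow> ('v \<Rightarrow> 'a) measure set" where
  "markov_dists V E X = {P \<in> borel_probs (prod_space X V).
     \<forall>A B C. A \<subseteq> V \<and> B \<subseteq> V \<and> C \<subseteq> V \<and> d_separated V E A B C \<longrightarrow> cond_indep X P A B C}"

definition faithful_dists ::
  "'v set \<Rightarrow> ('v \<times> 'v) set \<Rightarrow> ('v \<Rightarrow> 'a metric) \<Rightarrow> ('v \<Rightarrow> 'a) measure set" where
  "faithful_dists V E X = {P \<in> markov_dists V E X.
     \<forall>A B C. A \<subseteq> V \<and> B \<subseteq> V \<and> C \<subseteq> V \<and> \<not> d_separated V E A B C \<longrightarrow> \<not> cond_indep X P A B C}"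

definition BN ::
  "'v set \<Rightarrow> ('v \<times> 'v) set \<Rightarrow> ('v \<Rightarrow> 'a metric) \<Rightarrow> ('v \<Rightarrow> ('v \<Rightarrow> 'a) \<Rightarrow> 'a measure) set" where
  "BN V E X = (\<Pi>\<^sub>E v\<in>V. measurable (borel_space (prod_space X (pa E v)))
     (prob_algebra (borel_space (X v))))"

text \<open>Product of the kernels along a list in which every vertex is preceded by all its children:
  the tail of the list is sampled first.\<close>

primrec kernel_product ::
  "('v \<times> 'v) set \<Rightarrow> ('v \<Rightarrow> 'a metric) \<Rightarrow> ('v \<Rightarrow> ('v \<Rightarrow> 'a) \<Rightarrow> 'a measure) \<Rightarrow> 'v list
     \<Rightarrow> ('v \<Rightarrow> 'a) measure" where
  "kernel_product E X k [] = return (borel_space (prod_space X {})) (\<lambda>_. undefined)"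
| "kernel_product E X k (v # vs) = kernel_product E X k vs \<bind>
     (\<lambda>x. distr (k v (restrict x (pa E v))) (borel_space (prod_space X (insert v (set vs))))
            (\<lambda>y. x(v := y)))"

definition rev_topological_order :: "'v set \<Rightarrow> ('v \<times> 'v) set \<Rightarrow> 'v list \<Rightarrow> bool" where
  "rev_topological_order V E vs \<longleftrightarrow>
     distinct vs \<and> set vs = V \<and> sorted_wrt (\<lambda>v w. (v, w) \<notin> E) vs"

lemma rev_topological_order_exists:
  assumes "dag V E"
  shows "\<exists>vs. rev_topological_order V E vs"
proof -
  have "\<exists>vs. distinct vs \<and> set vs = W \<and> sorted_wrt (\<lambda>v w. (v, w) \<notin> E) vs"
    if "finite W" "W \<subseteq> V" for W
    using that
  proof (induction "card W" arbitrary: W)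
    case 0
    then show ?case by (intro exI[of _ "[]"]) auto
  next
    case (Suc n)
    have fE: "finite E" using assms unfolding dag_def by (meson finite_SigmaI finite_subset)
    have "wf (E\<inverse>)" using assms fE by (simp add: dag_def finite_acyclic_wf_converse)
    moreover have "W \<noteq> {}" using Suc.hyps(2) by auto
    ultimately obtain z where z: "z \<in> W" "\<And>y. (y, z) \<in> E\<inverse> \<Longrightarrow> y \<notin> W"
      by (metis ex_in_conv wfE_min)
    have "n = card (W - {z})" using Suc.hyps(2) z(1) Suc.prems(1) by simp
    then obtain vs where "distinct vs" "set vs = W - {z}" "sorted_wrt (\<lambda>v w. (v, w) \<notin> E) vs"
      using Suc.hyps(1)[of "W - {z}"] Suc.prems by auto
    then show ?case using z by (intro exI[of _ "z # vs"]) auto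
  qed
  then show ?thesis using assms by (simp add: rev_topological_order_def dag_def)
qed

text \<open>For kernels in \<open>BN V E X\<close> the product does not depend on the chosen order.\<close>

definition BN_dist ::
  "'v set \<Rightarrow> ('v \<times> 'v) set \<Rightarrow> ('v \<Rightarrow> 'a metric) \<Rightarrow> ('v \<Rightarrow> ('v \<Rightarrow> 'a) \<Rightarrow> 'a measure)
     \<Rightarrow> ('v \<Rightarrow> 'a) measure" where
  "BN_dist V E X k = kernel_product E X k (SOME vs. rev_topological_order V E vs)"

definition modulus_of_continuity :: "(real \<Rightarrow> real) \<Rightarrow> bool" where
  "modulus_of_continuity \<omega> \<longleftrightarrow> (\<forall>t\<ge>0. 0 \<le> \<omega> t) \<and> (\<exists>t\<ge>0. \<omega> t \<noteq> 0) \<and>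
     \<omega> 0 = 0 \<and> (\<omega> \<longlongrightarrow> 0) (at_right 0)"

definition admits_modulus :: "'a metric \<Rightarrow> (real \<Rightarrow> real) \<Rightarrow> ('a \<Rightarrow> real) \<Rightarrow> bool" where
  "admits_modulus m \<omega> f \<longleftrightarrow>
     (\<forall>x\<in>mspace m. \<forall>y\<in>mspace m. \<bar>f x - f y\<bar> \<le> \<omega> (mdist m x y))"

definition locally_finite_measure :: "'a metric \<Rightarrow> 'a measure \<Rightarrow> bool" where
  "locally_finite_measure m M \<longleftrightarrow> sets M = sets (borel_space m) \<and>
     (\<forall>x\<in>mspace m. \<exists>U. openin (mtopology_of m) U \<and> x \<in> U \<and> emeasure M U < \<infinity>)"

text \<open>The density is evaluated at pairs \<open>(x\<^sub>v, x\<^bsub>pa(v)\<^esub>)\<close>; as \<open>v \<notin> pa(v)\<close>, the metric of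
  \<open>prod_metric\<close> on such pairs is the Euclidean product metric over \<open>{v} \<union> pa(v)\<close>. Measurability of
  the density follows from continuity.\<close>

definition BN_eqb ::
  "'v set \<Rightarrow> ('v \<times> 'v) set \<Rightarrow> ('v \<Rightarrow> 'a metric) \<Rightarrow> real \<Rightarrow> (real \<Rightarrow> real) \<Rightarrow> ('v \<Rightarrow> 'a measure)
     \<Rightarrow> ('v \<Rightarrow> ('v \<Rightarrow> 'a) \<Rightarrow> 'a measure) set" where
  "BN_eqb V E X K \<omega> \<mu> = {k \<in> BN V E X. \<forall>v\<in>V. \<exists>p.
     (\<forall>z \<in> mspace (prod_metric (X v) (prod_space X (pa E v))). 0 \<le> p z \<and> p z \<le> K) \<and>
     admits_modulus (prod_metric (X v) (prod_space X (pa E v))) \<omega> p \<and>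
     (\<forall>x \<in> mspace (prod_space X (pa E v)). k v x = density (\<mu> v) (\<lambda>y. ennreal (p (y, x))))}"

definition M_eqb ::
  "'v set \<Rightarrow> ('v \<times> 'v) set \<Rightarrow> ('v \<Rightarrow> 'a metric) \<Rightarrow> real \<Rightarrow> (real \<Rightarrow> real) \<Rightarrow> ('v \<Rightarrow> 'a measure)
     \<Rightarrow> ('v \<Rightarrow> 'a) measure set" where
  "M_eqb V E X K \<omega> \<mu> = BN_dist V E X ` BN_eqb V E X K \<omega> \<mu>"

definition F_eqb ::
  "'v set \<Rightarrow> ('v \<times> 'v) set \<Rightarrow> ('v \<Rightarrow> 'a metric) \<Rightarrow> real \<Rightarrow> (real \<Rightarrow> real) \<Rightarrow> ('v \<Rightarrow> 'a measure)
     \<Rightarrow> ('v \<Rightarrow> 'a) measure set" where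
  "F_eqb V E X K \<omega> \<mu> = M_eqb V E X K \<omega> \<mu> \<inter> faithful_dists V E X"

definition weak_topology :: "'a metric \<Rightarrow> 'a measure topology" where
  "weak_topology m = topology_generated_by
     {{P \<in> borel_probs m. (\<integral>x. f x \<partial>P) \<in> U} | f U.
        continuous_map (mtopology_of m) euclideanreal f \<and> bounded (f ` mspace m) \<and> open U}"

text \<open>The library's metric spaces carry a distance that is symmetric and nonnegative also outside
  the carrier; hence the default value.\<close>

definition tv_dist :: "'a metric \<Rightarrow> 'a measure \<Rightarrow> 'a measure \<Rightarrow> real" where
  "tv_dist m P Q = (if P \<in> borel_probs m \<and> Q \<in> borel_probs m
     then SUP S\<in>sets (borel_space m). \<bar>measure P S - measure Q S\<bar> else 0)"

definition tv_metric :: "'a metric \<Rightarrow> 'a measure metric" where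
  "tv_metric m = metric (borel_probs m, tv_dist m)"

lemma borel_probs_iff:
  "P \<in> borel_probs m \<longleftrightarrow> prob_space P \<and> sets P = sets (borel_space m)"
  by (auto simp: borel_probs_def space_prob_algebra)

lemma tv_dist_bdd:
  assumes "P \<in> borel_probs m" "Q \<in> borel_probs m"
  shows "bdd_above ((\<lambda>S. \<bar>measure P S - measure Q S\<bar>) ` sets (borel_space m))"
proof -
  interpret P: prob_space P using assms by (simp add: borel_probs_iff)
  interpret Q: prob_space Q using assms by (simp add: borel_probs_iff)
  have "\<bar>measure P S - measure Q S\<bar> \<le> 1" for S
    using P.prob_le_1[of S] Q.prob_le_1[of S] measure_nonneg[of P S] measure_nonneg[of Q S]
    by linarith
  then show ?thesis by (auto intro!: bdd_aboveI2)
qed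

lemma tv_dist_upper:
  assumes "P \<in> borel_probs m" "Q \<in> borel_probs m" "S \<in> sets (borel_space m)"
  shows "\<bar>measure P S - measure Q S\<bar> \<le> tv_dist m P Q"
  using assms cSUP_upper[OF assms(3) tv_dist_bdd[OF assms(1,2)]] by (simp add: tv_dist_def)

lemma Metric_space_tv: "Metric_space (borel_probs m) (tv_dist m)"
proof
  fix P Q
  show "0 \<le> tv_dist m P Q"
  proof (cases "P \<in> borel_probs m \<and> Q \<in> borel_probs m")
    case True
    then show ?thesis using tv_dist_upper[of P m Q "{}"] by simp
  qed (auto simp: tv_dist_def)
  show "tv_dist m P Q = tv_dist m Q P"
    by (auto simp: tv_dist_def abs_minus_commute)
next
  fix P Q assume PQ: "P \<in> borel_probs m" "Q \<in> borel_probs m"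
  show "(tv_dist m P Q = 0) = (P = Q)"
  proof
    assume 0: "tv_dist m P Q = 0"
    interpret P: prob_space P using PQ by (simp add: borel_probs_iff)
    interpret Q: prob_space Q using PQ by (simp add: borel_probs_iff)
    show "P = Q"
    proof (rule measure_eqI)
      show "sets P = sets Q" using PQ by (simp add: borel_probs_iff)
      fix S assume "S \<in> sets P"
      then show "emeasure P S = emeasure Q S"
        using tv_dist_upper[OF PQ, of S] 0 PQ
        by (simp add: borel_probs_iff P.emeasure_eq_measure Q.emeasure_eq_measure)
    qed
  next
    assume "P = Q"
    moreover have "sets (borel_space m) \<noteq> {}" using sets.empty_sets by blast
    ultimately show "tv_dist m P Q = 0"
      by (auto simp: tv_dist_def)
  qed
next
  fix P Q R assume PQR: "P \<in> borel_probs m" "Q \<in> borel_probs m" "R \<in> borel_probs m"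
  have "\<bar>measure P S - measure R S\<bar> \<le> tv_dist m P Q + tv_dist m Q R"
    if "S \<in> sets (borel_space m)" for S
    using tv_dist_upper[OF PQR(1,2) that] tv_dist_upper[OF PQR(2,3) that] by linarith
  then have "(SUP S\<in>sets (borel_space m). \<bar>measure P S - measure R S\<bar>)
      \<le> tv_dist m P Q + tv_dist m Q R"
    by (intro cSUP_least) (use sets.empty_sets in blast)+
  then show "tv_dist m P R \<le> tv_dist m P Q + tv_dist m Q R"
    using PQR by (simp add: tv_dist_def)
qed

lemma mspace_tv_metric: "mspace (tv_metric m) = borel_probs m"
  by (simp add: tv_metric_def Metric_space.mspace_metric Metric_space_tv)

lemma mdist_tv_metric: "mdist (tv_metric m) = tv_dist m"
  by (simp add: tv_metric_def Metric_space.mdist_metric Metric_space_tv)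

lemma topspace_weak_topology: "topspace (weak_topology m) = borel_probs m"
proof -
  have "borel_probs m \<in> {{P \<in> borel_probs m. (\<integral>x. f x \<partial>P) \<in> U} | f U.
        continuous_map (mtopology_of m) euclideanreal f \<and> bounded (f ` mspace m) \<and> open U}"
    by (rule CollectI, intro exI[of _ "\<lambda>_. 0"] exI[of _ UNIV]) (auto simp: bounded_def)
  then show ?thesis
    unfolding weak_topology_def topology_generated_by_topspace by blast
qed

definition open_dense_in :: "'a topology \<Rightarrow> 'a set \<Rightarrow> 'a set \<Rightarrow> bool" where
  "open_dense_in T M F \<longleftrightarrow> openin (subtopology T M) F \<and> (subtopology T M) closure_of F = M"

end

theory Submission
  imports Defs "HOL-Computational_Algebra.Polynomial"
begin

text \<open>Openness: joint densities of the class are uniformly bounded and equicontinuous, so weak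
  closeness to a given model forces closeness in total variation (a converse to Scheffe's theorem),
  and the failure of a conditional independence persists under small total variation changes because
  conditional probabilities vary Lipschitz continuously in the mean. Density: mixing the conditional
  densities of a model with those of a faithful one with weight \<open>l\<close> stays in the class, and after
  clearing denominators a conditional independence becomes the almost sure vanishing of a polynomial
  in \<open>l\<close>. As it fails at \<open>l = 1\<close> it holds for finitely many \<open>l\<close> only. Every model of the class
  satisfies the separations of the graph, since a d-separation splits the joint density of the
  ancestral set into two factors.\<close>

section \<open>Walks and d-separation\<close>

text \<open>The state spaces need not be locally compact, so no compactness of the class is
  available; equicontinuity is combined instead with finitely many small balls that carry almost all
  the mass of the one fixed model. On the class the two topologies agree, so it is enough to find
  total variation balls for openness and faithful models close in total variation for density.

  The reference measure is only \<sigma>-finite, and restricted to the events of a few coordinates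
  it may fail to be so, which rules out conditional expectations under it. All mixtures are
  therefore compared with the mixture of weight 1/2. It is a probability measure, it dominates every
  mixture with weight in [0,1], and relative to it the coefficients of the polynomial in
  \<open>l\<close> are bounded by 2 to the number of vertices.

  The Markov property needs the reachable vertices to be closed under single steps. Extending a path
  may repeat a vertex, so the combinatorics is done with walks, and loops are cut out only when a
  walk is confronted with the definition of d-separation.\<close>

definition open_at :: "('v \<times> 'v) set \<Rightarrow> 'v set \<Rightarrow> 'v \<Rightarrow> 'v \<Rightarrow> 'v \<Rightarrow> bool" where
  "open_at E C u v w \<longleftrightarrow>
     (if (u, v) \<in> E \<and> (w, v) \<in> E then v \<in> ancestors E C else v \<notin> C)"

fun open_inside :: "('v \<times> 'v) set \<Rightarrow> 'v set \<Rightarrow> 'v list \<Rightarrow> bool" where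
  "open_inside E C (u # v # w # p) \<longleftrightarrow> open_at E C u v w \<and> open_inside E C (v # w # p)"
| "open_inside E C _ \<longleftrightarrow> True"

text \<open>Vertices may repeat, so a walk is extended by checking its last inner vertex only. The
  ends count as non-colliders and must avoid \<open>C\<close>.\<close>

definition active_walk :: "'v set \<Rightarrow> ('v \<times> 'v) set \<Rightarrow> 'v set \<Rightarrow> 'v list \<Rightarrow> bool" where
  "active_walk V E C p \<longleftrightarrow> p \<noteq> [] \<and> set p \<subseteq> V \<and>
     successively (\<lambda>u v. (u, v) \<in> E \<or> (v, u) \<in> E) p \<and>
     hd p \<notin> C \<and> last p \<notin> C \<and> open_inside E C p"

text \<open>Whether an inner vertex is open depends on both its neighbours, so the two pieces have
  to overlap in two vertices.\<close>

lemma open_inside_append: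
  "open_inside E C (p @ u # v # q) \<longleftrightarrow> open_inside E C (p @ [u, v]) \<and> open_inside E C (u # v # q)"
proof (induction p)
  case (Cons a p)
  then show ?case by (cases p rule: list.exhaust; cases "tl p") auto
qed simp

lemma open_inside_nth:
  assumes "open_inside E C p" "Suc (Suc i) < length p"
  shows "open_at E C (p ! i) (p ! Suc i) (p ! Suc (Suc i))"
  using assms
proof (induction E C p arbitrary: i rule: open_inside.induct)
  case (1 E C u v w p)
  then show ?case by (cases i) auto
qed auto

lemma not_blockedI:
  assumes "active_walk V E C p"
  shows "\<not> blocked E C p"
proof
  assume "blocked E C p"
  then obtain i where i: "i < length p"
    and b: "collider E p i \<and> p ! i \<notin> ancestors E C \<or> \<not> collider E p i \<and> p ! i \<in> C"
    by (auto simp: blocked_def)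
  have p: "p \<noteq> []" "hd p \<notin> C" "last p \<notin> C" "open_inside E C p"
    using assms by (auto simp: active_walk_def)
  consider "i = 0" | "i + 1 = length p" | "0 < i" "i + 1 < length p" using i by linarith
  then show False
  proof cases
    case 1
    then show False using b p by (simp add: collider_def hd_conv_nth)
  next
    case 2
    then have "i = length p - 1" by simp
    then show False using b p 2 by (simp add: collider_def last_conv_nth)
  next
    case 3
    then have "open_at E C (p ! (i - 1)) (p ! i) (p ! (i + 1))"
      using p(4) open_inside_nth[of E C p "i - 1"] by simp
    then show False using b 3 by (auto simp: open_at_def collider_def split: if_splits)
  qed
qed

locale dag_graph =
  fixes V :: "'v set" and E :: "('v \<times> 'v) set"
  assumes dag: "dag V E"
begin

lemma finite_V: "finite V" and edges: "E \<subseteq> V \<times> V" and acyclic: "acyclic E"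
  using dag by (auto simp: dag_def)

lemma asym_edge: "(u, v) \<in> E \<Longrightarrow> (v, u) \<notin> E"
  using acyclic by (meson acyclic_def trancl.r_into_trancl trancl_into_trancl)

lemma irrefl_edge: "(u, u) \<notin> E"
  using asym_edge by blast

lemma pa_subset: "pa E v \<subseteq> V"
  using edges by (auto simp: pa_def)

lemma not_in_pa: "v \<notin> pa E v"
  by (simp add: pa_def irrefl_edge)

lemma finite_pa: "finite (pa E v)"
  using pa_subset finite_V finite_subset by blast

lemma ancestors_subset: "C \<subseteq> V \<Longrightarrow> ancestors E C \<subseteq> V"
  using edges by (auto simp: ancestors_def elim: converse_rtranclE)

lemma pa_ancestors: "v \<in> ancestors E C \<Longrightarrow> pa E v \<subseteq> ancestors E C"
  by (auto simp: ancestors_def pa_def intro: converse_rtrancl_into_rtrancl)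

text \<open>Follow the arrows out of \<open>v\<close>. Either they all point onwards and lead to the
  end of the walk, or the first one that does not creates a collider; being open it is an ancestor
  of \<open>C\<close>, and so is \<open>v\<close> above it.\<close>

lemma outgoing_walk_end:
  assumes "successively (\<lambda>u v. (u, v) \<in> E \<or> (v, u) \<in> E) (v # y # r)"
    and "open_inside E C (v # y # r)" "(v, y) \<in> E"
  shows "(v, last (y # r)) \<in> E\<^sup>+ \<or> v \<in> ancestors E C"
  using assms
proof (induction r arbitrary: v y)
  case (Cons z r)
  show ?case
  proof (cases "(z, y) \<in> E")
    case True
    then have "y \<in> ancestors E C" using Cons.prems by (simp add: open_at_def)
    then show ?thesis using Cons.prems(3)
      by (auto simp: ancestors_def intro: converse_rtrancl_into_rtrancl)
  next
    case False
    then have "(y, last (z # r)) \<in> E\<^sup>+ \<or> y \<in> ancestors E C"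
      using Cons.prems by (intro Cons.IH) auto
    then show ?thesis using Cons.prems(3)
      by (auto simp: ancestors_def intro: converse_rtrancl_into_rtrancl trancl_into_trancl2)
  qed
qed auto

text \<open>If cutting out a loop at \<open>v\<close> turns \<open>v\<close> into a collider that it was not before, then the loop
  leaves \<open>v\<close> along an arrow and, the graph being acyclic, runs into a collider below \<open>v\<close>.\<close>

lemma active_walk_shortcut:
  assumes "active_walk V E C (xs @ [v] @ ys @ [v] @ zs)"
  shows "active_walk V E C (xs @ [v] @ zs)"
proof -
  let ?adj = "\<lambda>u v. (u, v) \<in> E \<or> (v, u) \<in> E"
  have suc: "successively ?adj (xs @ [v] @ ys @ [v] @ zs)"
    and op: "open_inside E C (xs @ [v] @ ys @ [v] @ zs)"
    using assms by (auto simp: active_walk_def)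
  have "ys \<noteq> []" using suc irrefl_edge by (auto simp: successively_append_iff)
  then obtain y ys' y' ys'' where y: "ys = y # ys'" "ys = ys'' @ [y']"
    by (metis neq_Nil_conv rev_exhaust)
  have zop: "open_inside E C (v # zs)"
  proof (cases zs)
    case (Cons z zs')
    then show ?thesis using op open_inside_append[of E C "xs @ [v] @ ys" v z zs'] by simp
  qed simp
  have xop: "open_inside E C (xs @ [v])"
  proof (cases xs rule: rev_exhaust)
    case (snoc xs' x)
    then show ?thesis using op open_inside_append[of E C xs' x v "ys @ [v] @ zs"] by simp
  qed simp
  have "open_inside E C (xs @ [v] @ zs)"
  proof (cases "xs = [] \<or> zs = []")
    case True
    then show ?thesis using xop zop by auto
  next
    case False
    then obtain xs' x z zs' where xz: "xs = xs' @ [x]" "zs = z # zs'"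
      by (metis neq_Nil_conv rev_exhaust)
    have o1: "open_at E C x v y"
      using op open_inside_append[of E C xs' x v "ys @ [v] @ zs"] y xz by simp
    have "open_inside E C ((xs @ [v] @ ys'') @ y' # v # zs)" using op y(2) by simp
    then have o2: "open_at E C y' v z"
      using open_inside_append[of E C "xs @ [v] @ ys''" y' v zs] xz(2) by simp
    have "open_inside E C (xs @ v # y # ys' @ [v] @ zs)" using op y(1) by simp
    then have "open_inside E C (v # y # ys' @ [v] @ zs)"
      using open_inside_append[of E C "xs" v y "ys' @ [v] @ zs"] by blast
    moreover have "v # y # ys' @ [v] @ zs = (v # ys'') @ y' # v # zs" using y by simp
    moreover have "v # y # ys' @ [v] = (v # ys'') @ [y', v]" using y by simp
    ultimately have o3: "open_inside E C (v # y # ys' @ [v])"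
      using open_inside_append[of E C "v # ys''" y' v "zs"] by metis
    have "successively ?adj (v # ys @ [v])"
      using suc \<open>ys \<noteq> []\<close> by (simp add: successively_append_iff successively_Cons)
    then have s3: "successively ?adj (v # y # ys' @ [v])" using y(1) by simp
    have "open_at E C x v z"
    proof (cases "(x, v) \<in> E \<and> (z, v) \<in> E")
      case True
      have "v \<in> ancestors E C"
      proof (cases "(y, v) \<in> E")
        case True
        then show ?thesis using o1 \<open>(x, v) \<in> E \<and> _\<close> by (simp add: open_at_def)
      next
        case False
        then have "(v, y) \<in> E" using s3 by auto
        from outgoing_walk_end[OF s3 o3 this] show ?thesis
          using acyclic by (simp add: acyclic_def)
      qed
      then show ?thesis using True by (simp add: open_at_def)
    next
      case False
      \<comment> \<open>One of the two edges kept at \<open>v\<close> leaves \<open>v\<close>; at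
        the visit that used this edge \<open>v\<close> was a non-collider, so it is outside
        \<open>C\<close>.\<close>
      then show ?thesis using o1 o2 by (auto simp: open_at_def split: if_splits)
    qed
    moreover have "open_inside E C (x # v # zs) \<longleftrightarrow> open_at E C x v z \<and> open_inside E C (v # zs)"
      using xz by simp
    ultimately show ?thesis using xop zop xz open_inside_append[of E C xs' x v zs] by simp
  qed
  moreover have "successively ?adj (xs @ [v] @ zs)"
    using suc by (cases zs) (simp_all add: successively_append_iff successively_Cons)
  ultimately show ?thesis
    using assms by (cases xs; cases zs) (auto simp: active_walk_def)
qed

text \<open>Cutting out a loop shortens an active walk and keeps its ends. When nothing repeats any
  more the walk is a path, which d-separation would have to block.\<close>

lemma d_separated_no_active_walk:
  assumes "d_separated V E A B C" "active_walk V E C p" "hd p \<in> A"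
  shows "last p \<notin> B"
  using assms(2,3)
proof (induction p rule: length_induct)
  case (1 p)
  show ?case
  proof (cases "distinct p")
    case True
    then have "is_path V E p" using 1 by (auto simp: active_walk_def is_path_def)
    then show ?thesis using 1 not_blockedI assms(1) unfolding d_separated_def by blast
  next
    case False
    then obtain xs v ys zs where p: "p = xs @ [v] @ ys @ [v] @ zs"
      using not_distinct_decomp by blast
    let ?q = "xs @ [v] @ zs"
    have "active_walk V E C ?q" using 1 p active_walk_shortcut by blast
    moreover have "hd ?q = hd p" "last ?q = last p" "length ?q < length p"
      using p by (auto simp: hd_append)
    ultimately show ?thesis using 1 by metis
  qed
qed

section \<open>Vertices reachable by active walks\<close>

definition reachable :: "'v set \<Rightarrow> 'v set \<Rightarrow> 'v \<Rightarrow> bool" where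
  "reachable A C w \<longleftrightarrow> (\<exists>p. active_walk V E C p \<and> hd p \<in> A \<and> last p = w)"

text \<open>The last edge points away from \<open>w\<close>, so \<open>w\<close> is a non-collider
  however the walk goes on. Such a walk may climb to the parents of \<open>w\<close> even if
  \<open>w\<close> is no ancestor of \<open>C\<close>.\<close>

definition reachable_by_tail :: "'v set \<Rightarrow> 'v set \<Rightarrow> 'v \<Rightarrow> bool" where
  "reachable_by_tail A C w \<longleftrightarrow>
     (\<exists>p. active_walk V E C (p @ [w]) \<and> hd (p @ [w]) \<in> A \<and> (p \<noteq> [] \<longrightarrow> (w, last p) \<in> E))"

lemma reachable_snoc:
  assumes p: "active_walk V E C (p @ [u])" "hd (p @ [u]) \<in> A"
    and uw: "(u, w) \<in> E \<or> (w, u) \<in> E" and w: "w \<notin> C"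
    and o: "p \<noteq> [] \<Longrightarrow> open_at E C (last p) u w"
  shows "active_walk V E C ((p @ [u]) @ [w]) \<and> hd ((p @ [u]) @ [w]) \<in> A"
proof -
  have "open_inside E C ((p @ [u]) @ [w])"
  proof (cases p rule: rev_exhaust)
    case (snoc p' x)
    then show ?thesis using p o open_inside_append[of E C p' x u "[w]"]
      by (simp add: active_walk_def)
  qed simp
  then show ?thesis using p uw w edges
    by (auto simp: active_walk_def successively_append_iff hd_append split: if_splits)
qed

lemma reachableE:
  assumes "reachable A C u"
  obtains p where "active_walk V E C (p @ [u])" "hd (p @ [u]) \<in> A" "u \<notin> C"
proof -
  obtain q where q: "active_walk V E C q" "hd q \<in> A" "last q = u"
    using assms by (auto simp: reachable_def)
  have "q = butlast q @ [u]" using q by (metis active_walk_def append_butlast_last_id)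
  then show ?thesis using q that[of "butlast q"] by (auto simp: active_walk_def)
qed

text \<open>The new step leaves \<open>u\<close> along an arrow, so \<open>u\<close> is a
  non-collider there, and as the end of an active walk it is outside \<open>C\<close>.\<close>

lemma reachable_child:
  assumes "reachable A C u" "(u, w) \<in> E" "w \<notin> C"
  shows "reachable A C w"
proof -
  obtain p where p: "active_walk V E C (p @ [u])" "hd (p @ [u]) \<in> A" "u \<notin> C"
    using assms reachableE by blast
  show ?thesis
    using reachable_snoc[OF p(1,2), of w] assms p asym_edge
    unfolding reachable_def open_at_def by (metis last_snoc)
qed

text \<open>However the walk entered \<open>u\<close>, it may pass: as a collider because
  \<open>u\<close> is an ancestor of \<open>C\<close>, as a non-collider because \<open>u\<close> is
  outside \<open>C\<close>.\<close>

lemma reachable_parent: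
  assumes "reachable A C u" "(w, u) \<in> E" "w \<notin> C" "u \<in> ancestors E C"
  shows "reachable A C w"
proof -
  obtain p where p: "active_walk V E C (p @ [u])" "hd (p @ [u]) \<in> A" "u \<notin> C"
    using assms reachableE by blast
  show ?thesis
    using reachable_snoc[OF p(1,2), of w] assms p
    unfolding reachable_def open_at_def by (metis last_snoc)
qed

text \<open>Two steps at once, because \<open>v\<close> may lie in \<open>C\<close>, where no active
  walk can end; the walk passes through \<open>v\<close> as an open collider.\<close>

lemma reachable_coparent:
  assumes "reachable A C u" "(u, v) \<in> E" "(w, v) \<in> E" "w \<notin> C" "v \<in> ancestors E C"
  shows "reachable A C w"
proof -
  obtain p where p: "active_walk V E C (p @ [u])" "hd (p @ [u]) \<in> A" "u \<notin> C"
    using assms reachableE by blast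
  have "open_inside E C (p @ [u, v, w])"
  proof (cases p rule: rev_exhaust)
    case (snoc p' x)
    have "open_at E C x u v" using p assms asym_edge by (auto simp: open_at_def)
    then show ?thesis using p assms snoc open_inside_append[of E C p' x u "[v, w]"]
      by (simp add: active_walk_def open_at_def)
  qed (use assms in \<open>simp add: open_at_def\<close>)
  then have "active_walk V E C (p @ [u, v, w])" using p assms edges
    by (auto simp: active_walk_def successively_append_iff hd_append split: if_splits)
  moreover have "hd (p @ [u, v, w]) \<in> A" using p by (cases p) auto
  ultimately show ?thesis unfolding reachable_def by (intro exI[of _ "p @ [u, v, w]"]) auto
qed

lemma reachable_by_tail_parent:
  assumes "reachable_by_tail A C u" "(w, u) \<in> E" "w \<notin> C" "u \<notin> C"
  shows "reachable_by_tail A C w"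
proof -
  obtain p where p: "active_walk V E C (p @ [u])" "hd (p @ [u]) \<in> A"
    "p \<noteq> [] \<longrightarrow> (u, last p) \<in> E"
    using assms by (auto simp: reachable_by_tail_def)
  have "active_walk V E C ((p @ [u]) @ [w]) \<and> hd ((p @ [u]) @ [w]) \<in> A"
    using reachable_snoc[OF p(1,2), of w] assms p asym_edge unfolding open_at_def by metis
  then show ?thesis unfolding reachable_by_tail_def using assms
    by (intro exI[of _ "p @ [u]"]) auto
qed

text \<open>Walk the directed path from \<open>u\<close> to \<open>a\<close> backwards. Its vertices
  lie below \<open>u\<close>, so none of them is an ancestor of \<open>C\<close> and in particular
  none is in \<open>C\<close>.\<close>

lemma reachable_by_tail_ancestor:
  assumes "a \<in> A" "A \<subseteq> V" "(u, a) \<in> E\<^sup>*" "u \<notin> ancestors E C"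
  shows "reachable_by_tail A C u"
  using assms(3,4)
proof (induction rule: converse_rtrancl_induct)
  case base
  then show ?case using assms(1,2)
    by (auto simp: reachable_by_tail_def active_walk_def ancestors_def intro!: exI[of _ "[]"])
next
  case (step u u')
  then have "u' \<notin> ancestors E C"
    by (auto simp: ancestors_def intro: converse_rtrancl_into_rtrancl)
  moreover have "u \<notin> C" "u' \<notin> C" using step.prems calculation by (auto simp: ancestors_def)
  ultimately show ?case using step reachable_by_tail_parent by blast
qed

lemma reachable_descendant:
  assumes "(u, b) \<in> E\<^sup>*" "reachable A C u" "u \<notin> ancestors E C"
  shows "reachable A C b"
  using assms
proof (induction rule: converse_rtrancl_induct)
  case (step u u')
  then have "u' \<notin> ancestors E C"
    by (auto simp: ancestors_def intro: converse_rtrancl_into_rtrancl)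
  moreover have "u' \<notin> C" using calculation by (auto simp: ancestors_def)
  ultimately show ?case using step reachable_child by blast
qed

text \<open>No family contains both reachable and unreachable vertices outside \<open>C\<close>,
  hence each factor of the joint density sees one side only. The delicate step goes from
  \<open>v\<close> to a parent when \<open>v\<close> is no ancestor of \<open>C\<close>. Then
  \<open>v\<close> lies above \<open>A\<close> or \<open>B\<close>. Above \<open>B\<close> it would
  make a vertex of \<open>B\<close> reachable by descending; so it lies above \<open>A\<close>, can
  be reached from there against the arrows, and the climb continues.\<close>

lemma reachable_family:
  assumes A: "A \<subseteq> V" and sep: "\<And>b. b \<in> B \<Longrightarrow> \<not> reachable A C b"
    and v: "v \<in> ancestors E (A \<union> B \<union> C)"
    and u: "u \<in> insert v (pa E v)" "reachable A C u"
    and w: "w \<in> insert v (pa E v)" "w \<notin> C"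
  shows "reachable A C w"
proof -
  have parent: "reachable A C w" if r: "reachable A C v" and w: "(w, v) \<in> E" "w \<notin> C" for w
  proof (cases "v \<in> ancestors E C")
    case True
    then show ?thesis using reachable_parent r w by blast
  next
    case False
    then obtain c where c: "c \<in> A \<union> B" "(v, c) \<in> E\<^sup>*" using v by (auto simp: ancestors_def)
    have "c \<notin> B" using reachable_descendant[OF c(2) r False] sep by blast
    then have "reachable_by_tail A C v" using c reachable_by_tail_ancestor A False by blast
    moreover have "v \<notin> C" using False by (auto simp: ancestors_def)
    ultimately have "reachable_by_tail A C w" using reachable_by_tail_parent w by blast
    then show ?thesis by (auto simp: reachable_by_tail_def reachable_def)
  qed
  show ?thesis
  proof (cases "u = v")
    case True
    then show ?thesis using parent u w by (auto simp: pa_def)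
  next
    case False
    then have uv: "(u, v) \<in> E" using u by (simp add: pa_def)
    show ?thesis
    proof (cases "w = v")
      case True
      then show ?thesis using uv u w reachable_child by blast
    next
      case False
      then have wv: "(w, v) \<in> E" using w by (simp add: pa_def)
      show ?thesis
      proof (cases "v \<in> ancestors E C")
        case True
        then show ?thesis using reachable_coparent u uv wv w by blast
      next
        case False
        then have "v \<notin> C" by (auto simp: ancestors_def)
        then show ?thesis using parent wv w reachable_child u uv by blast
      qed
    qed
  qed
qed

text \<open>\<open>D\<close> collects the vertices of the ancestral set outside \<open>C\<close>
  that are reachable from \<open>A\<close>. By \<open>reachable_family\<close>, a family that meets
  \<open>D\<close> has all its other members in \<open>D\<close> or in \<open>C\<close>.\<close>

lemma d_separated_split:
  assumes sep: "d_separated V E A B C" and sub: "A \<subseteq> V" "B \<subseteq> V" "C \<subseteq> V"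
  defines "W \<equiv> ancestors E (A \<union> B \<union> C)"
  obtains D where "D \<subseteq> W" "D \<inter> C = {}" "A \<subseteq> D \<union> C" "D \<inter> B = {}"
    "\<And>v. v \<in> W \<Longrightarrow> insert v (pa E v) \<subseteq> D \<union> C \<or> insert v (pa E v) \<inter> D = {}"
proof
  let ?D = "{w \<in> W - C. reachable A C w}"
  have notB: "\<not> reachable A C b" if "b \<in> B" for b
    using d_separated_no_active_walk[OF sep] that by (auto simp: reachable_def)
  show "?D \<subseteq> W" "?D \<inter> C = {}" by auto
  show "?D \<inter> B = {}" using notB by auto
  show "A \<subseteq> ?D \<union> C"
  proof
    fix a assume "a \<in> A"
    then have "a \<notin> C \<Longrightarrow> reachable A C a" using sub
      by (auto simp: reachable_def active_walk_def intro!: exI[of _ "[a]"])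
    moreover have "a \<in> W" using \<open>a \<in> A\<close> by (auto simp: W_def ancestors_def)
    ultimately show "a \<in> ?D \<union> C" by auto
  qed
  fix v assume v: "v \<in> W"
  have sub: "insert v (pa E v) \<subseteq> W" using v pa_ancestors by (auto simp: W_def)
  show "insert v (pa E v) \<subseteq> ?D \<union> C \<or> insert v (pa E v) \<inter> ?D = {}"
  proof (rule disjCI)
    assume "insert v (pa E v) \<inter> ?D \<noteq> {}"
    then obtain u where u: "u \<in> insert v (pa E v)" "reachable A C u" by auto
    show "insert v (pa E v) \<subseteq> ?D \<union> C"
      using reachable_family[OF \<open>A \<subseteq> V\<close> notB _ u] v sub by (auto simp: W_def)
  qed
qed

end

section \<open>Conditional independence of events\<close>

definition unit_clip :: "real \<Rightarrow> real" where
  "unit_clip t = max 0 (min 1 t)"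

lemma unit_clip_range: "0 \<le> unit_clip t" "unit_clip t \<le> 1"
  by (auto simp: unit_clip_def)

lemma unit_clip_id: "0 \<le> t \<Longrightarrow> t \<le> 1 \<Longrightarrow> unit_clip t = t"
  by (auto simp: unit_clip_def)

lemma borel_measurable_unit_clip [measurable]: "unit_clip \<in> borel_measurable borel"
  unfolding unit_clip_def by measurable

lemma prob_space_borel_probs: "P \<in> borel_probs m \<Longrightarrow> prob_space P"
  and sets_borel_probs: "P \<in> borel_probs m \<Longrightarrow> sets P = sets (borel_space m)"
  by (auto simp: borel_probs_iff)

lemma space_borel_space: "space (borel_space m) = mspace m"
  by (simp add: borel_space_def space_measure_of_conv)

lemma space_borel_probs: "P \<in> borel_probs m \<Longrightarrow> space P = mspace m"
  using sets_eq_imp_space_eq[OF sets_borel_probs] space_borel_space by metis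

text \<open>The number of levels \<open>k / n\<close> that \<open>t\<close> reaches is the integer
  part of \<open>n * t\<close>.\<close>

lemma staircase_approx:
  fixes t :: real
  assumes "0 \<le> t" "t \<le> 1" "0 < n"
  shows "\<bar>t - (\<Sum>k\<in>{1..n}. indicator {s. real k / real n \<le> s} t) / real n\<bar> \<le> 1 / real n"
proof -
  have "(\<Sum>k\<in>{1..n}. indicator {s. real k / real n \<le> s} t :: real)
      = real (card {k\<in>{1..n}. real k \<le> real n * t})"
    using assms by (simp add: indicator_def sum.If_cases Int_def field_simps)
  also have "{k\<in>{1..n}. real k \<le> real n * t} = {1..nat \<lfloor>real n * t\<rfloor>}"
  proof -
    have "k \<le> nat \<lfloor>real n * t\<rfloor> \<longleftrightarrow> real k \<le> real n * t" for k
      using assms by (simp add: le_nat_iff le_floor_iff)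
    moreover have "real k \<le> real n * t \<Longrightarrow> k \<le> n" for k
      using assms mult_left_le[of t "real n"] by linarith
    ultimately show ?thesis by auto
  qed
  finally have eq: "(\<Sum>k\<in>{1..n}. indicator {s. real k / real n \<le> s} t) = real_of_int \<lfloor>real n * t\<rfloor>"
    using assms by simp
  have "\<bar>real n * t - \<lfloor>real n * t\<rfloor>\<bar> \<le> 1" by linarith
  then have "\<bar>real n * t - \<lfloor>real n * t\<rfloor>\<bar> / real n \<le> 1 / real n"
    using assms by (simp add: divide_right_mono)
  moreover have "t - \<lfloor>real n * t\<rfloor> / real n = (real n * t - \<lfloor>real n * t\<rfloor>) / real n"
    using assms by (simp add: field_simps)
  ultimately show ?thesis unfolding eq using assms by simp
qed

text \<open>Up to \<open>1 / n\<close> each integral is the average of the probabilities of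
  \<open>n\<close> superlevel sets, and each of these moves by at most \<open>tv_dist m P Q\<close>;
  averaging costs no constant.\<close>

lemma tv_dist_integral:
  assumes P: "P \<in> borel_probs m" and Q: "Q \<in> borel_probs m"
    and g: "g \<in> borel_measurable (borel_space m)"
    and g01: "\<And>x. x \<in> mspace m \<Longrightarrow> 0 \<le> g x \<and> g x \<le> 1"
  shows "\<bar>(\<integral>x. g x \<partial>P) - (\<integral>x. g x \<partial>Q)\<bar> \<le> tv_dist m P Q"
proof -
  define s where "s n x = (\<Sum>k\<in>{1..n}. indicator {x\<in>mspace m. real k / real n \<le> g x} x) / real n"
    for n :: nat and x
  have lev [measurable]: "{x\<in>mspace m. r \<le> g x} \<in> sets (borel_space m)" for r
    using g unfolding space_borel_space[symmetric] by measurable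
  have main: "\<bar>(\<integral>x. g x \<partial>N) - (\<Sum>k\<in>{1..n}. measure N {x\<in>mspace m. real k / real n \<le> g x}) / n\<bar> \<le> 1 / n"
    if N: "N \<in> borel_probs m" and n: "0 < n" for N and n :: nat
  proof -
    interpret prob_space N using N by (rule prob_space_borel_probs)
    note sets = sets_borel_probs[OF N, measurable_cong]
    have sp: "space N = mspace m" using N by (rule space_borel_probs)
    have gN [measurable]: "g \<in> borel_measurable N" using g by measurable
    have ig: "integrable N g"
      by (rule integrable_const_bound[of _ 1]) (use g01 sp in auto)
    have sn: "integrable N (s n)" unfolding s_def
      by (intro integrable_divide integrable_sum) (simp add: integrable_indicator_iff sets emeasure_eq_measure)
    have sub: "{x\<in>mspace m. r \<le> g x} \<inter> mspace m = {x\<in>mspace m. r \<le> g x}" for r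
      by auto
    have eq: "(\<integral>x. s n x \<partial>N)
        = (\<Sum>k\<in>{1..n}. measure N {x\<in>mspace m. real k / real n \<le> g x}) / n"
      unfolding s_def
      by (subst integral_divide_zero, subst Bochner_Integration.integral_sum)
        (auto simp: integrable_indicator_iff sets emeasure_eq_measure sp Int_absorb2 sub)
    have "\<bar>g x - s n x\<bar> \<le> 1 / n" if "x \<in> space N" for x
      using staircase_approx[of "g x" n] g01[of x] that n sp
      by (simp add: s_def indicator_def)
    then have "\<bar>\<integral>x. g x - s n x \<partial>N\<bar> \<le> (\<integral>x. 1 / n \<partial>N)"
      using ig sn by (intro order_trans[OF integral_abs_bound] integral_mono) auto
    then show ?thesis using eq ig sn by (simp add: prob_space)
  qed
  have bound: "\<bar>(\<integral>x. g x \<partial>P) - (\<integral>x. g x \<partial>Q)\<bar> \<le> tv_dist m P Q + 2 * inverse (real (Suc n))" for n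
  proof -
    let ?S = "\<lambda>k. {x\<in>mspace m. real k / real (Suc n) \<le> g x}"
    let ?c = "\<lambda>N. (\<Sum>k\<in>{1..Suc n}. measure N (?S k)) / real (Suc n)"
    have "\<bar>(\<Sum>k\<in>{1..Suc n}. measure P (?S k)) - (\<Sum>k\<in>{1..Suc n}. measure Q (?S k))\<bar>
        \<le> (\<Sum>k\<in>{1..Suc n}. \<bar>measure P (?S k) - measure Q (?S k)\<bar>)"
      unfolding sum_subtractf[symmetric] by (rule sum_abs)
    also have "\<dots> \<le> (\<Sum>k\<in>{1..Suc n}. tv_dist m P Q)"
      by (intro sum_mono tv_dist_upper[OF P Q] lev)
    finally have "\<bar>?c P - ?c Q\<bar> \<le> tv_dist m P Q"
      by (simp add: diff_divide_distrib[symmetric] field_simps)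
    moreover have "\<bar>(\<integral>x. g x \<partial>P) - ?c P\<bar> \<le> inverse (real (Suc n))"
      "\<bar>(\<integral>x. g x \<partial>Q) - ?c Q\<bar> \<le> inverse (real (Suc n))"
      using main[OF P, of "Suc n"] main[OF Q, of "Suc n"] by (simp_all only: inverse_eq_divide zero_less_Suc)
    ultimately show ?thesis by linarith
  qed
  have "(\<lambda>n. tv_dist m P Q + 2 * inverse (real (Suc n))) \<longlonglongrightarrow> tv_dist m P Q + 2 * 0"
    by (intro tendsto_intros LIMSEQ_inverse_real_of_nat)
  then show ?thesis using bound by (intro LIMSEQ_le_const[of _ "tv_dist m P Q"]) auto
qed

text \<open>Clipping alters the conditional expectation on a null set of \<open>P\<close> only, but bounds it
  everywhere, also where another measure has mass.\<close>

definition cond_prob :: "'a measure \<Rightarrow> 'a measure \<Rightarrow> 'a set \<Rightarrow> 'a \<Rightarrow> real" where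
  "cond_prob P F S x = unit_clip (real_cond_exp P F (indicator S) x)"

definition cond_indep_events :: "'a measure \<Rightarrow> 'a measure \<Rightarrow> 'a set \<Rightarrow> 'a set \<Rightarrow> bool" where
  "cond_indep_events P F S T \<longleftrightarrow> (AE x in P. real_cond_exp P F (indicator (S \<inter> T)) x
     = real_cond_exp P F (indicator S) x * real_cond_exp P F (indicator T) x)"

lemma borel_measurable_cond_prob [measurable]: "cond_prob P F S \<in> borel_measurable F"
  unfolding cond_prob_def by measurable

lemma cond_prob_range: "0 \<le> cond_prob P F S x" "cond_prob P F S x \<le> 1"
  by (auto simp: cond_prob_def unit_clip_range)

lemma cond_prob_mult_range:
  "0 \<le> cond_prob P F S x * cond_prob P F T x" "cond_prob P F S x * cond_prob P F T x \<le> 1"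
  by (simp_all add: cond_prob_range mult_le_one)

lemma (in prob_space) finite_measure_subalgebraI:
  "subalgebra M F \<Longrightarrow> finite_measure_subalgebra M F"
  by (simp add: finite_measure_subalgebra_axioms_def finite_measure_subalgebra_def
      finite_measure_axioms)

lemma (in prob_space) cond_prob_AE:
  assumes F: "subalgebra M F" and S [measurable]: "S \<in> sets M"
  shows "AE x in M. real_cond_exp M F (indicator S) x = cond_prob M F S x"
proof -
  interpret finite_measure_subalgebra M F by (rule finite_measure_subalgebraI[OF F])
  have i: "integrable M (indicator S :: _ \<Rightarrow> real)"
    by (simp add: integrable_indicator_iff emeasure_eq_measure)
  have "AE x in M. real_cond_exp M F (indicator S) x \<ge> 0"
    by (rule real_cond_exp_ge_c[OF i]) (simp add: indicator_def)
  moreover have "AE x in M. real_cond_exp M F (indicator S) x \<le> 1"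
    by (rule real_cond_exp_le_c[OF i]) (simp add: indicator_def)
  ultimately show ?thesis by eventually_elim (simp add: cond_prob_def unit_clip_id)
qed

lemma (in prob_space) cond_prob_integral:
  assumes F: "subalgebra M F" and S [measurable]: "S \<in> sets M" and G: "G \<in> sets F"
  shows "(\<integral>x. indicator G x * cond_prob M F S x \<partial>M) = prob (S \<inter> G)"
proof -
  interpret finite_measure_subalgebra M F by (rule finite_measure_subalgebraI[OF F])
  have GM [measurable]: "G \<in> sets M" using G F by (auto simp: subalgebra_def)
  have i: "integrable M (\<lambda>x. indicator G x * indicator S x :: real)"
    using integrable_real_indicator[of "G \<inter> S" M]
    by (simp add: indicator_inter_arith[abs_def] emeasure_eq_measure)
  have [measurable]: "cond_prob M F S \<in> borel_measurable M"
    by (rule measurable_from_subalg[OF F]) measurable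
  have "(\<integral>x. indicator G x * cond_prob M F S x \<partial>M)
      = (\<integral>x. indicator G x * real_cond_exp M F (indicator S) x \<partial>M)"
    using cond_prob_AE[OF F S] by (intro integral_cong_AE) auto
  also have "\<dots> = (\<integral>x. indicator G x * indicator S x \<partial>M)"
    by (rule real_cond_exp_intg(2)[OF i]) (use G in auto)
  also have "\<dots> = (\<integral>x. indicator (S \<inter> G) x \<partial>M)"
    by (simp add: indicator_inter_arith mult.commute)
  finally show ?thesis using sets.sets_into_space[OF S] by (simp add: Int_absorb1 Int_absorb2 le_infI1)
qed

lemma cond_indep_events_iff:
  assumes "prob_space P" "subalgebra P F" and [measurable]: "S \<in> sets P" "T \<in> sets P"
  shows "cond_indep_events P F S T \<longleftrightarrow>
    (AE x in P. cond_prob P F (S \<inter> T) x = cond_prob P F S x * cond_prob P F T x)"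
proof -
  interpret prob_space P by fact
  show ?thesis unfolding cond_indep_events_def
  proof (rule eventually_subst)
    show "AE x in P. (real_cond_exp P F (indicator (S \<inter> T)) x
        = real_cond_exp P F (indicator S) x * real_cond_exp P F (indicator T) x)
      = (cond_prob P F (S \<inter> T) x = cond_prob P F S x * cond_prob P F T x)"
      using cond_prob_AE[OF assms(2,3)] cond_prob_AE[OF assms(2,4)]
        cond_prob_AE[OF assms(2) sets.Int[OF assms(3,4)]]
      by eventually_elim simp
  qed
qed

text \<open>The bound on \<open>P(S | F) - Q(S | F)\<close> comes from testing it against the two sets in \<open>F\<close> on
  which it has a constant sign.\<close>

lemma cond_prob_tv_dist:
  assumes P: "P \<in> borel_probs m" and Q: "Q \<in> borel_probs m"
    and F: "subalgebra (borel_space m) F" and S: "S \<in> sets (borel_space m)"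
  shows "(\<integral>x. \<bar>cond_prob Q F S x - cond_prob P F S x\<bar> \<partial>P) \<le> 4 * tv_dist m P Q"
proof -
  interpret P: prob_space P using P by (rule prob_space_borel_probs)
  interpret Q: prob_space Q using Q by (rule prob_space_borel_probs)
  note sP = sets_borel_probs[OF P, measurable_cong] and sQ = sets_borel_probs[OF Q]
  have spF: "space F = mspace m" using F by (simp add: subalgebra_def space_borel_space)
  have FP: "subalgebra P F" and FQ: "subalgebra Q F"
    using F sP sQ space_borel_probs[OF P] space_borel_probs[OF Q]
    by (auto simp: subalgebra_def space_borel_space)
  have SP: "S \<in> sets P" "S \<in> sets Q" using S sP sQ by auto
  have mF: "f \<in> borel_measurable F \<Longrightarrow> f \<in> borel_measurable (borel_space m)" for f :: "_ \<Rightarrow> real"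
    using measurable_from_subalg[OF F] .
  have mb: "cond_prob N F S \<in> borel_measurable P" for N
    by (rule measurable_from_subalg[OF FP]) measurable
  note [measurable] = mb[of P] mb[of Q]
  have ib: "integrable P (\<lambda>x. indicator G x * cond_prob N F S x)" if "G \<in> sets F" for N G
  proof (rule P.integrable_const_bound[of _ 1])
    show "AE x in P. norm (indicator G x * cond_prob N F S x) \<le> 1"
      by (simp add: indicator_def cond_prob_range abs_le_iff)
    have "G \<in> sets P" using that FP by (auto simp: subalgebra_def)
    then show "(\<lambda>x. indicator G x * cond_prob N F S x) \<in> borel_measurable P" using mb by measurable
  qed
  \<comment> \<open>One \<open>tv_dist\<close> pays for changing the measure under the integral of
    \<open>Q(S | F)\<close>, the other for replacing the mass of \<open>S \<inter> G\<close> under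
    \<open>Q\<close> by that under \<open>P\<close>.\<close>
  have G: "\<bar>(\<integral>x. indicator G x * cond_prob Q F S x \<partial>P)
      - (\<integral>x. indicator G x * cond_prob P F S x \<partial>P)\<bar> \<le> 2 * tv_dist m P Q" if G: "G \<in> sets F" for G
  proof -
    have "(\<lambda>x. indicator G x * cond_prob Q F S x) \<in> borel_measurable (borel_space m)"
      by (intro mF borel_measurable_times borel_measurable_indicator G borel_measurable_cond_prob)
    then have "\<bar>(\<integral>x. indicator G x * cond_prob Q F S x \<partial>P)
        - (\<integral>x. indicator G x * cond_prob Q F S x \<partial>Q)\<bar> \<le> tv_dist m P Q"
      by (intro tv_dist_integral[OF P Q]) (auto simp: indicator_def cond_prob_range)
    moreover have "S \<inter> G \<in> sets (borel_space m)" using S G F by (auto simp: subalgebra_def)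
    then have "\<bar>measure P (S \<inter> G) - measure Q (S \<inter> G)\<bar> \<le> tv_dist m P Q"
      by (rule tv_dist_upper[OF P Q])
    ultimately show ?thesis
      unfolding P.cond_prob_integral[OF FP SP(1) G] Q.cond_prob_integral[OF FQ SP(2) G]
      by linarith
  qed
  define U where "U = {x\<in>space F. cond_prob P F S x \<le> cond_prob Q F S x}"
  have U: "U \<in> sets F" "space F - U \<in> sets F" unfolding U_def by measurable
  let ?i = "\<lambda>N G. (\<integral>x. indicator G x * cond_prob N F S x \<partial>P)"
  have "(\<integral>x. \<bar>cond_prob Q F S x - cond_prob P F S x\<bar> \<partial>P)
    = (\<integral>x. (indicator U x * cond_prob Q F S x - indicator U x * cond_prob P F S x)
        - (indicator (space F - U) x * cond_prob Q F S x
           - indicator (space F - U) x * cond_prob P F S x) \<partial>P)"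
    using spF space_borel_probs[OF P]
    by (intro Bochner_Integration.integral_cong) (auto simp: U_def indicator_def)
  also have "\<dots> = (?i Q U - ?i P U) - (?i Q (space F - U) - ?i P (space F - U))"
    using U ib by simp
  also have "\<dots> \<le> 4 * tv_dist m P Q" using G[OF U(1)] G[OF U(2)] by linarith
  finally show ?thesis .
qed

text \<open>The constant is 3 * 4 + 1: each of the three conditional probabilities of
  \<open>P\<close> is replaced by that of \<open>Q\<close> at cost 4. The identity for
  \<open>Q\<close> may fail on a \<open>Q\<close>-null set \<open>J\<close>, which \<open>P\<close>
  charges with at most \<open>tv_dist m P Q\<close>.\<close>

lemma cond_indep_events_tv_dist:
  assumes P: "P \<in> borel_probs m" and Q: "Q \<in> borel_probs m"
    and F: "subalgebra (borel_space m) F"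
    and S: "S \<in> sets (borel_space m)" and T: "T \<in> sets (borel_space m)"
    and ci: "cond_indep_events Q F S T"
  shows "(\<integral>x. \<bar>cond_prob P F (S \<inter> T) x - cond_prob P F S x * cond_prob P F T x\<bar> \<partial>P)
    \<le> 13 * tv_dist m P Q"
proof -
  interpret P: prob_space P using P by (rule prob_space_borel_probs)
  interpret Q: prob_space Q using Q by (rule prob_space_borel_probs)
  note sP = sets_borel_probs[OF P, measurable_cong] and sQ = sets_borel_probs[OF Q]
  have sp: "space F = mspace m" "space P = mspace m" "space Q = mspace m"
    using F space_borel_probs[OF P] space_borel_probs[OF Q]
    by (auto simp: subalgebra_def space_borel_space)
  have FP: "subalgebra P F" and FQ: "subalgebra Q F"
    using F sP sQ sp by (auto simp: subalgebra_def space_borel_space)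
  have mb: "cond_prob N F A \<in> borel_measurable P" for N A
    by (rule measurable_from_subalg[OF FP]) measurable
  let ?p = "\<lambda>A x. cond_prob P F A x" and ?q = "\<lambda>A x. cond_prob Q F A x"
  define J where "J = {x\<in>space F. ?q (S \<inter> T) x \<noteq> ?q S x * ?q T x}"
  have JF: "J \<in> sets F" unfolding J_def by measurable
  then have JP: "J \<in> sets P" and JQ: "J \<in> sets Q" and JB: "J \<in> sets (borel_space m)"
    using FP FQ F by (auto simp: subalgebra_def)
  have "AE x in Q. ?q (S \<inter> T) x = ?q S x * ?q T x"
    using ci S T sQ by (subst (asm) cond_indep_events_iff[OF Q.prob_space_axioms FQ]) auto
  then have "AE x in Q. x \<notin> J" by eventually_elim (simp add: J_def)
  then have "measure Q J = 0" using JQ by (simp add: Q.prob_eq_0)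
  then have PJ: "measure P J \<le> tv_dist m P Q"
    using tv_dist_upper[OF P Q JB] by simp
  have dm: "(\<lambda>x. \<bar>?q A x - ?p A x\<bar>) \<in> borel_measurable P" for A
    using mb[of P A] mb[of Q A] by measurable
  have di: "integrable P (\<lambda>x. \<bar>?q A x - ?p A x\<bar>)" for A
  proof (rule P.integrable_const_bound[of _ 1, OF _ dm])
    show "AE x in P. norm \<bar>?q A x - ?p A x\<bar> \<le> 1"
      using cond_prob_range[of P F A] cond_prob_range[of Q F A]
      by (intro AE_I2) (simp add: abs_le_iff, smt (verit))
  qed
  have le: "\<bar>?p (S \<inter> T) x - ?p S x * ?p T x\<bar>
      \<le> \<bar>?q (S \<inter> T) x - ?p (S \<inter> T) x\<bar> + \<bar>?q S x - ?p S x\<bar> + \<bar>?q T x - ?p T x\<bar> + indicator J x"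
    if x: "x \<in> space P" for x
  proof -
    have 1: "\<bar>?q (S \<inter> T) x - ?q S x * ?q T x\<bar> \<le> indicator J x"
    proof (cases "x \<in> J")
      case True
      have "\<bar>?q (S \<inter> T) x - ?q S x * ?q T x\<bar> \<le> 1"
        using cond_prob_range[of Q F "S \<inter> T" x] cond_prob_mult_range[of Q F S x T] by linarith
      then show ?thesis using True by simp
    qed (use x sp in \<open>simp add: J_def\<close>)
    have "?q S x * ?q T x - ?p S x * ?p T x
        = (?q S x - ?p S x) * ?q T x + ?p S x * (?q T x - ?p T x)"
      by (simp add: algebra_simps)
    also have "\<bar>\<dots>\<bar> \<le> \<bar>?q S x - ?p S x\<bar> * ?q T x + ?p S x * \<bar>?q T x - ?p T x\<bar>"
      using cond_prob_range by (intro order_trans[OF abs_triangle_ineq]) (simp add: abs_mult abs_of_nonneg cond_prob_range)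
    also have "\<dots> \<le> \<bar>?q S x - ?p S x\<bar> * 1 + 1 * \<bar>?q T x - ?p T x\<bar>"
      using cond_prob_range by (intro add_mono mult_mono) auto
    finally have 2: "\<bar>?q S x * ?q T x - ?p S x * ?p T x\<bar> \<le> \<bar>?q S x - ?p S x\<bar> + \<bar>?q T x - ?p T x\<bar>"
      by simp
    have "\<bar>?p (S \<inter> T) x - ?p S x * ?p T x\<bar> \<le> \<bar>?q (S \<inter> T) x - ?p (S \<inter> T) x\<bar>
        + \<bar>?q (S \<inter> T) x - ?q S x * ?q T x\<bar> + \<bar>?q S x * ?q T x - ?p S x * ?p T x\<bar>"
      by linarith
    then show ?thesis using 1 2 by linarith
  qed
  have iJ: "integrable P (indicator J :: _ \<Rightarrow> real)"
    using JP by (simp add: integrable_indicator_iff P.emeasure_eq_measure)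
  have "(\<integral>x. \<bar>?p (S \<inter> T) x - ?p S x * ?p T x\<bar> \<partial>P)
    \<le> (\<integral>x. \<bar>?q (S \<inter> T) x - ?p (S \<inter> T) x\<bar> + \<bar>?q S x - ?p S x\<bar> + \<bar>?q T x - ?p T x\<bar>
        + indicator J x \<partial>P)"
  proof (rule integral_mono')
    show "integrable P (\<lambda>x. \<bar>?q (S \<inter> T) x - ?p (S \<inter> T) x\<bar> + \<bar>?q S x - ?p S x\<bar>
        + \<bar>?q T x - ?p T x\<bar> + indicator J x)"
      using di iJ by (intro Bochner_Integration.integrable_add)
  qed (use le in auto)
  also have "\<dots> = (\<integral>x. \<bar>?q (S \<inter> T) x - ?p (S \<inter> T) x\<bar> \<partial>P) + (\<integral>x. \<bar>?q S x - ?p S x\<bar> \<partial>P)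
      + (\<integral>x. \<bar>?q T x - ?p T x\<bar> \<partial>P) + measure P J"
    using di iJ sets.sets_into_space[OF JP] by (simp add: Int_absorb1 Int_absorb2)
  also have "\<dots> \<le> 13 * tv_dist m P Q"
    using cond_prob_tv_dist[OF P Q F S] cond_prob_tv_dist[OF P Q F T]
      cond_prob_tv_dist[OF P Q F sets.Int[OF S T]] PJ by linarith
  finally show ?thesis .
qed

text \<open>Dependence means that the integrated defect of \<open>P\<close> is positive. An
  independent \<open>Q\<close> closer than a thirteenth of it would force the defect below
  itself.\<close>

lemma not_cond_indep_events_tv_open:
  assumes P: "P \<in> borel_probs m" and F: "subalgebra (borel_space m) F"
    and S: "S \<in> sets (borel_space m)" and T: "T \<in> sets (borel_space m)"
    and nci: "\<not> cond_indep_events P F S T"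
  obtains e where "e > 0"
    "\<And>Q. Q \<in> borel_probs m \<Longrightarrow> tv_dist m P Q < e \<Longrightarrow> \<not> cond_indep_events Q F S T"
proof -
  interpret P: prob_space P using P by (rule prob_space_borel_probs)
  note sP = sets_borel_probs[OF P, measurable_cong]
  have FP: "subalgebra P F"
    using F sP space_borel_probs[OF P] by (auto simp: subalgebra_def space_borel_space)
  have mb: "cond_prob P F A \<in> borel_measurable P" for A
    by (rule measurable_from_subalg[OF FP]) measurable
  define f where "f x = \<bar>cond_prob P F (S \<inter> T) x - cond_prob P F S x * cond_prob P F T x\<bar>" for x
  have fm: "f \<in> borel_measurable P" unfolding f_def using mb by measurable
  have f1: "\<bar>f x\<bar> \<le> 1" for x
    unfolding f_def
    using cond_prob_range[of P F "S \<inter> T" x] cond_prob_mult_range[of P F S x T] by linarith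
  have fi: "integrable P f" by (rule P.integrable_const_bound[of _ 1, OF _ fm]) (simp add: f1)
  have f0: "0 \<le> f x" for x by (simp add: f_def)
  have "\<not> (AE x in P. f x = 0)"
    using nci S T sP unfolding f_def
    by (subst (asm) cond_indep_events_iff[OF P.prob_space_axioms FP]) auto
  then have "(\<integral>x. f x \<partial>P) \<noteq> 0"
    using integral_nonneg_eq_0_iff_AE[OF fi] f0 by auto
  then have pos: "(\<integral>x. f x \<partial>P) > 0" using Bochner_Integration.integral_nonneg[of P f] f0 by fastforce
  show ?thesis
  proof
    show "(\<integral>x. f x \<partial>P) / 13 > 0" using pos by simp
    fix Q assume "Q \<in> borel_probs m" "tv_dist m P Q < (\<integral>x. f x \<partial>P) / 13"
    then show "\<not> cond_indep_events Q F S T"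
      using cond_indep_events_tv_dist[OF P _ F S T, of Q] unfolding f_def by fastforce
  qed
qed

section \<open>Conditional independence under a change of measure\<close>

context prob_space
begin

context
  fixes F h P
  assumes F: "subalgebra M F"
    and h: "integrable M h" "\<And>x. x \<in> space M \<Longrightarrow> 0 \<le> h x"
    and P: "P = density M (\<lambda>x. ennreal (h x))" "prob_space P"
begin

text \<open>By Bayes' formula \<open>P(U | F)\<close> is the quotient \<open>ce U / ce UNIV\<close>.
  Numerator and denominator are kept apart so that no division remains in the criterion for
  independence.\<close>

abbreviation ce :: "'a set \<Rightarrow> 'a \<Rightarrow> real" where
  "ce U \<equiv> real_cond_exp M F (\<lambda>x. h x * indicator U x)"

lemma integrable_mult_indicator':
  assumes "U \<in> sets M \<or> U = UNIV" shows "integrable M (\<lambda>x. h x * indicator U x)"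
  using assms h(1) integrable_mult_indicator[of U M h] by (auto simp: mult.commute)

lemma ce_bounds:
  assumes U: "U \<in> sets M"
  shows "AE x in M. 0 \<le> ce U x \<and> ce U x \<le> ce UNIV x"
proof -
  interpret finite_measure_subalgebra M F by (rule finite_measure_subalgebraI[OF F])
  have "AE x in M. 0 \<le> ce U x"
    using integrable_mult_indicator'[of U] U h(2)
    by (intro real_cond_exp_pos) auto
  moreover have "AE x in M. ce U x \<le> ce UNIV x"
    using integrable_mult_indicator'[of U] integrable_mult_indicator'[of UNIV] U h(2)
    by (intro real_cond_exp_mono) (auto simp: indicator_def)
  ultimately show ?thesis by eventually_elim simp
qed

lemma integral_density_h:
  assumes "f \<in> borel_measurable M"
  shows "(\<integral>x. f x \<partial>P) = (\<integral>x. h x * f x \<partial>M)"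
  unfolding P using h assms by (subst integral_real_density) auto

lemma integral_density_F:
  assumes f: "f \<in> borel_measurable F" "\<And>x. \<bar>f x\<bar> \<le> 1"
  shows "(\<integral>x. f x * h x \<partial>M) = (\<integral>x. f x * ce UNIV x \<partial>M)"
proof -
  interpret finite_measure_subalgebra M F by (rule finite_measure_subalgebraI[OF F])
  have [measurable]: "f \<in> borel_measurable M" using f F by (metis measurable_from_subalg)
  have "integrable M (\<lambda>x. f x * h x)"
    by (rule Bochner_Integration.integrable_bound[OF h(1)])
      (use f h in \<open>auto simp: abs_mult intro!: mult_left_le_one_le\<close>)
  then show ?thesis using real_cond_exp_intg(2)[of f h] f h by simp
qed

text \<open>The \<open>P\<close>-mass of an event of \<open>F\<close> is the
  \<open>M\<close>-integral of the almost surely nonnegative \<open>ce UNIV\<close> over it.\<close>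

lemma AE_density_F:
  assumes J: "J \<in> sets F"
  shows "(AE x in P. x \<notin> J) \<longleftrightarrow> (AE x in M. x \<in> J \<longrightarrow> ce UNIV x = 0)"
proof -
  interpret finite_measure_subalgebra M F by (rule finite_measure_subalgebraI[OF F])
  interpret P: prob_space P by (rule P)
  have JM: "J \<in> sets M" using J F by (auto simp: subalgebra_def)
  then have JP: "J \<in> sets P" by (simp add: P)
  have "(AE x in P. x \<notin> J) \<longleftrightarrow> measure P J = 0"
    using JP by (simp add: P.prob_eq_0)
  also have "measure P J = (\<integral>x. indicator J x \<partial>P)"
    using sets.sets_into_space[OF JP] by (simp add: Int_absorb1 Int_absorb2)
  also have "\<dots> = (\<integral>x. indicator J x * h x \<partial>M)"
    using JM integral_density_h[of "indicator J"] by (simp add: mult.commute)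
  also have "\<dots> = (\<integral>x. indicator J x * ce UNIV x \<partial>M)"
    using J by (intro integral_density_F) (auto simp: indicator_def)
  also have "\<dots> = 0 \<longleftrightarrow> (AE x in M. indicator J x * ce UNIV x = 0)"
  proof (rule integral_nonneg_eq_0_iff_AE)
    show "integrable M (\<lambda>x. indicator J x * ce UNIV x)"
      using integrable_mult_indicator[OF JM real_cond_exp_int(1)[OF integrable_mult_indicator'[of UNIV]]]
      by simp
    have "AE x in M. 0 \<le> ce UNIV x"
      using integrable_mult_indicator'[of UNIV] h(2) by (intro real_cond_exp_pos) auto
    then show "AE x in M. 0 \<le> indicator J x * ce UNIV x" by eventually_elim simp
  qed
  also have "\<dots> \<longleftrightarrow> (AE x in M. x \<in> J \<longrightarrow> ce UNIV x = 0)"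
    by (intro AE_cong) (auto simp: indicator_def)
  finally show ?thesis .
qed

lemma AE_density_mono: "(AE x in M. Q x) \<Longrightarrow> AE x in P. Q x"
  unfolding P using h(1) by (subst AE_density) auto

lemma cond_exp_density:
  assumes U: "U \<in> sets M"
  shows "AE x in P. ce UNIV x * real_cond_exp P F (indicator U) x = ce U x"
proof -
  interpret finite_measure_subalgebra M F by (rule finite_measure_subalgebraI[OF F])
  interpret P: prob_space P by (rule P)
  have FP: "subalgebra P F" using F by (simp add: P subalgebra_def)
  interpret P: finite_measure_subalgebra P F by (rule P.finite_measure_subalgebraI[OF FP])
  \<comment> \<open>Where \<open>ce UNIV\<close> vanishes the quotient is 0 by convention;
    \<open>ce U\<close>, squeezed between 0 and \<open>ce UNIV\<close>, is almost surely 0 there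
    too.\<close>
  define r where "r x = unit_clip (ce U x / ce UNIV x)" for x
  have rF [measurable]: "r \<in> borel_measurable F" unfolding r_def by measurable
  have rM [measurable]: "r \<in> borel_measurable M" using F rF by (metis measurable_from_subalg)
  have rP [measurable]: "r \<in> borel_measurable P" by (simp add: P)
  have r1: "0 \<le> r x" "r x \<le> 1" for x by (auto simp: r_def unit_clip_range)
  have UP [measurable]: "U \<in> sets P" using U by (simp add: P)
  have rce: "AE x in M. r x * ce UNIV x = ce U x"
    using ce_bounds[OF U]
  proof eventually_elim
    case (elim x)
    then show ?case by (cases "ce UNIV x = 0") (auto simp: r_def unit_clip_id)
  qed
  have "AE x in P. real_cond_exp P F (indicator U) x = r x"
  proof (rule P.real_cond_exp_charact)
    fix G assume G: "G \<in> sets F"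
    have GM [measurable]: "G \<in> sets M" using G F by (auto simp: subalgebra_def)
    have "(\<integral>x\<in>G. indicator U x \<partial>P) = (\<integral>x. h x * (indicator G x * indicator U x) \<partial>M)"
      unfolding set_lebesgue_integral_def using U
      by (subst integral_density_h) auto
    also have "\<dots> = (\<integral>x. indicator G x * (h x * indicator U x) \<partial>M)"
      by (simp add: mult_ac)
    also have "\<dots> = (\<integral>x. indicator G x * ce U x \<partial>M)"
    proof (rule real_cond_exp_intg(2)[symmetric])
      show "integrable M (\<lambda>x. indicator G x * (h x * indicator U x))"
        using integrable_mult_indicator[OF GM integrable_mult_indicator'[of U]] U by simp
    qed (use G U h in auto)
    also have "\<dots> = (\<integral>x. (indicator G x * r x) * ce UNIV x \<partial>M)"
      using rce by (intro integral_cong_AE) auto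
    also have "\<dots> = (\<integral>x. (indicator G x * r x) * h x \<partial>M)"
      using G r1 by (intro integral_density_F[symmetric]) (auto simp: indicator_def abs_le_iff intro: order_trans[of _ 0])
    also have "\<dots> = (\<integral>x\<in>G. r x \<partial>P)"
      unfolding set_lebesgue_integral_def
      by (subst integral_density_h) (auto simp: mult_ac)
    finally show "(\<integral>x\<in>G. indicator U x \<partial>P) = (\<integral>x\<in>G. r x \<partial>P)" .
  next
    show "integrable P (indicator U :: _ \<Rightarrow> real)"
      by (simp add: integrable_indicator_iff P.emeasure_eq_measure)
    show "integrable P r"
      by (rule P.integrable_const_bound[of _ 1]) (auto simp: r1)
  qed simp
  then show ?thesis using AE_density_mono[OF rce] by eventually_elim (simp add: mult.commute)
qed

text \<open>Bayes' formula with denominators cleared. Where \<open>ce UNIV\<close> vanishes, a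
  \<open>P\<close>-null set that \<open>M\<close> may charge, both sides are 0. Independence under
  any density is thus tested under the one measure \<open>M\<close>.\<close>

lemma cond_indep_events_density:
  assumes S: "S \<in> sets M" and T: "T \<in> sets M"
  shows "cond_indep_events P F S T \<longleftrightarrow>
    (AE x in M. ce UNIV x * ce (S \<inter> T) x = ce S x * ce T x)"
proof
  have ST: "S \<inter> T \<in> sets M" using S T by auto
  note ceP = cond_exp_density[OF S] cond_exp_density[OF T] cond_exp_density[OF ST]
  have "{x\<in>space F. ce UNIV x = 0} \<in> sets F" by measurable
  from AE_density_F[OF this] have "AE x in P. x \<notin> {x\<in>space F. ce UNIV x = 0}"
    by simp
  moreover have "space P = space F" using F by (simp add: P subalgebra_def)
  ultimately have nz: "AE x in P. ce UNIV x \<noteq> 0"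
    using AE_space[of P] by (auto elim!: eventually_elim2)
  {
    assume ci: "cond_indep_events P F S T"
    define J where "J = {x\<in>space F. ce UNIV x * ce (S \<inter> T) x \<noteq> ce S x * ce T x}"
    have J: "J \<in> sets F" unfolding J_def by measurable
    have "AE x in P. x \<notin> J"
      using ci[unfolded cond_indep_events_def] ceP
    proof eventually_elim
      case (elim x)
      let ?u = "\<lambda>A. real_cond_exp P F (indicator A) x"
      have "ce UNIV x * ce (S \<inter> T) x = ce UNIV x * (ce UNIV x * (?u S * ?u T))"
        using elim by simp
      also have "\<dots> = (ce UNIV x * ?u S) * (ce UNIV x * ?u T)" by (simp only: mult_ac)
      also have "\<dots> = ce S x * ce T x" using elim by simp
      finally have "ce UNIV x * ce (S \<inter> T) x = ce S x * ce T x" .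
      then show ?case by (simp add: J_def)
    qed
    then have "AE x in M. x \<in> J \<longrightarrow> ce UNIV x = 0" using AE_density_F[OF J] by simp
    then show "AE x in M. ce UNIV x * ce (S \<inter> T) x = ce S x * ce T x"
      using ce_bounds[OF S] ce_bounds[OF T] AE_space
    proof eventually_elim
      case (elim x)
      show ?case
      proof (cases "x \<in> J")
        case True
        then show ?thesis using elim by auto
      next
        case False
        then show ?thesis using elim F by (simp add: J_def subalgebra_def)
      qed
    qed
  }
  assume "AE x in M. ce UNIV x * ce (S \<inter> T) x = ce S x * ce T x"
  from AE_density_mono[OF this] show "cond_indep_events P F S T"
    unfolding cond_indep_events_def using ceP nz
  proof eventually_elim
    case (elim x)
    let ?u = "\<lambda>A. real_cond_exp P F (indicator A) x"
    have "ce UNIV x * (ce UNIV x * ?u (S \<inter> T)) = (ce UNIV x * ?u S) * (ce UNIV x * ?u T)"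
      using elim by simp
    then have "(ce UNIV x * ce UNIV x) * ?u (S \<inter> T) = (ce UNIV x * ce UNIV x) * (?u S * ?u T)"
      by (simp add: mult_ac)
    then show ?case using elim by simp
  qed
qed

end

text \<open>For fixed \<open>S\<close>, \<open>T\<close> conditional independence says that a polynomial in \<open>l\<close>, whose coefficients
  are conditional expectations, vanishes almost surely.\<close>

lemma cond_indep_events_polynomial:
  fixes I :: "'i set" and a :: "'i \<Rightarrow> 'a \<Rightarrow> real" and d :: "'i \<Rightarrow> nat" and P :: "real \<Rightarrow> 'a measure"
  defines "h l x \<equiv> (\<Sum>i\<in>I. l ^ d i * a i x)"
  assumes F: "subalgebra M F" and I: "finite I"
    and a: "\<And>i. i \<in> I \<Longrightarrow> integrable M (a i)"
    and h: "\<And>l x. l \<in> {0..1} \<Longrightarrow> x \<in> space M \<Longrightarrow> 0 \<le> h l x"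
    and P: "\<And>l. l \<in> {0..1} \<Longrightarrow> P l = density M (\<lambda>x. ennreal (h l x))"
      "\<And>l. l \<in> {0..1} \<Longrightarrow> prob_space (P l)"
    and S: "S \<in> sets M" and T: "T \<in> sets M"
    and inf: "infinite {l\<in>{0..1}. cond_indep_events (P l) F S T}"
    and l0: "l0 \<in> {0..1}"
  shows "cond_indep_events (P l0) F S T"
proof -
  interpret finite_measure_subalgebra M F by (rule finite_measure_subalgebraI[OF F])
  define e where "e U x = (\<Sum>i\<in>I. monom (real_cond_exp M F (\<lambda>x. a i x * indicator U x) x) (d i))"
    for U x
  have hi: "integrable M (h l)" for l
    unfolding h_def using a by (intro Bochner_Integration.integrable_sum integrable_mult_right)
  have ai: "integrable M (\<lambda>x. a i x * indicator U x)" if "i \<in> I" "U \<in> sets M \<or> U = UNIV" for i U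
    using that a[of i] integrable_mult_indicator[of U M "a i"] by (auto simp: mult.commute)
  have e: "AE x in M. real_cond_exp M F (\<lambda>x. h l x * indicator U x) x = poly (e U x) l"
    if U: "U \<in> sets M \<or> U = UNIV" for l U
  proof -
    have eq: "(\<lambda>x. h l x * indicator U x) = (\<lambda>x. \<Sum>i\<in>I. l ^ d i * (a i x * indicator U x))"
      by (simp add: h_def sum_distrib_right mult.assoc)
    \<comment> \<open>Put to 0 outside \<open>I\<close>, the summands are integrable for every index
      whatsoever, as the rule for conditional expectations of sums asks.\<close>
    define b where "b i x = (if i \<in> I then l ^ d i * (a i x * indicator U x) else 0)" for i x
    have "integrable M (b i)" for i
      using ai[OF _ U, of i] by (cases "i \<in> I") (simp_all add: b_def[abs_def])
    then have "AE x in M. real_cond_exp M F (\<lambda>x. \<Sum>i\<in>I. b i x) x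
        = (\<Sum>i\<in>I. real_cond_exp M F (b i) x)"
      by (rule real_cond_exp_sum)
    moreover have "b i = (\<lambda>x. l ^ d i * (a i x * indicator U x))" if "i \<in> I" for i
      using that by (auto simp: b_def)
    ultimately have "AE x in M. real_cond_exp M F (\<lambda>x. \<Sum>i\<in>I. l ^ d i * (a i x * indicator U x)) x
        = (\<Sum>i\<in>I. real_cond_exp M F (\<lambda>x. l ^ d i * (a i x * indicator U x)) x)"
      by simp
    moreover have "AE x in M. \<forall>i\<in>I. real_cond_exp M F (\<lambda>x. l ^ d i * (a i x * indicator U x)) x
        = l ^ d i * real_cond_exp M F (\<lambda>x. a i x * indicator U x) x"
      using ai U I by (intro AE_finite_allI real_cond_exp_cmult) auto
    ultimately show ?thesis
      unfolding eq by eventually_elim (simp add: e_def poly_sum poly_monom mult.commute)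
  qed
  have crit: "cond_indep_events (P l) F S T \<longleftrightarrow>
      (AE x in M. poly (e UNIV x * e (S \<inter> T) x - e S x * e T x) l = 0)" if l: "l \<in> {0..1}" for l
  proof -
    have ST: "S \<inter> T \<in> sets M" using S T by auto
    note eq = e[of UNIV l] e[of "S \<inter> T" l] e[of S l] e[of T l]
    have "cond_indep_events (P l) F S T \<longleftrightarrow>
        (AE x in M. real_cond_exp M F (\<lambda>x. h l x * indicator UNIV x) x
           * real_cond_exp M F (\<lambda>x. h l x * indicator (S \<inter> T) x) x
         = real_cond_exp M F (\<lambda>x. h l x * indicator S x) x
           * real_cond_exp M F (\<lambda>x. h l x * indicator T x) x)"
      by (rule cond_indep_events_density[OF F hi h P]) (use l S T in auto)
    also have "\<dots> \<longleftrightarrow> (AE x in M. poly (e UNIV x * e (S \<inter> T) x - e S x * e T x) l = 0)"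
      (is "(AE x in M. ?A x) \<longleftrightarrow> (AE x in M. ?B x)")
    proof -
      have "AE x in M. ?A x \<longleftrightarrow> ?B x"
        using eq(1)[OF disjI2[OF refl]] eq(2)[OF disjI1[OF ST]] eq(3)[OF disjI1[OF S]]
          eq(4)[OF disjI1[OF T]]
        by eventually_elim simp
      then show ?thesis by (rule eventually_subst)
    qed
    finally show ?thesis .
  qed
  \<comment> \<open>Each \<open>l\<close> has its own exceptional null set, and only countably many
    may be united. A countably infinite set of roots is enough to annihilate a polynomial.\<close>
  obtain L where L: "countable L" "infinite L" "L \<subseteq> {l\<in>{0..1}. cond_indep_events (P l) F S T}"
    using infinite_countable_subset'[OF inf] by blast
  have "AE x in M. \<forall>l\<in>L. poly (e UNIV x * e (S \<inter> T) x - e S x * e T x) l = 0"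
    using L crit by (intro AE_ball_countable'[OF _ L(1)]) blast
  then have "AE x in M. poly (e UNIV x * e (S \<inter> T) x - e S x * e T x) l0 = 0"
  proof eventually_elim
    case (elim x)
    let ?q = "e UNIV x * e (S \<inter> T) x - e S x * e T x"
    have "infinite {l. poly ?q l = 0}"
      using L(2) elim by (auto elim!: infinite_super[rotated])
    then have "?q = 0" using poly_roots_finite by blast
    then show ?case by simp
  qed
  then show ?thesis using crit l0 by blast
qed

end

section \<open>Borel sets of products of metric spaces\<close>

lemma openin_mtopology_of_iff:
  "openin (mtopology_of m) U \<longleftrightarrow> U \<subseteq> mspace m \<and>
     (\<forall>x\<in>U. \<exists>r>0. \<forall>y\<in>mspace m. mdist m x y < r \<longrightarrow> y \<in> U)"
proof -
  interpret Metric_space "mspace m" "mdist m" by (rule Metric_space_mspace_mdist)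
  have "mball x r \<subseteq> U \<longleftrightarrow> (\<forall>y\<in>mspace m. mdist m x y < r \<longrightarrow> y \<in> U)" if "x \<in> mspace m" for x r
    using that by (auto simp: mball_def)
  then show ?thesis
    unfolding mtopology_of_def openin_mtopology by (meson subsetD)
qed

lemma openin_subset_mspace: "openin (mtopology_of m) U \<Longrightarrow> U \<subseteq> mspace m"
  by (simp add: openin_mtopology_of_iff)

lemma second_countable_mtopology_of:
  assumes "separable_space (mtopology_of m)"
  shows "second_countable (mtopology_of m)"
proof -
  interpret Metric_space "mspace m" "mdist m" by (rule Metric_space_mspace_mdist)
  obtain D where D: "countable D" "D \<subseteq> mspace m" "mtopology closure_of D = mspace m"
    using assms by (auto simp: separable_space_def mtopology_of_def)
  define B where "B = (\<lambda>(d, n). mball d (inverse (real (Suc n)))) ` (D \<times> UNIV)"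
  have dense: "\<exists>d\<in>D. mdist m x d < r" if "x \<in> mspace m" "r > 0" for x r
  proof -
    have "x \<in> mtopology closure_of D" using that D by simp
    then show ?thesis using that by (auto simp: metric_closure_of)
  qed
  show ?thesis unfolding second_countable_def
  proof (intro exI[of _ B] conjI allI impI ballI)
    show "countable B" unfolding B_def using D by auto
    show "openin (mtopology_of m) W" if "W \<in> B" for W
      using that by (auto simp: B_def mtopology_of_def)
    fix U x assume Ux: "openin (mtopology_of m) U \<and> x \<in> U"
    then obtain r where r: "r > 0" "mball x r \<subseteq> U" and x: "x \<in> mspace m"
      unfolding mtopology_of_def openin_mtopology by blast
    obtain n where n: "inverse (real (Suc n)) < r / 2" using r reals_Archimedean[of "r / 2"] by auto
    obtain d where d: "d \<in> D" "mdist m x d < inverse (real (Suc n))"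
      using dense[OF x, of "inverse (real (Suc n))"] by auto
    have dm: "d \<in> mspace m" using d D by auto
    show "\<exists>W\<in>B. x \<in> W \<and> W \<subseteq> U"
    proof (intro bexI conjI)
      show "x \<in> mball d (inverse (real (Suc n)))" using d dm x by (simp add: commute)
      show "mball d (inverse (real (Suc n))) \<subseteq> U"
      proof
        fix y assume y: "y \<in> mball d (inverse (real (Suc n)))"
        then have "mdist m x y \<le> mdist m x d + mdist m d y" using x dm by (intro triangle) auto
        then have "y \<in> mball x r" using y d n x by auto
        then show "y \<in> U" using r by auto
      qed
    qed (use d in \<open>auto simp: B_def\<close>)
  qed
qed

lemma countable_subcover_mtopology_of:
  assumes sep: "second_countable (mtopology_of m)"
    and op: "\<And>x. x \<in> mspace m \<Longrightarrow> openin (mtopology_of m) (U x) \<and> x \<in> U x"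
  obtains C where "countable C" "C \<subseteq> mspace m" "(\<Union>x\<in>C. U x) = mspace m"
proof -
  interpret Metric_space "mspace m" "mdist m" by (rule Metric_space_mspace_mdist)
  have ts: "topspace (mtopology_of m) = mspace m" by (simp add: mtopology_of_def)
  have cover: "\<Union>(U ` mspace m) = topspace (mtopology_of m)"
    using op openin_subset ts by fastforce
  obtain W where W: "countable W" "W \<subseteq> U ` mspace m" "\<Union>W = topspace (mtopology_of m)"
    using Lindelof_spaceD[OF second_countable_imp_Lindelof_space[OF sep] _ cover] op by auto
  obtain C where "countable C" "C \<subseteq> mspace m" "W = U ` C"
    using countable_image_eq_inj W(1,2) by (metis countable_subset_image)
  then show thesis using that W ts by simp
qed

lemma borel_openin: "openin (mtopology_of m) U \<Longrightarrow> U \<in> sets (borel_space m)"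
proof -
  have "{U. openin (mtopology_of m) U} \<subseteq> Pow (mspace m)"
    using openin_subset_mspace by auto
  then show "openin (mtopology_of m) U \<Longrightarrow> U \<in> sets (borel_space m)"
    by (simp add: borel_space_def sets_measure_of)
qed

lemma measurable_borel_spaceI:
  assumes "f \<in> space N \<rightarrow> mspace m"
    and "\<And>U. openin (mtopology_of m) U \<Longrightarrow> f -` U \<inter> space N \<in> sets N"
  shows "f \<in> measurable N (borel_space m)"
proof -
  have "{U. openin (mtopology_of m) U} \<subseteq> Pow (mspace m)"
    using openin_subset_mspace by auto
  then show ?thesis unfolding borel_space_def using assms by (intro measurable_measure_of) auto
qed

lemma borel_measurable_borel_spaceI:
  fixes f :: "'a \<Rightarrow> real"
  assumes "\<And>x e. x \<in> mspace m \<Longrightarrow> e > 0 \<Longrightarrow>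
      \<exists>d>0. \<forall>y\<in>mspace m. mdist m x y < d \<longrightarrow> \<bar>f x - f y\<bar> < e"
  shows "f \<in> borel_measurable (borel_space m)"
proof (rule borel_measurableI)
  fix S :: "real set" assume S: "open S"
  have "openin (mtopology_of m) (f -` S \<inter> mspace m)"
    unfolding openin_mtopology_of_iff
  proof (intro conjI ballI)
    fix x assume x: "x \<in> f -` S \<inter> mspace m"
    then obtain e where e: "e > 0" "\<And>t. \<bar>f x - t\<bar> < e \<Longrightarrow> t \<in> S"
      using S by (force simp: open_dist dist_real_def abs_minus_commute)
    then show "\<exists>r>0. \<forall>y\<in>mspace m. mdist m x y < r \<longrightarrow> y \<in> f -` S \<inter> mspace m"
      using assms[of x e] x by (metis IntI IntD2 vimageI)
  qed simp
  then show "f -` S \<inter> space (borel_space m) \<in> sets (borel_space m)"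
    by (simp add: borel_openin space_borel_space)
qed

lemma mdist_coordinate_le:
  assumes "finite W" "v \<in> W"
  shows "mdist (X v) (x v) (y v) \<le> mdist (prod_space X W) x y"
proof -
  have "mdist (X v) (x v) (y v) \<le> L2_set (\<lambda>v. mdist (X v) (x v) (y v)) W"
    using assms member_le_L2_set[of W v "\<lambda>v. mdist (X v) (x v) (y v)"] by simp
  then show ?thesis using assms by (simp add: mdist_prod_space L2_set_def)
qed

lemma mdist_prod_space_le_sum:
  assumes "finite W"
  shows "mdist (prod_space X W) x y \<le> (\<Sum>v\<in>W. mdist (X v) (x v) (y v))"
  using L2_set_le_sum[of W "\<lambda>v. mdist (X v) (x v) (y v)"] assms
  by (simp add: mdist_prod_space L2_set_def)

lemma openin_box:
  assumes W: "finite W" and U: "\<And>v. v \<in> W \<Longrightarrow> openin (mtopology_of (X v)) (U v)"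
  shows "openin (mtopology_of (prod_space X W)) (Pi\<^sub>E W U)"
  unfolding openin_mtopology_of_iff
proof (intro conjI ballI)
  have sub: "U v \<subseteq> mspace (X v)" if "v \<in> W" for v
    using U[OF that] by (simp add: openin_mtopology_of_iff)
  then show "Pi\<^sub>E W U \<subseteq> mspace (prod_space X W)"
    using W by (auto simp: mspace_prod_space PiE_iff)
  fix x assume x: "x \<in> Pi\<^sub>E W U"
  have "\<exists>r>0. \<forall>y\<in>mspace (X v). mdist (X v) (x v) y < r \<longrightarrow> y \<in> U v" if "v \<in> W" for v
    using U[OF that] PiE_mem[OF x that] by (simp add: openin_mtopology_of_iff)
  then obtain r where r: "\<And>v. v \<in> W \<Longrightarrow> r v > 0"
    "\<And>v y. v \<in> W \<Longrightarrow> y \<in> mspace (X v) \<Longrightarrow> mdist (X v) (x v) y < r v \<Longrightarrow> y \<in> U v"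
    by metis
  \<comment> \<open>The 1 gives the minimum a value when \<open>W\<close> is empty.\<close>
  define s where "s = Min (insert 1 (r ` W))"
  have s: "s > 0" "\<And>v. v \<in> W \<Longrightarrow> s \<le> r v" using W r by (auto simp: s_def)
  show "\<exists>r>0. \<forall>y\<in>mspace (prod_space X W). mdist (prod_space X W) x y < r \<longrightarrow> y \<in> Pi\<^sub>E W U"
  proof (intro exI[of _ s] conjI ballI impI s(1))
    fix y assume y: "y \<in> mspace (prod_space X W)" "mdist (prod_space X W) x y < s"
    have "y v \<in> U v" if "v \<in> W" for v
      using r(2)[OF that, of "y v"] y W that s(2)[OF that] mdist_coordinate_le[OF W that, of X x y]
      by (auto simp: mspace_prod_space)
    then show "y \<in> Pi\<^sub>E W U" using y W by (auto simp: mspace_prod_space PiE_iff)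
  qed
qed

text \<open>Sides from countable bases give countably many boxes, so every open set of the product
  is a countable union of boxes. Second countability of the product and the comparison of the two
  \<sigma>-algebras both rest on this.\<close>

lemma box_base:
  assumes W: "finite W"
    and sep: "\<forall>v\<in>W. second_countable (mtopology_of (X v))"
  shows "\<exists>B. (\<forall>v\<in>W. countable (B v)) \<and> (\<forall>v\<in>W. \<forall>S\<in>B v. openin (mtopology_of (X v)) S) \<and>
    (\<forall>U x. openin (mtopology_of (prod_space X W)) U \<longrightarrow> x \<in> U \<longrightarrow>
       (\<exists>f\<in>Pi\<^sub>E W B. x \<in> Pi\<^sub>E W f \<and> Pi\<^sub>E W f \<subseteq> U))"
proof -
  have "\<exists>B. countable B \<and> (\<forall>S\<in>B. openin (mtopology_of (X v)) S) \<and>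
      (\<forall>U x. openin (mtopology_of (X v)) U \<and> x \<in> U \<longrightarrow> (\<exists>S\<in>B. x \<in> S \<and> S \<subseteq> U))" if "v \<in> W" for v
    using sep that by (simp add: second_countable_def)
  then obtain B where B: "\<And>v. v \<in> W \<Longrightarrow> countable (B v)"
    "\<And>v S. v \<in> W \<Longrightarrow> S \<in> B v \<Longrightarrow> openin (mtopology_of (X v)) S"
    "\<And>v U x. v \<in> W \<Longrightarrow> openin (mtopology_of (X v)) U \<Longrightarrow> x \<in> U \<Longrightarrow>
      \<exists>S\<in>B v. x \<in> S \<and> S \<subseteq> U"
    by metis
  show ?thesis
  proof (intro exI[of _ B] conjI ballI allI impI)
    fix U x assume U: "openin (mtopology_of (prod_space X W)) U" "x \<in> U"
    then obtain r where r: "r > 0"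
      "\<And>y. y \<in> mspace (prod_space X W) \<Longrightarrow> mdist (prod_space X W) x y < r \<Longrightarrow> y \<in> U"
      unfolding openin_mtopology_of_iff by blast
    have xW: "x \<in> mspace (prod_space X W)" using U openin_subset_mspace by blast
    have x: "x v \<in> mspace (X v)" if "v \<in> W" for v
      using xW W that by (auto simp: mspace_prod_space)
    \<comment> \<open>The product distance is at most the sum of \<open>card W\<close> coordinate
      distances; the successor keeps the resulting bound strictly below \<open>r\<close> and covers
      empty \<open>W\<close>.\<close>
    define s where "s = r / real (Suc (card W))"
    have s: "s > 0" using r by (simp add: s_def)
    have "\<exists>S\<in>B v. x v \<in> S \<and> (\<forall>y\<in>S. mdist (X v) (x v) y < s)" if v: "v \<in> W" for v
    proof -
      interpret Metric_space "mspace (X v)" "mdist (X v)" by (rule Metric_space_mspace_mdist)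
      have "openin (mtopology_of (X v)) (mball (x v) s)" by (simp add: mtopology_of_def)
      from B(3)[OF v this, of "x v"] show ?thesis using x[OF v] s by (auto simp: subset_iff)
    qed
    then obtain f where f: "\<And>v. v \<in> W \<Longrightarrow> f v \<in> B v \<and> x v \<in> f v"
      "\<And>v y. v \<in> W \<Longrightarrow> y \<in> f v \<Longrightarrow> mdist (X v) (x v) y < s" by metis
    show "\<exists>f\<in>Pi\<^sub>E W B. x \<in> Pi\<^sub>E W f \<and> Pi\<^sub>E W f \<subseteq> U"
    proof (intro bexI[of _ "restrict f W"] conjI)
      show "restrict f W \<in> Pi\<^sub>E W B" using f by auto
      show "x \<in> Pi\<^sub>E W (restrict f W)" using f xW W by (auto simp: mspace_prod_space PiE_iff)
      show "Pi\<^sub>E W (restrict f W) \<subseteq> U"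
      proof
        fix y assume y: "y \<in> Pi\<^sub>E W (restrict f W)"
        have fs: "f v \<subseteq> mspace (X v)" if "v \<in> W" for v
          using B(2)[OF that] f(1)[OF that] by (auto simp: openin_mtopology_of_iff)
        have ys: "y \<in> mspace (prod_space X W)"
          using y fs W by (fastforce simp: mspace_prod_space PiE_iff)
        have "mdist (prod_space X W) x y \<le> (\<Sum>v\<in>W. mdist (X v) (x v) (y v))"
          by (rule mdist_prod_space_le_sum[OF W])
        also have "\<dots> \<le> (\<Sum>v\<in>W. s)"
          using y f(2) by (intro sum_mono less_imp_le) (auto simp: PiE_iff)
        also have "\<dots> < r" using r by (simp add: s_def field_simps)
        finally show "y \<in> U" using r ys by auto
      qed
    qed
  qed (fact B)+
qed

lemma second_countable_prod_space:
  assumes W: "finite W"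
    and sep: "\<forall>v\<in>W. second_countable (mtopology_of (X v))"
  shows "second_countable (mtopology_of (prod_space X W))"
proof -
  obtain B where "\<forall>v\<in>W. countable (B v)"
    "\<forall>v\<in>W. \<forall>S\<in>B v. openin (mtopology_of (X v)) S"
    "\<forall>U x. openin (mtopology_of (prod_space X W)) U \<longrightarrow> x \<in> U \<longrightarrow>
       (\<exists>f\<in>Pi\<^sub>E W B. x \<in> Pi\<^sub>E W f \<and> Pi\<^sub>E W f \<subseteq> U)"
    using box_base[OF W sep] by (elim exE conjE) (rule that)
  note B = this[rule_format]
  show ?thesis unfolding second_countable_def
  proof (intro exI[of _ "Pi\<^sub>E W ` Pi\<^sub>E W B"] conjI ballI allI impI)
    show "countable (Pi\<^sub>E W ` Pi\<^sub>E W B)" using W B(1) by (intro countable_image countable_PiE)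
    show "openin (mtopology_of (prod_space X W)) S" if S: "S \<in> Pi\<^sub>E W ` Pi\<^sub>E W B" for S
    proof -
      obtain f where f: "S = Pi\<^sub>E W f" "f \<in> Pi\<^sub>E W B" using S by blast
      show ?thesis unfolding f(1) using f(2) B(2) by (intro openin_box[OF W]) auto
    qed
    fix U x assume "openin (mtopology_of (prod_space X W)) U \<and> x \<in> U"
    then obtain f where "f \<in> Pi\<^sub>E W B" "x \<in> Pi\<^sub>E W f" "Pi\<^sub>E W f \<subseteq> U"
      using B(3)[of U x] by auto
    then show "\<exists>S\<in>Pi\<^sub>E W ` Pi\<^sub>E W B. x \<in> S \<and> S \<subseteq> U" by (intro bexI[of _ "Pi\<^sub>E W f"]) auto
  qed
qed

text \<open>Open sets are countable unions of boxes, which puts the Borel sets of the product metric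
  into the product \<sigma>-algebra. Conversely, coordinates are continuous.\<close>

lemma sets_borel_prod_space:
  assumes W: "finite W"
    and sep: "\<forall>v\<in>W. second_countable (mtopology_of (X v))"
  shows "sets (borel_space (prod_space X W)) = sets (PiM W (\<lambda>v. borel_space (X v)))"
proof (rule antisym)
  have spPi: "space (PiM W (\<lambda>v. borel_space (X v))) = mspace (prod_space X W)"
    using W by (simp add: space_PiM space_borel_space mspace_prod_space)
  obtain B where "\<forall>v\<in>W. countable (B v)"
    "\<forall>v\<in>W. \<forall>S\<in>B v. openin (mtopology_of (X v)) S"
    "\<forall>U x. openin (mtopology_of (prod_space X W)) U \<longrightarrow> x \<in> U \<longrightarrow>
       (\<exists>f\<in>Pi\<^sub>E W B. x \<in> Pi\<^sub>E W f \<and> Pi\<^sub>E W f \<subseteq> U)"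
    using box_base[OF W sep] by (elim exE conjE) (rule that)
  note B = this[rule_format]
  have "U \<in> sets (PiM W (\<lambda>v. borel_space (X v)))"
    if U: "openin (mtopology_of (prod_space X W)) U" for U
  proof -
    let ?C = "{f \<in> Pi\<^sub>E W B. Pi\<^sub>E W f \<subseteq> U}"
    have "countable ?C" using W B(1) by (intro countable_subset[OF _ countable_PiE[of W B]]) auto
    moreover have "Pi\<^sub>E W f \<in> sets (PiM W (\<lambda>v. borel_space (X v)))" if "f \<in> ?C" for f
      using that W B(2) by (intro sets_PiM_I_finite borel_openin) auto
    moreover have "U = (\<Union>f\<in>?C. Pi\<^sub>E W f)"
    proof
      show "U \<subseteq> (\<Union>f\<in>?C. Pi\<^sub>E W f)"
      proof
        fix x assume "x \<in> U"
        from B(3)[OF U this] show "x \<in> (\<Union>f\<in>?C. Pi\<^sub>E W f)" by auto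
      qed
    qed auto
    ultimately show ?thesis
      using sets.countable_UN'[of ?C "Pi\<^sub>E W" "PiM W (\<lambda>v. borel_space (X v))"] by auto
  qed
  then show "sets (borel_space (prod_space X W)) \<subseteq> sets (PiM W (\<lambda>v. borel_space (X v)))"
    using sets.sigma_sets_subset[of "{U. openin (mtopology_of (prod_space X W)) U}"
        "PiM W (\<lambda>v. borel_space (X v))"] openin_subset_mspace[of "prod_space X W"]
    unfolding spPi borel_space_def[of "prod_space X W"]
    by (subst sets_measure_of) blast+
  have coord: "(\<lambda>x. x v) \<in> measurable (borel_space (prod_space X W)) (borel_space (X v))"
    if v: "v \<in> W" for v
  proof (rule measurable_borel_spaceI)
    show "(\<lambda>x. x v) \<in> space (borel_space (prod_space X W)) \<rightarrow> mspace (X v)"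
      using v W by (auto simp: space_borel_space mspace_prod_space)
    fix U assume U: "openin (mtopology_of (X v)) U"
    have "(\<lambda>x. x v) -` U \<inter> mspace (prod_space X W)
        = Pi\<^sub>E W (\<lambda>u. if u = v then U else mspace (X u))"
      using v openin_subset_mspace[OF U] by (auto simp: mspace_prod_space[OF W] PiE_iff split: if_splits)
        (metis subsetD)
    moreover have "openin (mtopology_of (X u)) (mspace (X u))" for u
      unfolding openin_mtopology_of_iff using zero_less_one by blast
    then have "openin (mtopology_of (prod_space X W)) (Pi\<^sub>E W (\<lambda>u. if u = v then U else mspace (X u)))"
      using U by (intro openin_box[OF W]) simp
    ultimately show "(\<lambda>x. x v) -` U \<inter> space (borel_space (prod_space X W))
        \<in> sets (borel_space (prod_space X W))"
      unfolding space_borel_space by (simp add: borel_openin)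
  qed
  have "(\<lambda>x. x) \<in> measurable (borel_space (prod_space X W)) (PiM W (\<lambda>v. borel_space (X v)))"
    by (rule measurable_PiM_single')
      (use coord W in \<open>auto simp: space_borel_space mspace_prod_space\<close>)
  then show "sets (PiM W (\<lambda>v. borel_space (X v))) \<subseteq> sets (borel_space (prod_space X W))"
  proof (intro subsetI)
    fix S assume id: "(\<lambda>x. x) \<in> measurable (borel_space (prod_space X W)) (PiM W (\<lambda>v. borel_space (X v)))"
      and S: "S \<in> sets (PiM W (\<lambda>v. borel_space (X v)))"
    have "S \<subseteq> mspace (prod_space X W)" using sets.sets_into_space[OF S] spPi by simp
    then show "S \<in> sets (borel_space (prod_space X W))"
      using measurable_sets[OF id S] by (simp add: space_borel_space Int_absorb2)
  qed
qed

text \<open>By the Lindelof property countably many of the neighbourhoods of finite measure cover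
  the space.\<close>

lemma sigma_finite_locally_finite:
  assumes sep: "second_countable (mtopology_of m)" and M: "locally_finite_measure m M"
  shows "sigma_finite_measure M"
proof -
  have "\<exists>U. openin (mtopology_of m) U \<and> x \<in> U \<and> emeasure M U < \<infinity>" if "x \<in> mspace m" for x
    using M that by (auto simp: locally_finite_measure_def)
  then obtain U where U: "\<And>x. x \<in> mspace m \<Longrightarrow>
      openin (mtopology_of m) (U x) \<and> x \<in> U x \<and> emeasure M (U x) < \<infinity>" by metis
  obtain C where C: "countable C" "C \<subseteq> mspace m" "(\<Union>x\<in>C. U x) = mspace m"
    using countable_subcover_mtopology_of[OF sep, of U] U by blast
  have sM: "sets M = sets (borel_space m)" using M by (simp add: locally_finite_measure_def)
  have "space M = mspace m" using sets_eq_imp_space_eq[OF sM] by (simp add: space_borel_space)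
  then show ?thesis
    using C(1,3) U[OF subsetD[OF C(2)]] sM borel_openin[of m]
    by (intro sigma_finite_measure.intro exI[of _ "U ` C"]) (auto simp: less_top[symmetric])
qed

section \<open>The global Markov property\<close>

text \<open>Densities are functions of full assignments, so that the same expression can be
  integrated over products with different index sets. This predicate records which coordinates
  matter.\<close>

definition depends_on :: "'v set \<Rightarrow> (('v \<Rightarrow> 'a) \<Rightarrow> 'b) \<Rightarrow> bool" where
  "depends_on D f \<longleftrightarrow> (\<forall>x y. (\<forall>i\<in>D. x i = y i) \<longrightarrow> f x = f y)"

lemma depends_onD: "depends_on D f \<Longrightarrow> (\<And>i. i \<in> D \<Longrightarrow> x i = y i) \<Longrightarrow> f x = f y"
  by (auto simp: depends_on_def)

lemma depends_on_mono: "depends_on D f \<Longrightarrow> D \<subseteq> D' \<Longrightarrow> depends_on D' f"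
  by (auto simp: depends_on_def)

lemma depends_on_mult: "depends_on D f \<Longrightarrow> depends_on D g \<Longrightarrow> depends_on D (\<lambda>x. f x * g x)"
  unfolding depends_on_def by metis

lemma depends_on_prod:
  "(\<And>v. v \<in> W \<Longrightarrow> depends_on D (f v)) \<Longrightarrow> depends_on D (\<lambda>x. \<Prod>v\<in>W. f v x)"
  unfolding depends_on_def by (intro allI impI prod.cong) auto

lemma depends_on_restrict: "depends_on D (\<lambda>x. f (restrict x D))"
  unfolding depends_on_def by (metis restrict_ext)

lemma depends_on_measurable:
  assumes "depends_on D f" "f \<in> measurable (PiM D M) N" "D \<subseteq> W"
  shows "f \<in> measurable (PiM W M) N"
proof -
  have "(\<lambda>x. f (restrict x D)) \<in> measurable (PiM W M) N"
    using measurable_restrict_subset[OF assms(3)] assms(2) by measurable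
  moreover have "(\<lambda>x. f (restrict x D)) = f"
    using assms(1) by (auto simp: fun_eq_iff intro!: depends_onD[OF assms(1)])
  ultimately show ?thesis by simp
qed

text \<open>Testing with \<open>U = space M\<close> identifies \<open>r\<close> as the conditional
  probability of \<open>S\<close> given \<open>F\<close>; testing with \<open>U = T\<close> shows
  that this value is unaffected by the occurrence of \<open>T\<close>.\<close>

lemma (in prob_space) cond_indep_eventsI:
  assumes F: "subalgebra M F" and S: "S \<in> sets M" and T: "T \<in> sets M"
    and r: "r \<in> borel_measurable F" "\<And>x. 0 \<le> r x" "\<And>x. r x \<le> 1"
    and int: "\<And>U G. U \<in> {T, space M} \<Longrightarrow> G \<in> sets F \<Longrightarrow>
      prob (S \<inter> (U \<inter> G)) = (\<integral>x. r x * indicator (U \<inter> G) x \<partial>M)"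
  shows "cond_indep_events M F S T"
proof -
  interpret finite_measure_subalgebra M F by (rule finite_measure_subalgebraI[OF F])
  have rM: "r \<in> borel_measurable M" using r(1) F by (metis measurable_from_subalg)
  have i: "integrable M (indicator U :: _ \<Rightarrow> real)" if "U \<in> sets M" for U
    using that by (simp add: integrable_indicator_iff emeasure_eq_measure)
  have ir: "integrable M (\<lambda>x. r x * indicator U x)" if "U \<in> sets M" for U
    by (rule integrable_const_bound[of _ 1])
      (use that r rM in \<open>auto simp: indicator_def abs_le_iff intro: order_trans[of _ 0]\<close>)
  have ce: "AE x in M. real_cond_exp M F (indicator (S \<inter> U)) x = r x * real_cond_exp M F (indicator U) x"
    if U: "U \<in> {T, space M}" for U
  proof (rule real_cond_exp_charact)
    have UM: "U \<in> sets M" using U T by auto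
    show "integrable M (indicator (S \<inter> U) :: _ \<Rightarrow> real)" using S UM by (intro i) auto
    show "integrable M (\<lambda>x. r x * real_cond_exp M F (indicator U) x)"
      by (rule real_cond_exp_intg(1)[OF ir[OF UM] r(1)]) (use UM in auto)
    show "(\<lambda>x. r x * real_cond_exp M F (indicator U) x) \<in> borel_measurable F"
      using r(1) by measurable
    fix G assume G: "G \<in> sets F"
    have GM: "G \<in> sets M" using G F by (auto simp: subalgebra_def)
    have UG: "U \<inter> G \<in> sets M" "S \<inter> (U \<inter> G) \<in> sets M" using UM GM S by auto
    have "(\<integral>x\<in>G. indicator (S \<inter> U) x \<partial>M) = (\<integral>x. indicator (S \<inter> (U \<inter> G)) x \<partial>M)"
      unfolding set_lebesgue_integral_def
      by (intro Bochner_Integration.integral_cong) (auto simp: indicator_def)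
    also have "\<dots> = prob (S \<inter> (U \<inter> G))"
      using sets.sets_into_space[OF UG(2)] by (simp add: Int_absorb2)
    also have "\<dots> = (\<integral>x. (indicator G x * r x) * indicator U x \<partial>M)"
      unfolding int[OF U G] by (intro Bochner_Integration.integral_cong) (auto simp: indicator_def)
    also have "\<dots> = (\<integral>x. (indicator G x * r x) * real_cond_exp M F (indicator U) x \<partial>M)"
    proof (rule real_cond_exp_intg(2)[symmetric])
      have "integrable M (\<lambda>x. r x * indicator (G \<inter> U) x)" using GM UM by (intro ir) auto
      then show "integrable M (\<lambda>x. indicator G x * r x * indicator U x)"
        by (simp add: indicator_inter_arith mult_ac)
    qed (use G r UM in auto)
    finally show "(\<integral>x\<in>G. indicator (S \<inter> U) x \<partial>M)
        = (\<integral>x\<in>G. r x * real_cond_exp M F (indicator U) x \<partial>M)"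
      unfolding set_lebesgue_integral_def by (simp add: mult.assoc)
  qed
  have one: "AE x in M. real_cond_exp M F (indicator (space M)) x = 1"
  proof -
    have "AE x in M. real_cond_exp M F (indicator (space M)) x = real_cond_exp M F (\<lambda>_. 1) x"
      by (rule real_cond_exp_cong) auto
    moreover have "AE x in M. real_cond_exp M F (\<lambda>_. 1) x = 1"
      by (rule real_cond_exp_F_meas) auto
    ultimately show ?thesis by eventually_elim simp
  qed
  have "S \<inter> space M = S" using sets.sets_into_space[OF S] by auto
  then have "AE x in M. real_cond_exp M F (indicator S) x
      = r x * real_cond_exp M F (indicator (space M)) x"
    using ce[of "space M"] by simp
  with one ce[OF insertI1] show ?thesis
    unfolding cond_indep_events_def by eventually_elim simp
qed

section \<open>Reference measures and products of conditional densities\<close>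

locale bayes_space = dag_graph V E for V :: "'v set" and E +
  fixes X :: "'v \<Rightarrow> 'a metric" and \<mu> :: "'v \<Rightarrow> 'a measure"
  assumes separable: "\<And>v. v \<in> V \<Longrightarrow> separable_space (mtopology_of (X v))"
    and nonempty: "\<And>v. v \<in> V \<Longrightarrow> mspace (X v) \<noteq> {}"
    and locally_finite: "\<And>v. v \<in> V \<Longrightarrow> locally_finite_measure (X v) (\<mu> v)"
begin

text \<open>Products of measures require \<open>\<sigma>\<close>-finiteness at every index, also outside of \<open>V\<close>.\<close>

definition ref :: "'v \<Rightarrow> 'a measure" where
  "ref v = (if v \<in> V then \<mu> v else null_measure (count_space UNIV))"

lemma second_countable_X: "v \<in> V \<Longrightarrow> second_countable (mtopology_of (X v))"
  using separable second_countable_mtopology_of by blast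

lemma sets_ref: "v \<in> V \<Longrightarrow> sets (ref v) = sets (borel_space (X v))"
  using locally_finite by (simp add: ref_def locally_finite_measure_def)

lemma space_ref: "v \<in> V \<Longrightarrow> space (ref v) = mspace (X v)"
  using sets_eq_imp_space_eq[OF sets_ref] by (simp add: space_borel_space)

sublocale product_sigma_finite ref
proof (rule product_sigma_finite.intro)
  fix v
  show "sigma_finite_measure (ref v)"
  proof (cases "v \<in> V")
    case True
    then show ?thesis
      using sigma_finite_locally_finite[OF second_countable_X locally_finite] by (simp add: ref_def)
  next
    case False
    have "finite_measure (null_measure (count_space (UNIV :: 'a set)))"
      by (rule finite_measureI) simp
    then show ?thesis using False by (simp add: ref_def finite_measure.axioms)
  qed
qed

lemma finite_subset_V: "W \<subseteq> V \<Longrightarrow> finite W"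
  using finite_V finite_subset by blast

lemma sets_prod: "W \<subseteq> V \<Longrightarrow> sets (borel_space (prod_space X W)) = sets (PiM W ref)"
proof -
  assume W: "W \<subseteq> V"
  have "sets (borel_space (prod_space X W)) = sets (PiM W (\<lambda>v. borel_space (X v)))"
    using W second_countable_X by (intro sets_borel_prod_space finite_subset_V) auto
  also have "\<dots> = sets (PiM W ref)"
    using W sets_ref by (intro sets_PiM_cong) auto
  finally show ?thesis .
qed

lemma space_prod: "W \<subseteq> V \<Longrightarrow> space (PiM W ref) = mspace (prod_space X W)"
  using sets_eq_imp_space_eq[OF sets_prod] by (simp add: space_borel_space)

lemma space_prod_PiE: "W \<subseteq> V \<Longrightarrow> space (PiM W ref) = (\<Pi>\<^sub>E v\<in>W. mspace (X v))"
  by (simp add: space_prod mspace_prod_space finite_subset_V)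

definition family :: "'v \<Rightarrow> 'v set" where
  "family v = insert v (pa E v)"

text \<open>A conditional density of the vertex given its parents. It is normalised at every value
  of the parents, not just almost every, so that the vertex can be integrated out pointwise.\<close>

definition cpd :: "'v \<Rightarrow> (('v \<Rightarrow> 'a) \<Rightarrow> ennreal) \<Rightarrow> bool" where
  "cpd v f \<longleftrightarrow> depends_on (family v) f \<and> f \<in> borel_measurable (PiM (family v) ref) \<and>
     (\<forall>x\<in>space (PiM (pa E v) ref). (\<integral>\<^sup>+y. f (x(v := y)) \<partial>ref v) = 1)"

definition parent_closed :: "'v set \<Rightarrow> bool" where
  "parent_closed W \<longleftrightarrow> W \<subseteq> V \<and> (\<forall>v\<in>W. pa E v \<subseteq> W)"

lemma cpd_measurable: "cpd v f \<Longrightarrow> family v \<subseteq> W \<Longrightarrow> f \<in> borel_measurable (PiM W ref)"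
  using depends_on_measurable by (auto simp: cpd_def)

lemma cpd_depends_on: "cpd v f \<Longrightarrow> depends_on (family v) f"
  by (simp add: cpd_def)

lemma cpd_integral:
  assumes "cpd v f" "pa E v \<subseteq> W" "x \<in> space (PiM W ref)"
  shows "(\<integral>\<^sup>+y. f (x(v := y)) \<partial>ref v) = 1"
proof -
  have "restrict x (pa E v) \<in> space (PiM (pa E v) ref)"
    using assms measurable_space[OF measurable_restrict_subset[OF assms(2)]] by blast
  then have "(\<integral>\<^sup>+y. f ((restrict x (pa E v))(v := y)) \<partial>ref v) = 1"
    using assms by (auto simp: cpd_def)
  moreover have "f ((restrict x (pa E v))(v := y)) = f (x(v := y))" for y
    by (rule depends_onD[OF cpd_depends_on[OF assms(1)]]) (auto simp: family_def)
  ultimately show ?thesis by simp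
qed

lemma joint_measurable:
  assumes "\<And>v. v \<in> U \<Longrightarrow> cpd v (f v)" "\<And>v. v \<in> U \<Longrightarrow> family v \<subseteq> W"
  shows "(\<lambda>z. \<Prod>v\<in>U. f v z) \<in> borel_measurable (PiM W ref)"
  by (rule borel_measurable_prod_ennreal) (use assms in \<open>auto intro: cpd_measurable\<close>)

lemma family_subset: "parent_closed W \<Longrightarrow> v \<in> W \<Longrightarrow> family v \<subseteq> W"
  by (auto simp: parent_closed_def family_def)

lemma parent_closed_V: "parent_closed V"
  using pa_subset by (auto simp: parent_closed_def)

lemma sink_exists:
  assumes "finite W" "W \<noteq> {}"
  obtains v where "v \<in> W" "\<And>w. w \<in> W \<Longrightarrow> (v, w) \<notin> E"
proof -
  have "finite E" using finite_V edges by (meson finite_SigmaI finite_subset)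
  then have "wf (E\<inverse>)" using acyclic by (simp add: finite_acyclic_wf_converse)
  then show thesis using assms that by (metis converse_iff ex_in_conv wfE_min)
qed

text \<open>The vertices of \<open>W' - W\<close> are integrated out one by one, a sink first: the
  other factors and \<phi> do not depend on a sink, and its own factor has integral 1.\<close>

lemma joint_marginal:
  assumes cpd: "\<And>v. v \<in> V \<Longrightarrow> cpd v (f v)"
    and W: "parent_closed W"
    and \<phi>: "depends_on W \<phi>" "\<phi> \<in> borel_measurable (PiM W ref)"
    and W': "parent_closed W'" "W \<subseteq> W'"
  shows "(\<integral>\<^sup>+z. \<phi> z * (\<Prod>v\<in>W'. f v z) \<partial>PiM W' ref) = (\<integral>\<^sup>+z. \<phi> z * (\<Prod>v\<in>W. f v z) \<partial>PiM W ref)"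
  using W'
proof (induction "card (W' - W)" arbitrary: W')
  case 0
  have "finite W'" using 0 finite_subset_V by (auto simp: parent_closed_def)
  then have "W' = W" using 0 by auto
  then show ?case by simp
next
  case (Suc n)
  have fW': "finite W'" "W' \<subseteq> V" using Suc finite_subset_V by (auto simp: parent_closed_def)
  moreover have "W' - W \<noteq> {}" using Suc.hyps(2) by (metis card.empty nat.distinct(1))
  ultimately obtain v where v: "v \<in> W' - W" "\<And>w. w \<in> W' - W \<Longrightarrow> (v, w) \<notin> E"
    by (metis finite_Diff sink_exists)
  \<comment> \<open>\<open>W\<close> contains the parents of its vertices, so no arrow leads from
    \<open>W' - W\<close> into it; a sink of the difference is a sink of \<open>W'\<close>.\<close>
  have sink: "(v, w) \<notin> E" if "w \<in> W'" for w
    using v that W by (cases "w \<in> W") (auto simp: parent_closed_def pa_def)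
  let ?U = "W' - {v}"
  have U: "parent_closed ?U"
    using Suc.prems(1) sink by (auto simp: parent_closed_def pa_def)
  have ins: "insert v ?U = W'" using v by auto
  have pav: "pa E v \<subseteq> ?U" using Suc.prems(1) v not_in_pa by (auto simp: parent_closed_def)
  have \<phi>m: "\<phi> \<in> borel_measurable (PiM W' ref)" "\<phi> \<in> borel_measurable (PiM ?U ref)"
    by (rule depends_on_measurable[OF \<phi>], use Suc.prems(2) v in blast)+
  have jm: "(\<lambda>z. \<Prod>w\<in>W'. f w z) \<in> borel_measurable (PiM W' ref)"
    "(\<lambda>z. \<Prod>w\<in>?U. f w z) \<in> borel_measurable (PiM ?U ref)"
    using family_subset[OF Suc.prems(1)] family_subset[OF U] fW' cpd
    by (auto intro!: joint_measurable)
  have upd: "\<phi> (x(v := y)) * (\<Prod>w\<in>W'. f w (x(v := y))) = \<phi> x * (\<Prod>w\<in>?U. f w x) * f v (x(v := y))"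
    for x y
  proof -
    have "\<phi> (x(v := y)) = \<phi> x" by (rule depends_onD[OF \<phi>(1)]) (use v in auto)
    moreover have "f w (x(v := y)) = f w x" if "w \<in> ?U" for w
      by (rule depends_onD[OF cpd_depends_on[OF cpd]])
        (use that fW' sink in \<open>auto simp: family_def pa_def\<close>)
    moreover have "(\<Prod>w\<in>W'. f w (x(v := y))) = f v (x(v := y)) * (\<Prod>w\<in>?U. f w (x(v := y)))"
      using fW' v by (intro prod.remove) auto
    ultimately show ?thesis by (simp add: mult_ac)
  qed
  have fv: "(\<lambda>y. f v (x(v := y))) \<in> borel_measurable (ref v)" if "x \<in> space (PiM ?U ref)" for x
  proof -
    have "f v \<in> borel_measurable (PiM (insert v ?U) ref)"
      unfolding ins using v fW' cpd[of v] family_subset[OF Suc.prems(1), of v]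
      by (auto intro: cpd_measurable)
    from measurable_compose[OF measurable_component_update[OF that] this] show ?thesis by simp
  qed
  have "(\<integral>\<^sup>+z. \<phi> z * (\<Prod>v\<in>W'. f v z) \<partial>PiM W' ref)
    = (\<integral>\<^sup>+x. (\<integral>\<^sup>+y. \<phi> (x(v := y)) * (\<Prod>w\<in>W'. f w (x(v := y))) \<partial>ref v) \<partial>PiM ?U ref)"
    using product_nn_integral_insert[of ?U v "\<lambda>z. \<phi> z * (\<Prod>v\<in>W'. f v z)"] fW' \<phi>m jm
    unfolding ins by simp
  also have "\<dots> = (\<integral>\<^sup>+x. \<phi> x * (\<Prod>w\<in>?U. f w x) \<partial>PiM ?U ref)"
    unfolding upd using fv cpd_integral[OF cpd pav] v fW'
    by (intro nn_integral_cong) (auto simp: nn_integral_cmult)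
  also have "\<dots> = (\<integral>\<^sup>+z. \<phi> z * (\<Prod>v\<in>W. f v z) \<partial>PiM W ref)"
  proof (rule Suc.hyps(1)[OF _ U])
    have "?U - W = (W' - W) - {v}" by auto
    then show "n = card (?U - W)" using Suc.hyps(2) v fW' by simp
  qed (use Suc.prems v in auto)
  finally show ?case .
qed

definition joint :: "('v \<Rightarrow> ('v \<Rightarrow> 'a) \<Rightarrow> ennreal) \<Rightarrow> ('v \<Rightarrow> 'a) measure" where
  "joint f = density (PiM V ref) (\<lambda>z. \<Prod>v\<in>V. f v z)"

lemma sets_joint: "sets (joint f) = sets (borel_space (prod_space X V))"
  by (simp add: joint_def sets_prod)

lemma space_joint: "space (joint f) = mspace (prod_space X V)"
  by (simp add: joint_def space_prod)

lemma restrict_measurable: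
  assumes "W \<subseteq> U" "U \<subseteq> V"
  shows "(\<lambda>x. restrict x W) \<in> measurable (borel_space (prod_space X U)) (borel_space (prod_space X W))"
proof -
  have "W \<subseteq> V" using assms by auto
  have "measurable (borel_space (prod_space X U)) (borel_space (prod_space X W))
      = measurable (PiM U ref) (PiM W ref)"
    using assms \<open>W \<subseteq> V\<close> by (intro measurable_cong_sets sets_prod) auto
  then show ?thesis using measurable_restrict_subset[OF assms(1)] by simp
qed

lemma sigma_coord_eq:
  assumes "space P = mspace (prod_space X V)"
  shows "sigma_coord X P C = vimage_algebra (mspace (prod_space X V)) (\<lambda>x. restrict x C)
    (borel_space (prod_space X C))"
  by (simp add: sigma_coord_def assms)

lemma restrict_space: "C \<subseteq> V \<Longrightarrow> z \<in> mspace (prod_space X V) \<Longrightarrow> restrict z C \<in> mspace (prod_space X C)"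
  using measurable_space[OF restrict_measurable[of C V]] by (simp add: space_borel_space)

lemma subalgebra_sigma_coord:
  assumes P: "sets P = sets (borel_space (prod_space X V))" and C: "C \<subseteq> V"
  shows "subalgebra P (sigma_coord X P C)"
proof -
  have sp: "space P = mspace (prod_space X V)"
    using sets_eq_imp_space_eq[OF P] by (simp add: space_borel_space)
  show ?thesis unfolding subalgebra_def sigma_coord_eq[OF sp]
    using restrict_measurable[OF C order_refl] P sp
    by (auto simp: sets_vimage_algebra2 restrict_space[OF C] space_borel_space Pi_iff
        dest: measurable_sets)
qed

definition cyl :: "'v set \<Rightarrow> ('v \<Rightarrow> 'a) set \<Rightarrow> ('v \<Rightarrow> 'a) set" where
  "cyl A S = {z \<in> mspace (prod_space X V). restrict z A \<in> S}"

lemma cyl_sets: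
  assumes "A \<subseteq> V" "S \<in> sets (borel_space (prod_space X A))"
  shows "cyl A S \<in> sets (borel_space (prod_space X V))"
proof -
  have "cyl A S = (\<lambda>x. restrict x A) -` S \<inter> space (borel_space (prod_space X V))"
    by (auto simp: cyl_def space_borel_space)
  then show ?thesis
    using measurable_sets[OF restrict_measurable[OF assms(1) order_refl] assms(2)] by simp
qed

lemma cond_indep_iff_events:
  assumes sp: "space P = mspace (prod_space X V)"
  shows "cond_indep X P A B C \<longleftrightarrow>
    (\<forall>S\<in>sets (borel_space (prod_space X A)). \<forall>T\<in>sets (borel_space (prod_space X B)).
       cond_indep_events P (sigma_coord X P C) (cyl A S) (cyl B T))"
proof -
  have "{z \<in> space P. restrict z A \<in> S \<and> restrict z B \<in> T} = cyl A S \<inter> cyl B T" for S T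
    by (auto simp: cyl_def sp)
  moreover have "{z \<in> space P. restrict z A \<in> S} = cyl A S" for A S
    by (auto simp: cyl_def sp)
  ultimately show ?thesis unfolding cond_indep_def cond_indep_events_def by simp
qed

end

locale joint_cpds = bayes_space V E X \<mu>
  for V :: "'v set" and E and X :: "'v \<Rightarrow> 'a metric" and \<mu> +
  fixes f :: "'v \<Rightarrow> ('v \<Rightarrow> 'a) \<Rightarrow> ennreal"
  assumes cpd: "\<And>v. v \<in> V \<Longrightarrow> cpd v (f v)"
begin

lemma joint_density_measurable: "(\<lambda>z. \<Prod>v\<in>V. f v z) \<in> borel_measurable (PiM V ref)"
  using family_subset[OF parent_closed_V] cpd by (intro joint_measurable) auto

lemma prob_space_joint: "prob_space (joint f)"
proof
  have "emeasure (joint f) (space (joint f)) = (\<integral>\<^sup>+z. 1 * (\<Prod>v\<in>V. f v z) \<partial>PiM V ref)"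
    using joint_density_measurable unfolding joint_def
    by (subst emeasure_density) (auto intro!: nn_integral_cong)
  also have "\<dots> = (\<integral>\<^sup>+z. 1 * (\<Prod>v\<in>{}. f v z) \<partial>PiM {} ref)"
    by (rule joint_marginal[OF cpd _ _ _ parent_closed_V]) (auto simp: depends_on_def parent_closed_def)
  also have "\<dots> = 1" by (subst nn_integral_empty) auto
  finally show "emeasure (joint f) (space (joint f)) = 1" .
qed

lemma joint_borel_probs: "joint f \<in> borel_probs (prod_space X V)"
  by (simp add: borel_probs_iff prob_space_joint sets_joint)

lemma nn_integral_joint:
  assumes "parent_closed W" "depends_on W \<phi>" "\<phi> \<in> borel_measurable (PiM W ref)"
  shows "(\<integral>\<^sup>+z. \<phi> z \<partial>joint f) = (\<integral>\<^sup>+z. \<phi> z * (\<Prod>v\<in>W. f v z) \<partial>PiM W ref)"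
proof -
  have W: "W \<subseteq> V" using assms by (simp add: parent_closed_def)
  have "(\<integral>\<^sup>+z. \<phi> z \<partial>joint f) = (\<integral>\<^sup>+z. \<phi> z * (\<Prod>v\<in>V. f v z) \<partial>PiM V ref)"
    using joint_density_measurable depends_on_measurable[OF assms(2,3) W] unfolding joint_def
    by (subst nn_integral_density) (auto simp: mult.commute)
  also have "\<dots> = (\<integral>\<^sup>+z. \<phi> z * (\<Prod>v\<in>W. f v z) \<partial>PiM W ref)"
    by (rule joint_marginal[OF cpd assms parent_closed_V W])
  finally show ?thesis .
qed

text \<open>The joint density of the ancestral set splits into a factor on \<open>D \<union> C\<close> and a factor on
  \<open>W - D\<close>; integrating out \<open>D\<close> gives a function of the coordinates in \<open>C\<close>.\<close>

lemma d_separated_cond_indep: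
  assumes sep: "d_separated V E A B C" and sub: "A \<subseteq> V" "B \<subseteq> V" "C \<subseteq> V"
  shows "cond_indep X (joint f) A B C"
proof -
  interpret P: prob_space "joint f" by (rule prob_space_joint)
  define W where "W = ancestors E (A \<union> B \<union> C)"
  have ABC: "A \<union> B \<union> C \<subseteq> W" by (auto simp: W_def ancestors_def)
  have WV: "W \<subseteq> V" unfolding W_def using sub by (intro ancestors_subset) auto
  have pcW: "parent_closed W"
    using WV pa_ancestors unfolding parent_closed_def W_def by blast
  obtain D where D: "D \<subseteq> W" "D \<inter> C = {}" "A \<subseteq> D \<union> C" "D \<inter> B = {}"
    "\<And>v. v \<in> W \<Longrightarrow> family v \<subseteq> D \<union> C \<or> family v \<inter> D = {}"
    using d_separated_split[OF sep sub] unfolding W_def family_def by metis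
  define H where "H = W - D"
  have CH: "C \<subseteq> H" and BH: "B \<subseteq> H" using ABC D by (auto simp: H_def)
  have HD: "H \<inter> D = {}" "H \<union> D = W" using D by (auto simp: H_def)
  have fin: "finite W" "finite H" "finite D" "finite C"
    using WV D(1) sub(3) finite_subset_V by (auto simp: H_def intro: finite_subset)
  have DCW: "D \<union> C \<subseteq> W" and HW: "H \<subseteq> W" using D ABC by (auto simp: H_def)
  define W1 where "W1 = {v\<in>W. family v \<subseteq> D \<union> C}"
  define g where "g z = (\<Prod>v\<in>W1. f v z)" for z
  define h where "h z = (\<Prod>v\<in>W - W1. f v z)" for z
  have fam2: "family v \<subseteq> H" if "v \<in> W - W1" for v
    using that D(5)[of v] family_subset[OF pcW, of v] by (auto simp: W1_def H_def)
  have gm: "g \<in> borel_measurable (PiM (D \<union> C) ref)" and gd: "depends_on (D \<union> C) g"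
    unfolding g_def using WV cpd
    by (auto simp: W1_def intro!: joint_measurable depends_on_prod depends_on_mono[OF cpd_depends_on])
  have hm: "h \<in> borel_measurable (PiM H ref)" and hd: "depends_on H h"
    unfolding h_def using WV cpd fam2
    by (auto intro!: joint_measurable depends_on_prod depends_on_mono[OF cpd_depends_on])
  have gh: "(\<Prod>v\<in>W. f v z) = g z * h z" for z
    unfolding g_def h_def using fin by (intro prod.subset_diff[THEN trans]) (auto simp: W1_def mult.commute)
  \<comment> \<open>The integral of \<open>s\<close> times the first factor over the coordinates in
    \<open>D\<close>, those in \<open>C\<close> being fixed at \<open>c\<close>. Divided by
    \<open>N (\<lambda>_. 1) c\<close> it is the conditional mean of \<open>s\<close>.\<close>
  define N where "N s c = (\<integral>\<^sup>+y. s (merge D C (y, c)) * g (merge D C (y, c)) \<partial>PiM D ref)"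
    for s :: "_ \<Rightarrow> ennreal" and c
  have mm: "(\<lambda>(c, y). merge D C (y, c)) \<in> measurable (PiM C ref \<Otimes>\<^sub>M PiM D ref) (PiM (D \<union> C) ref)"
    unfolding split_beta' by (rule measurable_compose[OF measurable_Pair[OF measurable_snd measurable_fst] measurable_merge])
  have Nm: "N s \<in> borel_measurable (PiM C ref)" if s: "s \<in> borel_measurable (PiM (D \<union> C) ref)" for s
  proof -
    interpret Ds: sigma_finite_measure "PiM D ref" using fin by (intro sigma_finite)
    have "(\<lambda>(c, y). s (merge D C (y, c)) * g (merge D C (y, c)))
        \<in> borel_measurable (PiM C ref \<Otimes>\<^sub>M PiM D ref)"
      using measurable_compose[OF mm s] measurable_compose[OF mm gm] by (simp add: split_beta')
    then show ?thesis unfolding N_def by (rule Ds.borel_measurable_nn_integral)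
  qed
  \<comment> \<open>Fubini with \<open>D\<close> integrated first: \<psi> and \<open>h\<close> live
    on \<open>H\<close> and leave the inner integral.\<close>
  have fold: "(\<integral>\<^sup>+z. s z * \<psi> z \<partial>joint f) = (\<integral>\<^sup>+x. \<psi> x * h x * N s (restrict x C) \<partial>PiM H ref)"
    if s: "depends_on (D \<union> C) s" "s \<in> borel_measurable (PiM (D \<union> C) ref)"
      and \<psi>: "depends_on H \<psi>" "\<psi> \<in> borel_measurable (PiM H ref)" for s \<psi>
  proof -
    have sW: "s \<in> borel_measurable (PiM W ref)" "g \<in> borel_measurable (PiM W ref)"
      "\<psi> \<in> borel_measurable (PiM W ref)" "h \<in> borel_measurable (PiM W ref)"
      using depends_on_measurable[OF s DCW] depends_on_measurable[OF gd gm DCW]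
        depends_on_measurable[OF \<psi> HW] depends_on_measurable[OF hd hm HW] by auto
    have "(\<integral>\<^sup>+z. s z * \<psi> z \<partial>joint f) = (\<integral>\<^sup>+z. (s z * \<psi> z) * (\<Prod>v\<in>W. f v z) \<partial>PiM W ref)"
      using sW depends_on_mono[OF s(1) DCW] depends_on_mono[OF \<psi>(1) HW]
      by (intro nn_integral_joint[OF pcW] depends_on_mult) auto
    also have "\<dots> = (\<integral>\<^sup>+z. (s z * \<psi> z) * (g z * h z) \<partial>PiM (H \<union> D) ref)"
      unfolding gh HD ..
    also have "\<dots> = (\<integral>\<^sup>+x. \<integral>\<^sup>+y. (s (merge H D (x, y)) * \<psi> (merge H D (x, y)))
        * (g (merge H D (x, y)) * h (merge H D (x, y))) \<partial>PiM D ref \<partial>PiM H ref)"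
      using sW by (intro product_nn_integral_fold HD fin) (simp add: HD)
    also have "\<dots> = (\<integral>\<^sup>+x. \<psi> x * h x * N s (restrict x C) \<partial>PiM H ref)"
    proof (rule nn_integral_cong)
      fix x assume x: "x \<in> space (PiM H ref)"
      have xC: "restrict x C \<in> space (PiM C ref)"
        using x measurable_space[OF measurable_restrict_subset[OF CH]] by blast
      have 1: "\<psi> (merge H D (x, y)) = \<psi> x" "h (merge H D (x, y)) = h x"
        "s (merge H D (x, y)) = s (merge D C (y, restrict x C))"
        "g (merge H D (x, y)) = g (merge D C (y, restrict x C))" for y
        using HD CH D(2) s(1) \<psi>(1)
        by (auto intro!: depends_onD[OF s(1)] depends_onD[OF gd] depends_onD[OF \<psi>(1)]
            depends_onD[OF hd] simp: merge_def)
      have "(\<lambda>y. (restrict x C, y)) \<in> measurable (PiM D ref) (PiM C ref \<Otimes>\<^sub>M PiM D ref)"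
        using xC by measurable
      from measurable_compose[OF measurable_compose[OF this mm]]
      have m: "(\<lambda>y. s (merge D C (y, restrict x C))) \<in> borel_measurable (PiM D ref)"
        "(\<lambda>y. g (merge D C (y, restrict x C))) \<in> borel_measurable (PiM D ref)"
        using s(2) gm by auto
      have "(\<integral>\<^sup>+y. (s (merge H D (x, y)) * \<psi> (merge H D (x, y)))
          * (g (merge H D (x, y)) * h (merge H D (x, y))) \<partial>PiM D ref)
        = (\<integral>\<^sup>+y. (\<psi> x * h x) * (s (merge D C (y, restrict x C)) * g (merge D C (y, restrict x C)))
            \<partial>PiM D ref)"
        unfolding 1 by (simp add: mult_ac)
      also have "\<dots> = (\<psi> x * h x) * N s (restrict x C)"
        unfolding N_def using m by (intro nn_integral_cmult) auto
      finally show "(\<integral>\<^sup>+y. (s (merge H D (x, y)) * \<psi> (merge H D (x, y)))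
          * (g (merge H D (x, y)) * h (merge H D (x, y))) \<partial>PiM D ref)
        = \<psi> x * h x * N s (restrict x C)" .
    qed
    finally show ?thesis .
  qed
  have one: "(\<lambda>_. 1 :: ennreal) \<in> borel_measurable (PiM (D \<union> C) ref)" by simp
  have rC: "(\<lambda>x. restrict x C) \<in> measurable (PiM H ref) (PiM C ref)"
    by (rule measurable_restrict_subset[OF CH])
  have "(\<integral>\<^sup>+x. 1 * h x * N (\<lambda>_. 1) (restrict x C) \<partial>PiM H ref) = (\<integral>\<^sup>+z. 1 * 1 \<partial>joint f)"
    by (rule fold[symmetric]) (auto simp: depends_on_def)
  also have "\<dots> = 1" using P.emeasure_space_1 by simp
  finally have "(\<integral>\<^sup>+x. h x * N (\<lambda>_. 1) (restrict x C) \<partial>PiM H ref) \<noteq> \<infinity>" by simp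
  \<comment> \<open>\<open>N (\<lambda>_. 1)\<close> may be infinite, but almost everywhere only
    where \<open>h\<close> vanishes. This is what justifies the cancellation in
    \<open>uN\<close>.\<close>
  then have fin_ae: "AE x in PiM H ref. h x * N (\<lambda>_. 1) (restrict x C) \<noteq> \<infinity>"
    using hm measurable_compose[OF rC Nm[OF one]] by (intro nn_integral_PInf_AE) auto
  show ?thesis
    unfolding cond_indep_iff_events[OF space_joint]
  proof (intro ballI)
    fix S T assume S: "S \<in> sets (borel_space (prod_space X A))"
      and T: "T \<in> sets (borel_space (prod_space X B))"
    define s where "s z = (indicator S (restrict z A) :: ennreal)" for z
    have sd: "depends_on (D \<union> C) s"
      unfolding s_def by (rule depends_on_mono[OF depends_on_restrict D(3)])
    have indm: "(\<lambda>z. indicator S (restrict z A) :: ennreal) \<in> borel_measurable (PiM U ref)"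
      if "S \<in> sets (borel_space (prod_space X A))" "A \<subseteq> U" "A \<subseteq> V" for S A U
      using that by (intro measurable_compose[OF measurable_restrict_subset[OF that(2)]]
          borel_measurable_indicator) (simp add: sets_prod)
    have sm: "s \<in> borel_measurable (PiM (D \<union> C) ref)"
      unfolding s_def using S D(3) sub by (intro indm)
    \<comment> \<open>The conditional probability of \<open>S\<close> as a function of the
      coordinates in \<open>C\<close>. Where the denominator is 0 or \<infinity> the quotient is
      0.\<close>
    define u where "u c = N s c / N (\<lambda>_. 1) c" for c
    have um: "u \<in> borel_measurable (PiM C ref)"
      unfolding u_def using Nm[OF sm] Nm[OF one] by (intro borel_measurable_divide_ennreal)
    have N_le: "N s c \<le> N (\<lambda>_. 1) c" for c
      unfolding N_def s_def by (intro nn_integral_mono mult_right_mono) (auto simp: indicator_def)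
    have u1: "u c \<le> 1" for c
      unfolding u_def using N_le[of c]
      by (cases "N (\<lambda>_. 1) c = 0"; cases "N (\<lambda>_. 1) c = \<infinity>")
        (auto simp: divide_le_posI_ennreal zero_less_iff_neq_zero)
    have uN: "hx * N s c = hx * (u c * N (\<lambda>_. 1) c)" if "hx * N (\<lambda>_. 1) c \<noteq> \<infinity>" for hx c
    proof (cases "N (\<lambda>_. 1) c = 0 \<or> N (\<lambda>_. 1) c = \<infinity>")
      case True
      then show ?thesis
      proof
        assume "N (\<lambda>_. 1) c = 0"
        then show ?thesis using N_le[of c] by simp
      next
        assume "N (\<lambda>_. 1) c = \<infinity>"
        then show ?thesis using that by (auto simp: ennreal_mult_eq_top_iff)
      qed
    next
      case False
      then show ?thesis unfolding u_def by (simp add: ennreal_divide_times ennreal_mult_divide_eq ennreal_times_divide mult.commute)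
    qed
    \<comment> \<open>Test functions on \<open>H\<close> include products of events over
      \<open>B\<close> and \<open>C\<close>, so this is the identity that
      \<open>cond_indep_eventsI\<close> asks for.\<close>
    have key: "(\<integral>\<^sup>+z. s z * \<psi> z \<partial>joint f) = (\<integral>\<^sup>+z. u (restrict z C) * \<psi> z \<partial>joint f)"
      if \<psi>: "depends_on H \<psi>" "\<psi> \<in> borel_measurable (PiM H ref)" for \<psi>
    proof -
      have ud: "depends_on (D \<union> C) (\<lambda>z. u (restrict z C))"
        by (rule depends_on_mono[OF depends_on_restrict]) auto
      have um': "(\<lambda>z. u (restrict z C)) \<in> borel_measurable (PiM (D \<union> C) ref)"
        by (rule measurable_compose[OF measurable_restrict_subset um]) auto
      have Nu: "N (\<lambda>z. u (restrict z C)) (restrict x C) = u (restrict x C) * N (\<lambda>_. 1) (restrict x C)"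
        if x: "x \<in> space (PiM H ref)" for x
      proof -
        have xC: "restrict x C \<in> space (PiM C ref)"
          using x measurable_space[OF measurable_restrict_subset[OF CH]] by blast
        have "(\<lambda>y. (restrict x C, y)) \<in> measurable (PiM D ref) (PiM C ref \<Otimes>\<^sub>M PiM D ref)"
          using xC by measurable
        from measurable_compose[OF measurable_compose[OF this mm] gm]
        have "(\<lambda>y. g (merge D C (y, restrict x C))) \<in> borel_measurable (PiM D ref)" by simp
        moreover have "restrict (merge D C (y, restrict x C)) C = restrict x C" for y
          using D(2) by (auto simp: merge_def fun_eq_iff)
        ultimately show ?thesis unfolding N_def by (simp add: nn_integral_cmult)
      qed
      have "(\<integral>\<^sup>+z. s z * \<psi> z \<partial>joint f) = (\<integral>\<^sup>+x. \<psi> x * h x * N s (restrict x C) \<partial>PiM H ref)"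
        by (rule fold[OF sd sm \<psi>])
      also have "\<dots> = (\<integral>\<^sup>+x. \<psi> x * h x * N (\<lambda>z. u (restrict z C)) (restrict x C) \<partial>PiM H ref)"
      proof (rule nn_integral_cong_AE)
        show "AE x in PiM H ref. \<psi> x * h x * N s (restrict x C)
            = \<psi> x * h x * N (\<lambda>z. u (restrict z C)) (restrict x C)"
          using fin_ae AE_space
        proof eventually_elim
          case (elim x)
          then show ?case using uN[of "h x" "restrict x C"] Nu[of x] by (simp add: mult.assoc)
        qed
      qed
      also have "\<dots> = (\<integral>\<^sup>+z. u (restrict z C) * \<psi> z \<partial>joint f)"
        by (rule fold[OF ud um' \<psi>, symmetric])
      finally show ?thesis .
    qed
    define r where "r z = enn2real (u (restrict z C))" for z
    have r1: "0 \<le> r z" "r z \<le> 1" for z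
      using u1[of "restrict z C"] by (auto simp: r_def enn2real_leI)
    have ru: "ennreal (r z) = u (restrict z C)" for z
      using u1[of "restrict z C"] unfolding r_def
      by (intro ennreal_enn2real) (metis ennreal_one_less_top le_less_trans)
    let ?F = "sigma_coord X (joint f) C"
    have subalg: "subalgebra (joint f) ?F"
      using sets_joint sub by (intro subalgebra_sigma_coord)
    have "(\<lambda>z. restrict z C) \<in> measurable ?F (borel_space (prod_space X C))"
      unfolding sigma_coord_def
      by (rule measurable_vimage_algebra1) (use restrict_space[OF sub(3)] space_joint in \<open>auto simp: space_borel_space\<close>)
    moreover have "(\<lambda>c. enn2real (u c)) \<in> borel_measurable (borel_space (prod_space X C))"
      unfolding measurable_cong_sets[OF sets_prod[OF sub(3)] refl]
      by (rule measurable_compose[OF um]) simp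
    ultimately have rF: "r \<in> borel_measurable ?F" unfolding r_def by (rule measurable_compose)
    have rP: "r \<in> borel_measurable (joint f)" using rF subalg by (metis measurable_from_subalg)
    show "cond_indep_events (joint f) ?F (cyl A S) (cyl B T)"
    proof (rule P.cond_indep_eventsI[OF subalg _ _ rF r1])
      show cS: "cyl A S \<in> P.events" "cyl B T \<in> P.events"
        using S T sub by (simp_all add: sets_joint cyl_sets)
      fix U G assume U: "U \<in> {cyl B T, space (joint f)}" and G: "G \<in> sets ?F"
      obtain G' where G': "G' \<in> sets (borel_space (prod_space X C))" "G = cyl C G'"
        using G space_joint restrict_space[OF sub(3)] unfolding sigma_coord_def
        by (subst (asm) sets_vimage_algebra2) (auto simp: space_borel_space cyl_def)
      \<comment> \<open>The whole space is a cylinder over \<open>B\<close> too, so one computation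
        serves both choices of \<open>U\<close>.\<close>
      obtain T' where T': "T' \<in> sets (borel_space (prod_space X B))" "U = cyl B T'"
      proof (cases "U = cyl B T")
        case False
        have "space (joint f) = cyl B (space (borel_space (prod_space X B)))"
          using restrict_space[OF sub(2)] by (auto simp: cyl_def space_joint space_borel_space)
        then show ?thesis using False U that by auto
      qed (use T that in auto)
      define \<psi> where "\<psi> z = (indicator T' (restrict z B) * indicator G' (restrict z C) :: ennreal)" for z
      have \<psi>d: "depends_on H \<psi>" unfolding \<psi>_def
        by (intro depends_on_mult depends_on_mono[OF depends_on_restrict] CH BH)
      have \<psi>m: "\<psi> \<in> borel_measurable (PiM H ref)" unfolding \<psi>_def
        by (intro borel_measurable_times_ennreal indm T' G' CH BH sub)
      have UG: "U \<inter> G \<in> P.events" "cyl A S \<inter> (U \<inter> G) \<in> P.events"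
        unfolding T'(2) G'(2) sets_joint by (intro sets.Int cyl_sets S T'(1) G'(1) sub)+
      have \<psi>_eq: "\<psi> z = indicator (U \<inter> G) z" "s z = indicator (cyl A S) z" if "z \<in> space (joint f)" for z
        using that by (auto simp: \<psi>_def s_def T' G' cyl_def space_joint indicator_def)
      have "emeasure (joint f) (cyl A S \<inter> (U \<inter> G)) = (\<integral>\<^sup>+z. s z * \<psi> z \<partial>joint f)"
        unfolding nn_integral_indicator[OF UG(2), symmetric]
        by (intro nn_integral_cong) (simp add: \<psi>_eq indicator_inter_arith)
      also have "\<dots> = (\<integral>\<^sup>+z. u (restrict z C) * \<psi> z \<partial>joint f)" by (rule key[OF \<psi>d \<psi>m])
      also have "\<dots> = (\<integral>\<^sup>+z. ennreal (r z * indicator (U \<inter> G) z) \<partial>joint f)"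
        using r1 by (intro nn_integral_cong) (simp add: \<psi>_eq ru[symmetric] ennreal_mult'' ennreal_indicator)
      also have "\<dots> = ennreal (\<integral>z. r z * indicator (U \<inter> G) z \<partial>joint f)"
      proof (rule nn_integral_eq_integral)
        show "integrable (joint f) (\<lambda>z. r z * indicator (U \<inter> G) z)"
        proof (rule P.integrable_const_bound[of _ 1])
          show "AE z in joint f. norm (r z * indicator (U \<inter> G) z) \<le> 1"
            using r1 by (auto simp: indicator_def)
        qed (intro borel_measurable_times rP borel_measurable_indicator UG)
      qed (use r1 in auto)
      finally show "P.prob (cyl A S \<inter> (U \<inter> G)) = (\<integral>z. r z * indicator (U \<inter> G) z \<partial>joint f)"
        using r1 by (simp add: P.emeasure_eq_measure Bochner_Integration.integral_nonneg)
    qed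
  qed
qed

lemma joint_markov: "joint f \<in> markov_dists V E X"
  using joint_borel_probs d_separated_cond_indep by (auto simp: markov_dists_def)

end

section \<open>Densities of Bayesian networks\<close>

context bayes_space
begin

lemma space_prod_nonempty: "W \<subseteq> V \<Longrightarrow> space (PiM W ref) \<noteq> {}"
  using nonempty by (auto simp: space_prod_PiE PiE_eq_empty_iff)

text \<open>The head of the list has no arrow into the tail, while all its parents are in the tail.
  Its kernel therefore reads only coordinates already sampled, and no earlier factor changes when
  its value is added: the step multiplies the density by one factor.\<close>

lemma kernel_product_density:
  assumes k: "\<And>v. v \<in> V \<Longrightarrow> k v \<in> measurable (borel_space (prod_space X (pa E v)))
      (prob_algebra (borel_space (X v)))"
    and cpd: "\<And>v. v \<in> V \<Longrightarrow> cpd v (f v)"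
    and kf: "\<And>v x. v \<in> V \<Longrightarrow> x \<in> mspace (prod_space X (pa E v)) \<Longrightarrow>
      k v x = density (ref v) (\<lambda>y. f v (x(v := y)))"
  shows "distinct vs \<Longrightarrow> parent_closed (set vs) \<Longrightarrow> sorted_wrt (\<lambda>v w. (v, w) \<notin> E) vs \<Longrightarrow>
    kernel_product E X k vs = density (PiM (set vs) ref) (\<lambda>z. \<Prod>v\<in>set vs. f v z)"
proof (induction vs)
  case Nil
  have eq: "sets (borel_space (prod_space X {})) = sets (PiM {} ref)" by (rule sets_prod) simp
  \<comment> \<open>The empty product measure is the point mass at the assignment that is
    \<open>undefined\<close> everywhere.\<close>
  have "return (borel_space (prod_space X {})) (\<lambda>_. undefined) = density (PiM {} ref) (\<lambda>_. 1)"
  proof (rule measure_eqI)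
    fix S assume "S \<in> sets (return (borel_space (prod_space X {})) (\<lambda>_. undefined :: 'a))"
    then have S: "S \<in> sets (PiM {} ref)" using eq by simp
    have "emeasure (PiM {} ref) S = (\<integral>\<^sup>+x. indicator S x \<partial>PiM {} ref)" using S by simp
    also have "\<dots> = indicator S (\<lambda>_. undefined)" by (rule nn_integral_empty) simp
    finally show "emeasure (return (borel_space (prod_space X {})) (\<lambda>_. undefined)) S
        = emeasure (density (PiM {} ref) (\<lambda>_. 1)) S"
      using S eq by (simp add: density_1)
  qed (simp add: eq)
  then show ?case by simp
next
  case (Cons v vs)
  let ?W = "set vs" and ?U = "set (v # vs)"
  have vV: "v \<in> V" "?W \<subseteq> V" "v \<notin> ?W" "?U \<subseteq> V" "insert v ?W \<subseteq> V"
    using Cons.prems by (auto simp: parent_closed_def)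
  have pav: "pa E v \<subseteq> ?W"
    using Cons.prems(2) not_in_pa[of v] by (auto simp: parent_closed_def)
  have W: "parent_closed ?W" unfolding parent_closed_def
  proof (intro conjI ballI vV(2) subsetI)
    fix w u assume w: "w \<in> ?W" and u: "u \<in> pa E w"
    have "u \<in> insert v ?W" using Cons.prems(2) w u by (auto simp: parent_closed_def)
    moreover have "u \<noteq> v" using Cons.prems(3) w u by (auto simp: pa_def)
    ultimately show "u \<in> ?W" by simp
  qed
  have pV: "pa E v \<subseteq> V" by (rule pa_subset)
  have IH: "kernel_product E X k vs = density (PiM ?W ref) (\<lambda>z. \<Prod>v\<in>?W. f v z)"
    using Cons W by auto
  let ?N = "density (PiM ?W ref) (\<lambda>z. \<Prod>v\<in>?W. f v z)"
  let ?B = "borel_space (prod_space X (insert v ?W))"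
  let ?\<kappa> = "\<lambda>x. distr (k v (restrict x (pa E v))) ?B (\<lambda>y. x(v := y))"
  have jW: "(\<lambda>z. \<Prod>v\<in>?W. f v z) \<in> borel_measurable (PiM ?W ref)"
    using family_subset[OF W] vV cpd by (auto intro!: joint_measurable)
  have jU: "(\<lambda>z. \<Prod>v\<in>?U. f v z) \<in> borel_measurable (PiM ?U ref)"
    by (rule joint_measurable[OF cpd family_subset[OF Cons.prems(2)]]) (use vV(4) in blast)+
  have B: "sets ?B = sets (PiM ?U ref)" using sets_prod[OF vV(5)] by simp
  have rp: "(\<lambda>x. restrict x (pa E v)) \<in> measurable (PiM ?W ref) (borel_space (prod_space X (pa E v)))"
    unfolding measurable_cong_sets[OF refl sets_prod[OF pV]]
    by (rule measurable_restrict_subset[OF pav])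
  have upd: "(\<lambda>(x, y). x(v := y)) \<in> measurable (PiM ?W ref \<Otimes>\<^sub>M borel_space (X v)) ?B"
  proof -
    have "measurable (PiM ?W ref \<Otimes>\<^sub>M borel_space (X v)) ?B
        = measurable (PiM ?W ref \<Otimes>\<^sub>M ref v) (PiM (insert v ?W) ref)"
      using B vV by (intro measurable_cong_sets sets_pair_measure_cong) (auto simp: sets_ref)
    then show ?thesis using measurable_add_dim by simp
  qed
  have \<kappa>: "?\<kappa> \<in> measurable ?N (subprob_algebra ?B)"
  proof -
    have "?\<kappa> \<in> measurable (PiM ?W ref) (subprob_algebra ?B)"
      by (rule measurable_distr2[OF upd])
        (rule measurable_compose[OF rp measurable_prob_algebraD[OF k[OF vV(1)]]])
    then show ?thesis by simp
  qed
  have \<kappa>_em: "emeasure (?\<kappa> x) S = (\<integral>\<^sup>+y. f v (x(v := y)) * indicator S (x(v := y)) \<partial>ref v)"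
    if S: "S \<in> sets ?B" and x: "x \<in> space (PiM ?W ref)" for S x
  proof -
    have xp: "restrict x (pa E v) \<in> mspace (prod_space X (pa E v))"
      using measurable_space[OF rp x] by (simp add: space_borel_space)
    have kd: "k v (restrict x (pa E v)) = density (ref v) (\<lambda>y. f v ((restrict x (pa E v))(v := y)))"
      by (rule kf[OF vV(1) xp])
    have fr: "f v ((restrict x (pa E v))(v := y)) = f v (x(v := y))" for y
      by (rule depends_onD[OF cpd_depends_on[OF cpd[OF vV(1)]]]) (auto simp: family_def)
    have um: "(\<lambda>y. x(v := y)) \<in> measurable (ref v) (PiM (insert v ?W) ref)"
      using x vV by (intro measurable_component_update) auto
    have "family v \<subseteq> insert v ?W" using pav by (auto simp: family_def)
    then have fm: "(\<lambda>y. f v (x(v := y))) \<in> borel_measurable (ref v)"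
      by (intro measurable_compose[OF um] cpd_measurable[OF cpd[OF vV(1)]])
    have um': "(\<lambda>y. x(v := y)) \<in> measurable (k v (restrict x (pa E v))) ?B"
      unfolding kd using um by (simp add: measurable_cong_sets[OF refl sets_prod[OF vV(5)]])
    have Sm: "(\<lambda>y. indicator S (x(v := y)) :: ennreal) \<in> borel_measurable (ref v)"
      using S B by (intro measurable_compose[OF um] borel_measurable_indicator) simp
    have "emeasure (?\<kappa> x) S = (\<integral>\<^sup>+y. indicator S y \<partial>?\<kappa> x)" using S by simp
    also have "\<dots> = (\<integral>\<^sup>+y. indicator S (x(v := y)) \<partial>k v (restrict x (pa E v)))"
      using S by (intro nn_integral_distr um') simp
    also have "\<dots> = (\<integral>\<^sup>+y. f v (x(v := y)) * indicator S (x(v := y)) \<partial>ref v)"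
      unfolding kd fr by (rule nn_integral_density[OF fm Sm])
    finally show ?thesis .
  qed
  have ne: "space ?N \<noteq> {}" using space_prod_nonempty[OF vV(2)] by simp
  have "?N \<bind> ?\<kappa> = density (PiM ?U ref) (\<lambda>z. \<Prod>v\<in>?U. f v z)"
  proof (rule measure_eqI)
    have sb: "sets (?N \<bind> ?\<kappa>) = sets ?B" using ne by (intro sets_bind) auto
    then show "sets (?N \<bind> ?\<kappa>) = sets (density (PiM ?U ref) (\<lambda>z. \<Prod>v\<in>?U. f v z))"
      using B by simp
    fix S assume "S \<in> sets (?N \<bind> ?\<kappa>)"
    then have S: "S \<in> sets ?B" using sb by simp
    have SU: "S \<in> sets (PiM (insert v ?W) ref)" using S B by simp
    have \<kappa>m: "(\<lambda>x. emeasure (?\<kappa> x) S) \<in> borel_measurable (PiM ?W ref)"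
      using measurable_emeasure_kernel[OF \<kappa> S] by simp
    have "emeasure (?N \<bind> ?\<kappa>) S = (\<integral>\<^sup>+x. emeasure (?\<kappa> x) S \<partial>?N)"
      by (rule emeasure_bind[OF ne \<kappa> S])
    also have "\<dots> = (\<integral>\<^sup>+x. (\<Prod>v\<in>?W. f v x) * emeasure (?\<kappa> x) S \<partial>PiM ?W ref)"
      by (rule nn_integral_density[OF jW \<kappa>m])
    also have "\<dots> = (\<integral>\<^sup>+x. \<integral>\<^sup>+y. (\<Prod>w\<in>?U. f w (x(v := y))) * indicator S (x(v := y)) \<partial>ref v \<partial>PiM ?W ref)"
    proof (rule nn_integral_cong)
      fix x assume x: "x \<in> space (PiM ?W ref)"
      have um: "(\<lambda>y. x(v := y)) \<in> measurable (ref v) (PiM (insert v ?W) ref)"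
        using x vV by (intro measurable_component_update) auto
      have "family v \<subseteq> insert v ?W" using pav by (auto simp: family_def)
      then have fm: "(\<lambda>y. f v (x(v := y))) \<in> borel_measurable (ref v)"
        by (intro measurable_compose[OF um] cpd_measurable[OF cpd[OF vV(1)]])
      have Sm: "(\<lambda>y. indicator S (x(v := y)) :: ennreal) \<in> borel_measurable (ref v)"
        using SU by (intro measurable_compose[OF um] borel_measurable_indicator)
      have eq: "(\<Prod>w\<in>?U. f w (x(v := y))) = (\<Prod>w\<in>?W. f w x) * f v (x(v := y))" for y
      proof -
        have "f w (x(v := y)) = f w x" if "w \<in> ?W" for w
          by (rule depends_onD[OF cpd_depends_on[OF cpd]])
            (use that vV Cons.prems(3) in \<open>auto simp: family_def pa_def\<close>)
        then show ?thesis using vV by (simp add: mult.commute)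
      qed
      show "(\<Prod>v\<in>?W. f v x) * emeasure (?\<kappa> x) S
        = (\<integral>\<^sup>+y. (\<Prod>w\<in>?U. f w (x(v := y))) * indicator S (x(v := y)) \<partial>ref v)"
        unfolding \<kappa>_em[OF S x] eq mult.assoc
        by (rule nn_integral_cmult[symmetric]) (intro borel_measurable_times_ennreal fm Sm)
    qed
    also have "\<dots> = (\<integral>\<^sup>+z. (\<Prod>w\<in>?U. f w z) * indicator S z \<partial>PiM (insert v ?W) ref)"
      using vV jU SU by (intro product_nn_integral_insert[symmetric]) auto
    also have "\<dots> = emeasure (density (PiM ?U ref) (\<lambda>z. \<Prod>v\<in>?U. f v z)) S"
      using jU SU by (subst emeasure_density) auto
    finally show "emeasure (?N \<bind> ?\<kappa>) S = emeasure (density (PiM ?U ref) (\<lambda>z. \<Prod>v\<in>?U. f v z)) S" .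
  qed
  then show ?case by (simp add: IH)
qed

text \<open>Every admissible order yields the same product of factors, so nothing has to be known
  about the order that the choice operator picks.\<close>

lemma BN_dist_joint:
  assumes k: "k \<in> BN V E X"
    and cpd: "\<And>v. v \<in> V \<Longrightarrow> cpd v (f v)"
    and kf: "\<And>v x. v \<in> V \<Longrightarrow> x \<in> mspace (prod_space X (pa E v)) \<Longrightarrow>
      k v x = density (ref v) (\<lambda>y. f v (x(v := y)))"
  shows "BN_dist V E X k = joint f"
proof -
  define vs where "vs = (SOME vs. rev_topological_order V E vs)"
  have "rev_topological_order V E vs"
    unfolding vs_def using rev_topological_order_exists[OF dag] by (rule someI_ex)
  then have vs: "distinct vs" "set vs = V" "sorted_wrt (\<lambda>v w. (v, w) \<notin> E) vs"
    by (auto simp: rev_topological_order_def)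
  have kv: "k v \<in> measurable (borel_space (prod_space X (pa E v))) (prob_algebra (borel_space (X v)))"
    if "v \<in> V" for v
    using k that by (auto simp: BN_def)
  have "kernel_product E X k vs = density (PiM (set vs) ref) (\<lambda>z. \<Prod>v\<in>set vs. f v z)"
    using vs parent_closed_V by (intro kernel_product_density[OF kv cpd kf]) auto
  then show ?thesis by (simp add: BN_dist_def vs_def[symmetric] joint_def vs(2))
qed

section \<open>Bounded equicontinuous conditional densities\<close>

definition fam_density :: "'v \<Rightarrow> ('a \<times> ('v \<Rightarrow> 'a) \<Rightarrow> real) \<Rightarrow> ('v \<Rightarrow> 'a) \<Rightarrow> real" where
  "fam_density v p z = p (z v, restrict z (pa E v))"

lemma depends_on_fam_density: "depends_on (family v) (fam_density v p)"
  unfolding depends_on_def fam_density_def family_def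
  by (metis (no_types, lifting) insert_iff restrict_ext)

lemma fam_density_upd:
  assumes "x \<in> mspace (prod_space X (pa E v))"
  shows "fam_density v p (x(v := y)) = p (y, x)"
proof -
  have "x \<in> extensional (pa E v)"
    using assms by (simp add: mspace_prod_space finite_pa PiE_def)
  then have "restrict (x(v := y)) (pa E v) = x"
    using not_in_pa[of v] by (auto simp: fun_eq_iff restrict_def extensional_def)
  then show ?thesis by (simp add: fam_density_def)
qed

lemma family_point:
  assumes "family v \<subseteq> W" "W \<subseteq> V" "z \<in> mspace (prod_space X W)"
  shows "(z v, restrict z (pa E v)) \<in> mspace (prod_metric (X v) (prod_space X (pa E v)))"
  using assms by (auto simp: mspace_prod_space finite_subset_V finite_pa family_def)

text \<open>As \<open>v\<close> is not its own parent, the squared distance of the pairs is the sum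
  of squares over the family, a partial sum of that over \<open>W\<close>.\<close>

lemma family_mdist_le:
  assumes "family v \<subseteq> W" "W \<subseteq> V"
  shows "mdist (prod_metric (X v) (prod_space X (pa E v)))
      (x v, restrict x (pa E v)) (y v, restrict y (pa E v)) \<le> mdist (prod_space X W) x y"
proof -
  have "(mdist (prod_space X (pa E v)) (restrict x (pa E v)) (restrict y (pa E v)))\<^sup>2
      = (\<Sum>u\<in>pa E v. (mdist (X u) (x u) (y u))\<^sup>2)"
    by (simp add: mdist_prod_space finite_pa sum_nonneg)
  then have "(mdist (X v) (x v) (y v))\<^sup>2
      + (mdist (prod_space X (pa E v)) (restrict x (pa E v)) (restrict y (pa E v)))\<^sup>2
      = (\<Sum>u\<in>family v. (mdist (X u) (x u) (y u))\<^sup>2)"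
    by (simp add: family_def finite_pa not_in_pa)
  also have "\<dots> \<le> (\<Sum>u\<in>W. (mdist (X u) (x u) (y u))\<^sup>2)"
    using assms by (intro sum_mono2 finite_subset_V) auto
  finally show ?thesis
    using assms by (simp add: prod_dist_def mdist_prod_space finite_subset_V)
qed

definition eqb_density :: "real \<Rightarrow> (real \<Rightarrow> real) \<Rightarrow> 'v \<Rightarrow> ('a \<times> ('v \<Rightarrow> 'a) \<Rightarrow> real) \<Rightarrow> bool" where
  "eqb_density K \<omega> v p \<longleftrightarrow>
     (\<forall>z \<in> mspace (prod_metric (X v) (prod_space X (pa E v))). 0 \<le> p z \<and> p z \<le> K) \<and>
     admits_modulus (prod_metric (X v) (prod_space X (pa E v))) \<omega> p"

lemma modulus_small:
  assumes "modulus_of_continuity \<omega>" "e > 0"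
  obtains d where "d > 0" "\<And>t. 0 \<le> t \<Longrightarrow> t < d \<Longrightarrow> \<omega> t < e"
proof -
  have "eventually (\<lambda>t. \<omega> t < e) (at_right 0)"
    using assms by (intro order_tendstoD[of \<omega> 0]) (auto simp: modulus_of_continuity_def)
  then obtain d where d: "d > 0" "\<And>t. 0 < t \<Longrightarrow> t < d \<Longrightarrow> \<omega> t < e"
    by (auto simp: eventually_at_right_field)
  moreover have "\<omega> 0 < e" using assms by (simp add: modulus_of_continuity_def)
  ultimately show thesis using that[of d] by (metis order_le_less)
qed

lemma fam_density_bounds:
  assumes "eqb_density K \<omega> v p" "family v \<subseteq> W" "W \<subseteq> V" "z \<in> mspace (prod_space X W)"
  shows "0 \<le> fam_density v p z" "fam_density v p z \<le> K"
  using assms(1) family_point[OF assms(2-4)] unfolding eqb_density_def fam_density_def by blast+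

text \<open>\<open>d\<close> is obtained from \<omega> alone, before the density, the vertex and the
  index set are chosen; this uniformity is what the weak topology argument needs.\<close>

lemma fam_density_equicontinuous:
  assumes "modulus_of_continuity \<omega>" "e > 0"
  shows "\<exists>d>0. \<forall>K v p W x y. eqb_density K \<omega> v p \<and> family v \<subseteq> W \<and> W \<subseteq> V \<and>
     x \<in> mspace (prod_space X W) \<and> y \<in> mspace (prod_space X W) \<and>
     mdist (prod_space X W) x y < d \<longrightarrow> \<bar>fam_density v p x - fam_density v p y\<bar> < e"
proof -
  obtain d where d: "d > 0" "\<And>t. 0 \<le> t \<Longrightarrow> t < d \<Longrightarrow> \<omega> t < e"
    using modulus_small[OF assms] by blast
  show ?thesis
  proof (intro exI[of _ d] conjI allI impI d(1); elim conjE)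
    fix K v p W x y
    assume p: "eqb_density K \<omega> v p" and W: "family v \<subseteq> W" "W \<subseteq> V"
      and xy: "x \<in> mspace (prod_space X W)" "y \<in> mspace (prod_space X W)"
      and lt: "mdist (prod_space X W) x y < d"
    let ?m = "prod_metric (X v) (prod_space X (pa E v))"
    let ?x = "(x v, restrict x (pa E v))" and ?y = "(y v, restrict y (pa E v))"
    have "\<bar>p ?x - p ?y\<bar> \<le> \<omega> (mdist ?m ?x ?y)"
      using p family_point[OF W xy(1)] family_point[OF W xy(2)]
      unfolding eqb_density_def admits_modulus_def by blast
    also have "\<dots> < e"
      using family_mdist_le[OF W, of x y] lt by (intro d(2) mdist_nonneg) linarith
    finally show "\<bar>fam_density v p x - fam_density v p y\<bar> < e" by (simp add: fam_density_def)
  qed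
qed

lemma fam_density_measurable:
  assumes \<omega>: "modulus_of_continuity \<omega>" and p: "eqb_density K \<omega> v p" and W: "family v \<subseteq> W" "W \<subseteq> V"
  shows "fam_density v p \<in> borel_measurable (PiM W ref)"
proof -
  have "fam_density v p \<in> borel_measurable (borel_space (prod_space X W))"
  proof (rule borel_measurable_borel_spaceI)
    fix x and e :: real assume x: "x \<in> mspace (prod_space X W)" and e: "e > 0"
    show "\<exists>d>0. \<forall>y\<in>mspace (prod_space X W). mdist (prod_space X W) x y < d \<longrightarrow>
        \<bar>fam_density v p x - fam_density v p y\<bar> < e"
      using fam_density_equicontinuous[OF \<omega> e] p W x by meson
  qed
  then show ?thesis by (simp add: measurable_cong_sets[OF sets_prod[OF W(2)] refl])
qed

lemma density_section_measurable:
  assumes \<omega>: "modulus_of_continuity \<omega>" and p: "eqb_density K \<omega> v p" and v: "v \<in> V"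
    and x: "x \<in> mspace (prod_space X (pa E v))"
  shows "(\<lambda>y. p (y, x)) \<in> borel_measurable (ref v)"
proof -
  have "family v \<subseteq> V" using v pa_subset by (auto simp: family_def)
  then have m: "fam_density v p \<in> borel_measurable (PiM (insert v (pa E v)) ref)"
    by (intro fam_density_measurable[OF \<omega> p]) (auto simp: family_def)
  have "x \<in> space (PiM (pa E v) ref)" using x by (simp add: space_prod pa_subset)
  then have "(\<lambda>y. fam_density v p (x(v := y))) \<in> borel_measurable (ref v)"
    by (intro measurable_compose[OF measurable_component_update m]) (auto simp: not_in_pa)
  then show ?thesis by (simp add: fam_density_upd[OF x])
qed

lemma cpd_fam_density:
  assumes \<omega>: "modulus_of_continuity \<omega>" and p: "eqb_density K \<omega> v p" and v: "v \<in> V"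
    and one: "\<And>x. x \<in> mspace (prod_space X (pa E v)) \<Longrightarrow> (\<integral>\<^sup>+y. ennreal (p (y, x)) \<partial>ref v) = 1"
  shows "cpd v (\<lambda>z. ennreal (fam_density v p z))"
  unfolding cpd_def
proof (intro conjI ballI)
  show "depends_on (family v) (\<lambda>z. ennreal (fam_density v p z))"
    using depends_on_fam_density[of v p] unfolding depends_on_def by metis
  have "family v \<subseteq> V" using v pa_subset by (auto simp: family_def)
  then show "(\<lambda>z. ennreal (fam_density v p z)) \<in> borel_measurable (PiM (family v) ref)"
    using fam_density_measurable[OF \<omega> p] by (intro measurable_compose[OF _ measurable_ennreal]) auto
  fix x assume "x \<in> space (PiM (pa E v) ref)"
  then have "x \<in> mspace (prod_space X (pa E v))" by (simp add: space_prod pa_subset)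
  then show "(\<integral>\<^sup>+y. ennreal (fam_density v p (x(v := y))) \<partial>ref v) = 1"
    using one by (simp add: fam_density_upd)
qed

definition eqb_family :: "real \<Rightarrow> (real \<Rightarrow> real) \<Rightarrow> ('v \<Rightarrow> 'a \<times> ('v \<Rightarrow> 'a) \<Rightarrow> real) \<Rightarrow> bool" where
  "eqb_family K \<omega> p \<longleftrightarrow> (\<forall>v\<in>V. eqb_density K \<omega> v (p v) \<and>
     (\<forall>x\<in>mspace (prod_space X (pa E v)). (\<integral>\<^sup>+y. ennreal (p v (y, x)) \<partial>ref v) = 1))"

abbreviation eqb_joint :: "('v \<Rightarrow> 'a \<times> ('v \<Rightarrow> 'a) \<Rightarrow> real) \<Rightarrow> ('v \<Rightarrow> 'a) measure" where
  "eqb_joint p \<equiv> joint (\<lambda>v z. ennreal (fam_density v (p v) z))"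

text \<open>The last conclusion keeps the link to the kernels, from which mixed kernels will inherit
  their measurability.\<close>

lemma BN_eqb_density:
  assumes \<omega>: "modulus_of_continuity \<omega>" and k: "k \<in> BN_eqb V E X K \<omega> \<mu>"
  obtains p where "eqb_family K \<omega> p" "BN_dist V E X k = eqb_joint p"
    "\<And>v x. v \<in> V \<Longrightarrow> x \<in> mspace (prod_space X (pa E v)) \<Longrightarrow>
      k v x = density (ref v) (\<lambda>y. ennreal (p v (y, x)))"
proof -
  have "\<forall>v\<in>V. \<exists>p. eqb_density K \<omega> v p \<and>
      (\<forall>x \<in> mspace (prod_space X (pa E v)). k v x = density (ref v) (\<lambda>y. ennreal (p (y, x))))"
    using k by (simp add: BN_eqb_def eqb_density_def ref_def)
  then obtain p where p: "\<And>v. v \<in> V \<Longrightarrow> eqb_density K \<omega> v (p v)"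
    "\<And>v x. v \<in> V \<Longrightarrow> x \<in> mspace (prod_space X (pa E v)) \<Longrightarrow>
      k v x = density (ref v) (\<lambda>y. ennreal (p v (y, x)))"
    by metis
  have kBN: "k \<in> BN V E X" using k by (simp add: BN_eqb_def)
  have one: "(\<integral>\<^sup>+y. ennreal (p v (y, x)) \<partial>ref v) = 1"
    if v: "v \<in> V" and x: "x \<in> mspace (prod_space X (pa E v))" for v x
  proof -
    have "k v \<in> measurable (borel_space (prod_space X (pa E v))) (prob_algebra (borel_space (X v)))"
      using kBN v by (auto simp: BN_def)
    from measurable_space[OF this, of x] have "prob_space (k v x)"
      using x by (simp add: space_borel_space space_prob_algebra)
    then have "emeasure (k v x) (space (k v x)) = 1" by (rule prob_space.emeasure_space_1)
    then show ?thesis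
      using density_section_measurable[OF \<omega> p(1)[OF v] v x] unfolding p(2)[OF v x]
      by (subst (asm) emeasure_density) (auto cong: nn_integral_cong)
  qed
  have fam: "eqb_family K \<omega> p" unfolding eqb_family_def using p(1) one by blast
  have "BN_dist V E X k = eqb_joint p"
    by (rule BN_dist_joint[OF kBN])
      (use p one in \<open>auto simp: fam_density_upd intro!: cpd_fam_density[OF \<omega>]\<close>)
  then show thesis using that fam p(2) by blast
qed

lemma eqb_family_joint_cpds:
  assumes "modulus_of_continuity \<omega>" "eqb_family K \<omega> p"
  shows "joint_cpds V E X \<mu> (\<lambda>v z. ennreal (fam_density v (p v) z))"
  using assms by unfold_locales (auto simp: eqb_family_def intro!: cpd_fam_density)

end

section \<open>Weak and total variation neighbourhoods\<close>

lemma borel_measurable_continuous_map: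
  fixes g :: "'a \<Rightarrow> real"
  assumes "continuous_map (mtopology_of m) euclideanreal g"
  shows "g \<in> borel_measurable (borel_space m)"
proof (rule borel_measurableI)
  fix S :: "real set" assume "open S"
  then have "openin (mtopology_of m) {x \<in> topspace (mtopology_of m). g x \<in> S}"
    by (intro openin_continuous_map_preimage[OF assms]) simp
  moreover have "{x \<in> topspace (mtopology_of m). g x \<in> S} = g -` S \<inter> space (borel_space m)"
    by (auto simp: space_borel_space)
  ultimately show "g -` S \<inter> space (borel_space m) \<in> sets (borel_space m)"
    by (metis borel_openin)
qed

lemma openin_tv_iff:
  "openin (mtopology_of (tv_metric m)) U \<longleftrightarrow> U \<subseteq> borel_probs m \<and>
     (\<forall>P\<in>U. \<exists>r>0. \<forall>Q\<in>borel_probs m. tv_dist m P Q < r \<longrightarrow> Q \<in> U)"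
  by (simp add: openin_mtopology_of_iff mspace_tv_metric mdist_tv_metric)

text \<open>A test function bounded by \<open>B\<close> is rescaled to [0,1], where
  \<open>tv_dist_integral\<close> applies. Integrals of the original thus move by at most
  \<open>2 * B\<close> times the total variation distance.\<close>

lemma weak_topology_coarser_tv:
  assumes "openin (weak_topology m) U"
  shows "openin (mtopology_of (tv_metric m)) U"
proof -
  have gen: "openin (mtopology_of (tv_metric m)) {P \<in> borel_probs m. (\<integral>x. g x \<partial>P) \<in> S}"
    if g: "continuous_map (mtopology_of m) euclideanreal g" "bounded (g ` mspace m)" and S: "open S"
    for g S
    unfolding openin_tv_iff
  proof (intro conjI ballI)
    fix P assume "P \<in> {P \<in> borel_probs m. (\<integral>x. g x \<partial>P) \<in> S}"
    then have P: "P \<in> borel_probs m" "(\<integral>x. g x \<partial>P) \<in> S" by auto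
    obtain e where e: "e > 0" "\<And>t. \<bar>t - (\<integral>x. g x \<partial>P)\<bar> < e \<Longrightarrow> t \<in> S"
      using S P(2) unfolding open_dist dist_real_def by blast
    obtain B where B: "B > 0" "\<And>x. x \<in> mspace m \<Longrightarrow> \<bar>g x\<bar> \<le> B"
      using g(2) unfolding bounded_pos by auto
    have gm: "g \<in> borel_measurable (borel_space m)" by (rule borel_measurable_continuous_map[OF g(1)])
    have shift: "(\<integral>x. (g x + B) / (2 * B) \<partial>Q) = ((\<integral>x. g x \<partial>Q) + B) / (2 * B)"
      if Q: "Q \<in> borel_probs m" for Q
    proof -
      interpret Q: prob_space Q using Q by (rule prob_space_borel_probs)
      have "g \<in> borel_measurable Q"
        using gm by (simp add: measurable_cong_sets[OF sets_borel_probs[OF Q] refl])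
      then have "integrable Q g"
        by (intro Q.integrable_const_bound[of _ B]) (auto simp: space_borel_probs[OF Q] B)
      then show ?thesis using B Q.prob_space by simp
    qed
    show "\<exists>r>0. \<forall>Q\<in>borel_probs m. tv_dist m P Q < r \<longrightarrow> Q \<in> {P \<in> borel_probs m. (\<integral>x. g x \<partial>P) \<in> S}"
    proof (intro exI[of _ "e / (2 * B)"] conjI ballI impI)
      fix Q assume Q: "Q \<in> borel_probs m" and lt: "tv_dist m P Q < e / (2 * B)"
      have "\<bar>(\<integral>x. (g x + B) / (2 * B) \<partial>P) - (\<integral>x. (g x + B) / (2 * B) \<partial>Q)\<bar> \<le> tv_dist m P Q"
      proof (rule tv_dist_integral[OF P(1) Q])
        show "(\<lambda>x. (g x + B) / (2 * B)) \<in> borel_measurable (borel_space m)" using gm by measurable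
        fix x assume "x \<in> mspace m"
        from B(2)[OF this] have "-B \<le> g x" "g x \<le> B" by linarith+
        then show "0 \<le> (g x + B) / (2 * B) \<and> (g x + B) / (2 * B) \<le> 1"
          using B(1) by (simp add: field_simps)
      qed
      then have "\<bar>((\<integral>x. g x \<partial>P) - (\<integral>x. g x \<partial>Q)) / (2 * B)\<bar> < e / (2 * B)"
        using lt unfolding shift[OF P(1)] shift[OF Q] by (simp add: diff_divide_distrib[symmetric])
      then have "\<bar>(\<integral>x. g x \<partial>P) - (\<integral>x. g x \<partial>Q)\<bar> < e"
        using B(1) by (simp add: abs_divide divide_strict_right_mono_neg field_simps)
      then show "Q \<in> {P \<in> borel_probs m. (\<integral>x. g x \<partial>P) \<in> S}"
        using Q e(2) by (simp add: abs_minus_commute)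
    qed (use e B in auto)
  qed auto
  have "generate_topology_on {{P \<in> borel_probs m. (\<integral>x. f x \<partial>P) \<in> U} | f U.
        continuous_map (mtopology_of m) euclideanreal f \<and> bounded (f ` mspace m) \<and> open U} U"
    using assms by (simp add: weak_topology_def openin_topology_generated_by_iff)
  then show ?thesis
    by induction (use gen in \<open>auto intro: openin_Int openin_Union\<close>)
qed

text \<open>Continuity of the measure along increasing finite unions. Losing mass \<open>e\<close>
  is the price for a finite subcover without compactness.\<close>

lemma (in prob_space) finite_subcover_prob:
  assumes C: "countable C" and U: "\<And>x. x \<in> C \<Longrightarrow> U x \<in> events"
    and cov: "space M \<subseteq> (\<Union>x\<in>C. U x)" and e: "e > 0"
  obtains C0 where "finite C0" "C0 \<subseteq> C" "prob (\<Union>x\<in>C0. U x) > 1 - e"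
proof -
  have "C \<noteq> {}" using cov not_empty by auto
  then obtain c :: "nat \<Rightarrow> _" where c: "range c = C" using C by (metis uncountable_def)
  define A where "A n = (\<Union>i\<le>n. U (c i))" for n
  have A: "range A \<subseteq> events" using U c by (auto simp: A_def)
  have inc: "incseq A" unfolding incseq_def A_def by force
  have "(\<Union>n. A n) = (\<Union>x\<in>C. U x)" using c by (auto simp: A_def)
  moreover have "(\<Union>x\<in>C. U x) = space M"
    using cov U sets.sets_into_space by blast
  ultimately have "(\<lambda>n. prob (A n)) \<longlonglongrightarrow> 1"
    using finite_Lim_measure_incseq[OF A inc] prob_space by simp
  then have "eventually (\<lambda>n. prob (A n) > 1 - e) sequentially"
    using e by (intro order_tendstoD(1)) auto
  then obtain n where n: "prob (A n) > 1 - e" by (auto simp: eventually_sequentially)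
  have "A n = (\<Union>x\<in>c ` {..n}. U x)" by (auto simp: A_def)
  then show thesis using that[of "c ` {..n}"] n c by auto
qed

section \<open>From weak closeness to closeness in total variation\<close>

definition bump :: "'a metric \<Rightarrow> 'a \<Rightarrow> real \<Rightarrow> 'a \<Rightarrow> real" where
  "bump m x r y = max 0 (1 - mdist m x y / r)"

lemma bump_bounds: "r > 0 \<Longrightarrow> 0 \<le> bump m x r y" "r > 0 \<Longrightarrow> bump m x r y \<le> 1"
  by (auto simp: bump_def)

lemma bump_pos_iff: "r > 0 \<Longrightarrow> bump m x r y > 0 \<longleftrightarrow> mdist m x y < r"
  by (auto simp: bump_def less_max_iff_disj field_simps)

text \<open>Continuity admits these tents as weak test functions, which the indicators of the balls
  need not be; a tent is positive exactly on its ball.\<close>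

lemma continuous_map_bump:
  assumes "x \<in> mspace m"
  shows "continuous_map (mtopology_of m) euclideanreal (bump m x r)"
proof -
  have "continuous_map (mtopology_of m) euclideanreal (\<lambda>y. mdist m x y)"
    using assms by (intro continuous_map_mdist) auto
  then show ?thesis unfolding bump_def[abs_def] divide_inverse
    by (intro continuous_intros) (use assms in auto)
qed

definition eqb_class :: "'a metric \<Rightarrow> 'a measure \<Rightarrow> real \<Rightarrow> ('a \<Rightarrow> real) set \<Rightarrow> bool" where
  "eqb_class m \<nu> L FS \<longleftrightarrow>
     (\<forall>f\<in>FS. f \<in> borel_measurable (borel_space m) \<and> (\<forall>x\<in>mspace m. 0 \<le> f x \<and> f x \<le> L) \<and>
        prob_space (density \<nu> (\<lambda>x. ennreal (f x)))) \<and>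
     (\<forall>e>0. \<exists>d>0. \<forall>f\<in>FS. \<forall>x\<in>mspace m. \<forall>y\<in>mspace m. mdist m x y < d \<longrightarrow> \<bar>f x - f y\<bar> < e)"

text \<open>Testing against a bump function on a small ball determines, up to the oscillation of the
  density, its values on that ball; finitely many balls carry almost all of the mass. This is a
  converse to Scheffe's theorem in the absence of compactness.\<close>

lemma weak_neighbourhood_tv:
  assumes sep: "second_countable (mtopology_of m)" and lf: "locally_finite_measure m \<nu>"
    and FS: "eqb_class m \<nu> L FS" and f0: "f0 \<in> FS" and e: "e > 0"
  obtains U where "openin (weak_topology m) U" "density \<nu> (\<lambda>x. ennreal (f0 x)) \<in> U"
    "\<And>f. f \<in> FS \<Longrightarrow> density \<nu> (\<lambda>x. ennreal (f x)) \<in> U \<Longrightarrow>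
       tv_dist m (density \<nu> (\<lambda>x. ennreal (f0 x))) (density \<nu> (\<lambda>x. ennreal (f x))) < e"
proof -
  let ?P = "\<lambda>f. density \<nu> (\<lambda>x. ennreal (f x))"
  have s\<nu>: "sets \<nu> = sets (borel_space m)" using lf by (simp add: locally_finite_measure_def)
  have sp: "space \<nu> = mspace m" using sets_eq_imp_space_eq[OF s\<nu>] by (simp add: space_borel_space)
  have fm: "f \<in> borel_measurable \<nu>" and f_bd: "\<And>x. x \<in> mspace m \<Longrightarrow> 0 \<le> f x \<and> f x \<le> L"
    and fP: "prob_space (?P f)" and fB: "?P f \<in> borel_probs m" if "f \<in> FS" for f
    using FS that s\<nu> unfolding eqb_class_def borel_probs_iff
    by (auto simp: measurable_cong_sets[OF s\<nu> refl])
  obtain x0 where x0: "x0 \<in> mspace m"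
    using prob_space.not_empty[OF fP[OF f0]] by (auto simp: sp)
  have L0: "L \<ge> 0" using f_bd[OF f0 x0] by linarith
  interpret P0: prob_space "?P f0" by (rule fP[OF f0])
  have op_sets: "openin (mtopology_of m) S \<Longrightarrow> S \<in> sets \<nu>" for S
    using borel_openin s\<nu> by blast
  \<comment> \<open>The final bound is \<open>4 * \<eta>\<close>, namely \<eta> on the good set
    \<open>Y\<close> and at most \<open>3 * \<eta>\<close> off it; a fifth makes it strict.\<close>
  define \<eta> where "\<eta> = e / 5"
  have \<eta>: "\<eta> > 0" using e by (simp add: \<eta>_def)
  have "\<forall>x\<in>mspace m. \<exists>U. openin (mtopology_of m) U \<and> x \<in> U \<and> emeasure \<nu> U < \<infinity>"
    using lf by (simp add: locally_finite_measure_def)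
  then obtain N where N: "\<And>x. x \<in> mspace m \<Longrightarrow> openin (mtopology_of m) (N x) \<and> x \<in> N x"
    and Nfin: "\<And>x. x \<in> mspace m \<Longrightarrow> emeasure \<nu> (N x) < \<infinity>" by metis
  obtain C where C: "countable C" "C \<subseteq> mspace m" "(\<Union>x\<in>C. N x) = mspace m"
    using countable_subcover_mtopology_of[OF sep N] by blast
  obtain C0 where C0: "finite C0" "C0 \<subseteq> C" "P0.prob (\<Union>x\<in>C0. N x) > 1 - \<eta>"
  proof (rule P0.finite_subcover_prob[OF C(1), of N \<eta>])
    show "N x \<in> P0.events" if "x \<in> C" for x using N op_sets that C by auto
    show "space (?P f0) \<subseteq> (\<Union>x\<in>C. N x)" using C by (simp add: sp)
  qed (use \<eta> in auto)
  \<comment> \<open>\<nu> may be infinite. On \<open>W\<close> it is finite, so a uniformly small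
    difference of densities has a small integral there.\<close>
  define W where "W = (\<Union>x\<in>C0. N x)"
  have C0m: "x \<in> mspace m" if "x \<in> C0" for x using that C0 C by auto
  have Ws: "W \<in> sets \<nu>" unfolding W_def using C0 C0m N op_sets by (intro sets.finite_UN) auto
  have "emeasure \<nu> W \<le> (\<Sum>x\<in>C0. emeasure \<nu> (N x))"
    unfolding W_def using C0 C0m N op_sets by (intro emeasure_subadditive_finite) auto
  also have "\<dots> < \<infinity>" using Nfin C0m C0(1) by (simp add: less_top[symmetric])
  finally have Wfin: "emeasure \<nu> W < \<infinity>" .
  \<comment> \<open>On the good set densities will differ by at most \<open>5 * \<delta>\<close>,
    which integrates over \<open>W\<close> to at most \<eta>. The 1 keeps the denominator
    positive.\<close>
  define \<delta> where "\<delta> = \<eta> / (5 * (measure \<nu> W + 1))"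
  have \<delta>: "\<delta> > 0" using \<eta> by (simp add: \<delta>_def add_nonneg_pos)
  have "measure \<nu> W + 1 \<noteq> 0" using measure_nonneg[of \<nu> W] by linarith
  then have "5 * \<delta> * measure \<nu> W = \<eta> * (measure \<nu> W / (measure \<nu> W + 1))"
    unfolding \<delta>_def by (simp add: divide_simps)
  also have "\<dots> \<le> \<eta> * 1" using \<eta> by (intro mult_left_mono) (auto simp: add_nonneg_pos divide_le_eq)
  finally have \<delta>W: "5 * \<delta> * measure \<nu> W \<le> \<eta>" by simp
  obtain d where d: "d > 0" "\<And>f x y. f \<in> FS \<Longrightarrow> x \<in> mspace m \<Longrightarrow> y \<in> mspace m \<Longrightarrow>
      mdist m x y < d \<Longrightarrow> \<bar>f x - f y\<bar> < \<delta>"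
    using FS \<delta> unfolding eqb_class_def by meson
  \<comment> \<open>Radii below \<open>d\<close> make densities vary by less than \<delta> on a
    ball; balls inside \<open>N x\<close> have finite measure, so that the tents are
    integrable.\<close>
  have "\<exists>r>0. r \<le> d \<and> (\<forall>y\<in>mspace m. mdist m x y < r \<longrightarrow> y \<in> N x)" if xm: "x \<in> mspace m" for x
  proof -
    obtain r where "r > 0" "\<forall>y\<in>mspace m. mdist m x y < r \<longrightarrow> y \<in> N x"
      using N[OF xm] unfolding openin_mtopology_of_iff by blast
    then show ?thesis using d(1) by (intro exI[of _ "min r d"]) auto
  qed
  then obtain r where r: "\<And>x. x \<in> mspace m \<Longrightarrow> r x > 0" "\<And>x. x \<in> mspace m \<Longrightarrow> r x \<le> d"
    "\<And>x y. x \<in> mspace m \<Longrightarrow> y \<in> mspace m \<Longrightarrow> mdist m x y < r x \<Longrightarrow> y \<in> N x" by metis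
  define B where "B x = {y\<in>mspace m. mdist m x y < r x}" for x
  have Bop: "openin (mtopology_of m) (B x) \<and> x \<in> B x" if x: "x \<in> mspace m" for x
  proof -
    interpret Metric_space "mspace m" "mdist m" by (rule Metric_space_mspace_mdist)
    have "B x = mball x (r x)" using x by (auto simp: B_def)
    then show ?thesis using x r(1)[OF x] by (simp add: mtopology_of_def)
  qed
  have Bfin: "emeasure \<nu> (B x) < \<infinity>" if "x \<in> mspace m" for x
    using r(3)[OF that] N[OF that] Nfin[OF that] op_sets
    by (intro le_less_trans[OF emeasure_mono[of "B x" "N x"]]) (auto simp: B_def)
  obtain D where D: "countable D" "D \<subseteq> mspace m" "(\<Union>x\<in>D. B x) = mspace m"
    using countable_subcover_mtopology_of[OF sep Bop] by blast
  obtain D0 where D0: "finite D0" "D0 \<subseteq> D" "P0.prob (\<Union>x\<in>D0. B x) > 1 - \<eta>"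
  proof (rule P0.finite_subcover_prob[OF D(1), of B \<eta>])
    show "B x \<in> P0.events" if "x \<in> D" for x using Bop op_sets that D by auto
    show "space (?P f0) \<subseteq> (\<Union>x\<in>D. B x)" using D by (simp add: sp)
  qed (use \<eta> in auto)
  have D0m: "x \<in> mspace m" if "x \<in> D0" for x using that D0 D by auto
  define \<phi> where "\<phi> x = bump m x (r x)" for x
  have \<phi>c: "continuous_map (mtopology_of m) euclideanreal (\<phi> x)" if "x \<in> mspace m" for x
    unfolding \<phi>_def by (rule continuous_map_bump[OF that])
  have \<phi>m: "\<phi> x \<in> borel_measurable \<nu>" if "x \<in> mspace m" for x
    using borel_measurable_continuous_map[OF \<phi>c[OF that]] by (simp add: measurable_cong_sets[OF s\<nu> refl])
  have \<phi>01: "0 \<le> \<phi> x y" "\<phi> x y \<le> 1" if "x \<in> mspace m" for x y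
    unfolding \<phi>_def by (rule bump_bounds[OF r(1)[OF that]])+
  have \<phi>pos: "\<phi> x y > 0 \<longleftrightarrow> y \<in> B x" if "x \<in> mspace m" "y \<in> mspace m" for x y
    unfolding \<phi>_def using bump_pos_iff[OF r(1)[OF that(1)], of m x y] that by (auto simp: B_def)
  have \<phi>i: "integrable \<nu> (\<phi> x)" if x: "x \<in> mspace m" for x
  proof (rule Bochner_Integration.integrable_bound[of _ "indicator (B x) :: _ \<Rightarrow> real"])
    show "integrable \<nu> (indicator (B x) :: _ \<Rightarrow> real)"
      using Bfin[OF x] Bop[OF x] op_sets by (intro integrable_real_indicator) auto
    show "AE y in \<nu>. norm (\<phi> x y) \<le> norm (indicator (B x) y :: real)"
    proof (rule AE_I2)
      fix y assume "y \<in> space \<nu>"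
      then show "norm (\<phi> x y) \<le> norm (indicator (B x) y :: real)"
        using \<phi>01[OF x, of y] \<phi>pos[OF x, of y] by (cases "y \<in> B x") (auto simp: sp)
    qed
  qed (rule \<phi>m[OF x])
  define c where "c x = (\<integral>y. \<phi> x y \<partial>\<nu>)" for x
  have fi: "integrable \<nu> (\<lambda>y. f y * \<phi> x y)" if "f \<in> FS" "x \<in> mspace m" for f x
  proof (rule Bochner_Integration.integrable_bound[of _ "\<lambda>y. L * \<phi> x y"])
    show "AE y in \<nu>. norm (f y * \<phi> x y) \<le> norm (L * \<phi> x y)"
      using f_bd[OF that(1)] \<phi>01[OF that(2)] L0 by (auto simp: sp abs_mult intro!: AE_I2 mult_right_mono)
  qed (use \<phi>i fm \<phi>m that in auto)
  have \<phi>int: "\<bar>(\<integral>y. \<phi> x y \<partial>?P f) - f x * c x\<bar> \<le> \<delta> * c x" if f: "f \<in> FS" and x: "x \<in> mspace m" for f x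
  proof -
    have "(\<integral>y. \<phi> x y \<partial>?P f) = (\<integral>y. f y * \<phi> x y \<partial>\<nu>)"
      using fm[OF f] \<phi>m[OF x] f_bd[OF f] by (subst integral_real_density) (auto simp: sp)
    then have "(\<integral>y. \<phi> x y \<partial>?P f) - f x * c x = (\<integral>y. f y * \<phi> x y - f x * \<phi> x y \<partial>\<nu>)"
      using fi[OF f x] \<phi>i[OF x] by (simp add: c_def)
    also have "\<bar>\<dots>\<bar> \<le> (\<integral>y. \<bar>f y * \<phi> x y - f x * \<phi> x y\<bar> \<partial>\<nu>)" by (rule integral_abs_bound)
    also have "\<dots> \<le> (\<integral>y. \<delta> * \<phi> x y \<partial>\<nu>)"
    proof (rule integral_mono)
      fix y assume "y \<in> space \<nu>"
      then have y: "y \<in> mspace m" by (simp add: sp)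
      show "\<bar>f y * \<phi> x y - f x * \<phi> x y\<bar> \<le> \<delta> * \<phi> x y"
      proof (cases "y \<in> B x")
        case True
        then have "\<bar>f x - f y\<bar> < \<delta>"
          using d(2)[OF f x y] r(2)[OF x] by (simp add: B_def)
        then have "\<bar>f y - f x\<bar> * \<phi> x y \<le> \<delta> * \<phi> x y"
          using \<phi>01[OF x] by (intro mult_right_mono) auto
        then show ?thesis using \<phi>01[OF x, of y] by (simp add: left_diff_distrib[symmetric] abs_mult)
      next
        case False
        then have "\<phi> x y = 0" using \<phi>01[OF x, of y] \<phi>pos[OF x y] by auto
        then show ?thesis by simp
      qed
    qed (use fi[OF f x] \<phi>i[OF x] in auto)
    finally show ?thesis by (simp add: c_def)
  qed
  have c0: "c x \<ge> 0" if "x \<in> mspace m" for x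
    unfolding c_def using \<phi>01[OF that] by (intro Bochner_Integration.integral_nonneg) auto
  \<comment> \<open>With \<open>c x = 0\<close> the tolerance \<open>\<delta> * c x\<close> would
    give an empty test set. Such a ball is null for \<nu>, hence for the given model, and can be
    discarded.\<close>
  define D1 where "D1 = {x\<in>D0. c x > 0}"
  have D1: "finite D1" "\<And>x. x \<in> D1 \<Longrightarrow> x \<in> mspace m" using D0 D0m by (auto simp: D1_def)
  define U where "U = borel_probs m \<inter> (\<Inter>x\<in>D1. {P \<in> borel_probs m.
      (\<integral>y. \<phi> x y \<partial>P) \<in> ball (\<integral>y. \<phi> x y \<partial>?P f0) (\<delta> * c x)})"
  have gen: "openin (weak_topology m) {P \<in> borel_probs m.
      (\<integral>y. \<phi> x y \<partial>P) \<in> ball (\<integral>y. \<phi> x y \<partial>?P f0) (\<delta> * c x)}" if x: "x \<in> mspace m" for x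
    unfolding weak_topology_def
  proof (rule topology_generated_by_Basis, rule CollectI,
      intro exI[of _ "\<phi> x"] exI[of _ "ball (\<integral>y. \<phi> x y \<partial>?P f0) (\<delta> * c x)"] conjI refl open_ball)
    show "bounded (\<phi> x ` mspace m)"
      using \<phi>01[OF x] by (intro boundedI[of _ 1]) auto
  qed (rule \<phi>c[OF x])
  have "openin (weak_topology m) U"
    unfolding U_def topspace_weak_topology[symmetric]
    by (subst Int_commute, rule openin_INT) (use D1 gen in \<open>auto simp: topspace_weak_topology\<close>)
  moreover have "?P f0 \<in> U"
    using fB[OF f0] \<delta> by (auto simp: U_def D1_def)
  moreover have "tv_dist m (?P f0) (?P f) < e" if f: "f \<in> FS" and fU: "?P f \<in> U" for f
  proof -
    interpret P: prob_space "?P f" by (rule fP[OF f])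
    \<comment> \<open>At the centre the densities differ by at most \<open>3 * \<delta>\<close>: two
      averaging errors and the tolerance of the test. Moving from \<open>x\<close> to
      \<open>y\<close> costs \<delta> for each density.\<close>
    have close: "\<bar>f y - f0 y\<bar> \<le> 5 * \<delta>" if x: "x \<in> D1" and y: "y \<in> B x" for x y
    proof -
      have xm: "x \<in> mspace m" and cx: "c x > 0" using x D1 by (auto simp: D1_def)
      have ym: "y \<in> mspace m" using y by (simp add: B_def)
      have "\<bar>(\<integral>y. \<phi> x y \<partial>?P f0) - (\<integral>y. \<phi> x y \<partial>?P f)\<bar> < \<delta> * c x"
        using fU x by (auto simp: U_def dist_real_def)
      then have "\<bar>f x * c x - f0 x * c x\<bar> \<le> 3 * \<delta> * c x"
        using \<phi>int[OF f xm] \<phi>int[OF f0 xm] by linarith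
      then have "\<bar>f x - f0 x\<bar> * c x \<le> 3 * \<delta> * c x"
        using cx by (simp add: left_diff_distrib[symmetric] abs_mult)
      then have "\<bar>f x - f0 x\<bar> \<le> 3 * \<delta>" using cx by simp
      moreover have "mdist m x y < d" using y r(2)[OF xm] by (simp add: B_def)
      ultimately show ?thesis using d(2)[OF f xm ym] d(2)[OF f0 xm ym] by linarith
    qed
    define Y where "Y = W \<inter> (\<Union>x\<in>D1. B x)"
    have BS: "(\<Union>x\<in>D'. B x) \<in> sets \<nu>" if "D' \<subseteq> D0" for D'
      using that D0 D0m Bop op_sets by (intro sets.finite_UN) (auto intro: finite_subset)
    have D10: "D1 \<subseteq> D0" by (auto simp: D1_def)
    have Ys: "Y \<in> sets \<nu>" unfolding Y_def using Ws BS[OF D10] by auto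
    have null: "P0.prob (B x) = 0" if x: "x \<in> D0 - D1" for x
    proof -
      have xm: "x \<in> mspace m" using x D0m by auto
      have "c x = 0" using x c0[OF xm] by (auto simp: D1_def)
      then have "AE y in \<nu>. \<phi> x y = 0"
        using integral_nonneg_eq_0_iff_AE[OF \<phi>i[OF xm]] \<phi>01[OF xm] by (auto simp: c_def)
      then have "AE y in \<nu>. y \<notin> B x"
        using AE_space by eventually_elim (use \<phi>pos[OF xm] sp in fastforce)
      then have "AE y in ?P f0. y \<notin> B x"
        using fm[OF f0] by (subst AE_density) auto
      then show ?thesis using Bop[OF xm] op_sets by (subst P0.prob_eq_0) auto
    qed
    have "P0.prob (\<Union>x\<in>D0. B x) \<le> P0.prob (\<Union>x\<in>D1. B x) + P0.prob (\<Union>x\<in>D0 - D1. B x)"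
    proof -
      have "(\<Union>x\<in>D0. B x) = (\<Union>x\<in>D1. B x) \<union> (\<Union>x\<in>D0 - D1. B x)" using D10 by auto
      then show ?thesis using BS[OF D10] BS[of "D0 - D1"]
        by (simp add: measure_Un_le)
    qed
    moreover have "P0.prob (\<Union>x\<in>D0 - D1. B x) \<le> (\<Sum>x\<in>D0 - D1. P0.prob (B x))"
      using D0 D0m Bop op_sets by (intro measure_UNION_le) auto
    ultimately have PD1: "P0.prob (\<Union>x\<in>D1. B x) > 1 - \<eta>"
      using D0(3) null by simp
    have cY: "P0.prob (space \<nu> - Y) \<le> 2 * \<eta>"
    proof -
      have "space \<nu> - Y = (space \<nu> - W) \<union> (space \<nu> - (\<Union>x\<in>D1. B x))" by (auto simp: Y_def)
      then have "P0.prob (space \<nu> - Y)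
          \<le> P0.prob (space \<nu> - W) + P0.prob (space \<nu> - (\<Union>x\<in>D1. B x))"
        using Ws BS[OF D10] by (simp add: measure_Un_le)
      moreover have "P0.prob (space \<nu> - W) = 1 - P0.prob W"
        using P0.prob_compl[of W] Ws by simp
      moreover have "P0.prob (space \<nu> - (\<Union>x\<in>D1. B x)) = 1 - P0.prob (\<Union>x\<in>D1. B x)"
        using P0.prob_compl[of "\<Union>x\<in>D1. B x"] BS[OF D10] by simp
      ultimately show ?thesis using PD1 C0(3) by (simp add: W_def)
    qed
    have onY: "\<bar>P.prob (S \<inter> Y) - P0.prob (S \<inter> Y)\<bar> \<le> \<eta>" if S: "S \<in> sets \<nu>" for S
    proof -
      have SY: "S \<inter> Y \<in> sets \<nu>" using S Ys by auto
      have SYW: "S \<inter> Y \<subseteq> W" by (auto simp: Y_def)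
      have SYfin: "emeasure \<nu> (S \<inter> Y) < \<infinity>"
        using emeasure_mono[OF SYW Ws] Wfin by (rule le_less_trans)
      have int: "integrable \<nu> (\<lambda>y. g y * indicator (S \<inter> Y) y)" if "g \<in> FS" for g
      proof (rule Bochner_Integration.integrable_bound[of _ "\<lambda>y. L * indicator (S \<inter> Y) y"])
        show "integrable \<nu> (\<lambda>y. L * indicator (S \<inter> Y) y)"
          using SY SYfin by (intro integrable_mult_right integrable_real_indicator)
        show "AE y in \<nu>. norm (g y * indicator (S \<inter> Y) y) \<le> norm (L * indicator (S \<inter> Y) y)"
          using f_bd[OF that] L0 by (intro AE_I2) (auto simp: sp indicator_def)
        show "(\<lambda>y. g y * indicator (S \<inter> Y) y) \<in> borel_measurable \<nu>"
          using fm[OF that] SY by (intro borel_measurable_times borel_measurable_indicator)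
      qed
      have pr: "measure (?P g) (S \<inter> Y) = (\<integral>y. g y * indicator (S \<inter> Y) y \<partial>\<nu>)" if g: "g \<in> FS" for g
      proof -
        have "measure (?P g) (S \<inter> Y) = (\<integral>y. indicator (S \<inter> Y) y \<partial>?P g)"
          using SY sets.sets_into_space[OF SY] by (simp add: Int_absorb2)
        also have "\<dots> = (\<integral>y. g y * indicator (S \<inter> Y) y \<partial>\<nu>)"
          using fm[OF g] f_bd[OF g] borel_measurable_indicator[OF SY]
          by (subst integral_real_density) (auto simp: sp)
        finally show ?thesis .
      qed
      have "\<bar>P.prob (S \<inter> Y) - P0.prob (S \<inter> Y)\<bar>
          = \<bar>\<integral>y. f y * indicator (S \<inter> Y) y - f0 y * indicator (S \<inter> Y) y \<partial>\<nu>\<bar>"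
        unfolding pr[OF f] pr[OF f0] using int[OF f] int[OF f0] by simp
      also have "\<dots> \<le> (\<integral>y. \<bar>f y * indicator (S \<inter> Y) y - f0 y * indicator (S \<inter> Y) y\<bar> \<partial>\<nu>)"
        by (rule integral_abs_bound)
      also have "\<dots> \<le> (\<integral>y. 5 * \<delta> * indicator W y \<partial>\<nu>)"
      proof (rule integral_mono)
        show "integrable \<nu> (\<lambda>y. 5 * \<delta> * indicator W y)"
          using Ws Wfin by (intro integrable_mult_right integrable_real_indicator)
        fix y assume "y \<in> space \<nu>"
        show "\<bar>f y * indicator (S \<inter> Y) y - f0 y * indicator (S \<inter> Y) y\<bar> \<le> 5 * \<delta> * indicator W y"
          using close \<delta> by (auto simp: Y_def indicator_def)
      qed (use int[OF f] int[OF f0] in auto)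
      also have "\<dots> = 5 * \<delta> * measure \<nu> W"
        using sets.sets_into_space[OF Ws] by (simp add: Int_absorb2)
      finally show ?thesis using \<delta>W by linarith
    qed
    \<comment> \<open>Both measures have total mass 1 and nearly agree on \<open>Y\<close>, so the
      mass of the second one cannot escape from \<open>Y\<close>. No tightness of the class is
      assumed; it comes out here.\<close>
    have cYP: "P.prob (space \<nu> - Y) \<le> 3 * \<eta>"
    proof -
      have "space \<nu> \<inter> Y = Y" using sets.sets_into_space[OF Ys] by auto
      then have "\<bar>P.prob Y - P0.prob Y\<bar> \<le> \<eta>" using onY[of "space \<nu>"] by simp
      moreover have "P.prob (space \<nu> - Y) = 1 - P.prob Y" "P0.prob (space \<nu> - Y) = 1 - P0.prob Y"
        using P.prob_compl[of Y] P0.prob_compl[of Y] Ys by simp_all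
      ultimately show ?thesis using cY by linarith
    qed
    have bound: "\<bar>P0.prob S - P.prob S\<bar> \<le> 4 * \<eta>" if "S \<in> sets (borel_space m)" for S
    proof -
      have S: "S \<in> sets \<nu>" using that s\<nu> by simp
      have split: "measure (?P g) S = measure (?P g) (S \<inter> Y) + measure (?P g) (S - Y)"
        if g: "g \<in> FS" for g
      proof -
        interpret prob_space "?P g" by (rule fP[OF g])
        have "S = (S \<inter> Y) \<union> (S - Y)" by auto
        then show ?thesis using finite_measure_Union[of "S \<inter> Y" "S - Y"] S Ys by auto
      qed
      have "S - Y \<subseteq> space \<nu> - Y" using sets.sets_into_space[OF S] by auto
      then have "P0.prob (S - Y) \<le> P0.prob (space \<nu> - Y)" "P.prob (S - Y) \<le> P.prob (space \<nu> - Y)"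
        using Ys by (auto intro!: P0.finite_measure_mono P.finite_measure_mono)
      then have "P0.prob (S - Y) \<le> 3 * \<eta>" "P.prob (S - Y) \<le> 3 * \<eta>"
        using cY cYP \<eta> by linarith+
      moreover have "0 \<le> P0.prob (S - Y)" "0 \<le> P.prob (S - Y)" by simp_all
      ultimately show ?thesis using onY[OF S] unfolding split[OF f] split[OF f0] by linarith
    qed
    have "tv_dist m (?P f0) (?P f) \<le> 4 * \<eta>"
      using fB[OF f0] fB[OF f] bound unfolding tv_dist_def
      by (auto intro!: cSUP_least simp: ex_in_conv[symmetric] intro: sets.empty_sets)
    then show ?thesis using e by (simp add: \<eta>_def)
  qed
  ultimately show thesis by (rule that)
qed

section \<open>Openness and density\<close>

lemma open_dense_inI:
  assumes FM: "F \<subseteq> M" and M: "M \<subseteq> topspace T"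
    and op: "\<And>P. P \<in> F \<Longrightarrow> \<exists>U. openin T U \<and> P \<in> U \<and> U \<inter> M \<subseteq> F"
    and dense: "\<And>P U. P \<in> M \<Longrightarrow> openin T U \<Longrightarrow> P \<in> U \<Longrightarrow> \<exists>Q\<in>F. Q \<in> U"
  shows "open_dense_in T M F"
  unfolding open_dense_in_def
proof
  show "openin (subtopology T M) F"
  proof (subst openin_subopen, intro ballI)
    fix P assume P: "P \<in> F"
    then obtain U where U: "openin T U" "P \<in> U" "U \<inter> M \<subseteq> F" using op by blast
    then show "\<exists>W. openin (subtopology T M) W \<and> P \<in> W \<and> W \<subseteq> F"
      using P FM by (intro exI[of _ "U \<inter> M"]) (auto simp: openin_subtopology)
  qed
  have ts: "topspace (subtopology T M) = M" using M by (simp add: Int_absorb1)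
  show "subtopology T M closure_of F = M"
  proof
    show "subtopology T M closure_of F \<subseteq> M"
      using closure_of_subset_topspace[of "subtopology T M" F] ts by simp
    show "M \<subseteq> subtopology T M closure_of F"
    proof
      fix P assume P: "P \<in> M"
      show "P \<in> subtopology T M closure_of F"
        unfolding in_closure_of ts
      proof (intro conjI allI impI P)
        fix W assume "P \<in> W \<and> openin (subtopology T M) W"
        then obtain U where U: "openin T U" "W = U \<inter> M" "P \<in> U" by (auto simp: openin_subtopology)
        then obtain Q where "Q \<in> F" "Q \<in> U" using dense[OF P] by blast
        then show "\<exists>Q. Q \<in> F \<and> Q \<in> W" using U FM by auto
      qed
    qed
  qed
qed

context bayes_space
begin

lemma locally_finite_ref: "locally_finite_measure (prod_space X V) (PiM V ref)"
  unfolding locally_finite_measure_def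
proof (intro conjI ballI)
  show "sets (PiM V ref) = sets (borel_space (prod_space X V))" by (simp add: sets_prod)
  fix x assume x: "x \<in> mspace (prod_space X V)"
  have "\<exists>U. openin (mtopology_of (X v)) U \<and> x v \<in> U \<and> emeasure (ref v) U < \<infinity>" if v: "v \<in> V" for v
  proof -
    have "x v \<in> mspace (X v)" using x v by (auto simp: mspace_prod_space finite_V)
    then show ?thesis using locally_finite[OF v] v by (simp add: locally_finite_measure_def ref_def)
  qed
  then obtain U where U: "\<And>v. v \<in> V \<Longrightarrow> openin (mtopology_of (X v)) (U v)"
    "\<And>v. v \<in> V \<Longrightarrow> x v \<in> U v" "\<And>v. v \<in> V \<Longrightarrow> emeasure (ref v) (U v) < \<infinity>" by metis
  have "emeasure (PiM V ref) (Pi\<^sub>E V U) = (\<Prod>v\<in>V. emeasure (ref v) (U v))"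
    by (intro emeasure_PiM finite_V) (simp add: sets_ref borel_openin[OF U(1)])
  also have "\<dots> < \<infinity>"
    using U(3) by (simp add: less_top[symmetric] ennreal_prod_eq_top finite_V)
  finally have "emeasure (PiM V ref) (Pi\<^sub>E V U) < \<infinity>" .
  moreover have "x \<in> Pi\<^sub>E V U" using x U by (auto simp: mspace_prod_space finite_V PiE_iff)
  ultimately show "\<exists>U. openin (mtopology_of (prod_space X V)) U \<and> x \<in> U \<and> emeasure (PiM V ref) U < \<infinity>"
    using openin_box[OF finite_V, of X U] U(1) by blast
qed

section \<open>Joint densities of the class\<close>

definition joint_density :: "('v \<Rightarrow> 'a \<times> ('v \<Rightarrow> 'a) \<Rightarrow> real) \<Rightarrow> ('v \<Rightarrow> 'a) \<Rightarrow> real" where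
  "joint_density p z = (\<Prod>v\<in>V. fam_density v (p v) z)"

lemma family_subset_V: "v \<in> V \<Longrightarrow> family v \<subseteq> V"
  using pa_subset by (auto simp: family_def)

context
  fixes K :: real and \<omega> :: "real \<Rightarrow> real"
  assumes K: "K > 0" and \<omega>: "modulus_of_continuity \<omega>"
begin

lemma fam_bounds:
  assumes "eqb_family K \<omega> p" "v \<in> V" "z \<in> mspace (prod_space X V)"
  shows "0 \<le> fam_density v (p v) z" "fam_density v (p v) z \<le> K"
  using assms fam_density_bounds[OF _ family_subset_V order_refl, of K \<omega> v "p v" z]
  by (auto simp: eqb_family_def)

lemma fam_measurable:
  "eqb_family K \<omega> p \<Longrightarrow> v \<in> V \<Longrightarrow> fam_density v (p v) \<in> borel_measurable (PiM V ref)"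
  by (rule fam_density_measurable[OF \<omega>]) (auto simp: eqb_family_def family_subset_V)

lemma joint_density_bounds:
  assumes "eqb_family K \<omega> p" "z \<in> mspace (prod_space X V)"
  shows "0 \<le> joint_density p z" "joint_density p z \<le> K ^ card V"
proof -
  show "0 \<le> joint_density p z"
    unfolding joint_density_def using fam_bounds[OF assms(1) _ assms(2)] by (intro prod_nonneg) auto
  have "joint_density p z \<le> (\<Prod>v\<in>V. K)"
    unfolding joint_density_def using fam_bounds[OF assms(1) _ assms(2)] by (intro prod_mono) auto
  then show "joint_density p z \<le> K ^ card V" by simp
qed

lemma joint_density_borel:
  "eqb_family K \<omega> p \<Longrightarrow> joint_density p \<in> borel_measurable (PiM V ref)"
  unfolding joint_density_def[abs_def] by (intro borel_measurable_prod fam_measurable)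

lemma eqb_joint_eq:
  assumes "eqb_family K \<omega> p"
  shows "eqb_joint p = density (PiM V ref) (\<lambda>z. ennreal (joint_density p z))"
  unfolding joint_def
proof (rule density_cong)
  have m: "(\<lambda>z. ennreal (fam_density v (p v) z)) \<in> borel_measurable (PiM V ref)" if "v \<in> V" for v
    using fam_measurable[OF assms that] by measurable
  then show "(\<lambda>z. \<Prod>v\<in>V. ennreal (fam_density v (p v) z)) \<in> borel_measurable (PiM V ref)"
    by (rule borel_measurable_prod_ennreal)
  show "(\<lambda>z. ennreal (joint_density p z)) \<in> borel_measurable (PiM V ref)"
    using joint_density_borel[OF assms] by measurable
  show "AE z in PiM V ref. (\<Prod>v\<in>V. ennreal (fam_density v (p v) z)) = ennreal (joint_density p z)"
    using fam_bounds[OF assms]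
    by (intro AE_I2) (simp add: joint_density_def prod_ennreal space_prod)
qed

lemma eqb_joint_prob:
  assumes "eqb_family K \<omega> p"
  shows "prob_space (eqb_joint p)" "eqb_joint p \<in> borel_probs (prod_space X V)"
    "eqb_joint p \<in> markov_dists V E X"
proof -
  interpret joint_cpds V E X \<mu> "\<lambda>v z. ennreal (fam_density v (p v) z)"
    by (rule eqb_family_joint_cpds[OF \<omega> assms])
  show "prob_space (eqb_joint p)" "eqb_joint p \<in> borel_probs (prod_space X V)"
    "eqb_joint p \<in> markov_dists V E X"
    by (rule prob_space_joint joint_borel_probs joint_markov)+
qed

text \<open>Divided by \<open>K\<close> the factors lie in [0,1], where a product changes by at most
  the sum of the changes of its factors.\<close>

lemma joint_density_equicontinuous:
  assumes e: "e > 0"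
  shows "\<exists>d>0. \<forall>f\<in>joint_density ` {p. eqb_family K \<omega> p}. \<forall>x\<in>mspace (prod_space X V).
    \<forall>y\<in>mspace (prod_space X V). mdist (prod_space X V) x y < d \<longrightarrow> \<bar>f x - f y\<bar> < e"
proof -
  let ?n = "card V"
  \<comment> \<open>With \<open>n\<close> vertices the total change is at most
    \<open>K^n * (n * e' / K)\<close>, here \<open>n / (n + 1) * e\<close>. The added 1 makes this
    strict and the denominator nonzero for an empty graph.\<close>
  define e' where "e' = e * K / (K ^ ?n * (real ?n + 1))"
  have e': "e' > 0" using e K by (simp add: e'_def)
  from fam_density_equicontinuous[OF \<omega> e'] obtain d where d: "d > 0"
    and close: "\<forall>K v p W x y. eqb_density K \<omega> v p \<and> family v \<subseteq> W \<and> W \<subseteq> V \<and>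
     x \<in> mspace (prod_space X W) \<and> y \<in> mspace (prod_space X W) \<and>
     mdist (prod_space X W) x y < d \<longrightarrow> \<bar>fam_density v p x - fam_density v p y\<bar> < e'"
    by (elim exE conjE) (rule that)
  have "\<bar>joint_density p x - joint_density p y\<bar> < e"
    if p: "eqb_family K \<omega> p" and x: "x \<in> mspace (prod_space X V)" and y: "y \<in> mspace (prod_space X V)"
      and xy: "mdist (prod_space X V) x y < d" for p x y
  proof -
    let ?F = "\<lambda>v z. fam_density v (p v) z"
    have c: "\<bar>?F v x - ?F v y\<bar> < e'" if v: "v \<in> V" for v
      using close[rule_format, of K v "p v" V x y] p v x y xy family_subset_V[OF v]
      by (simp add: eqb_family_def)
    have scale: "joint_density p z = K ^ ?n * (\<Prod>v\<in>V. ?F v z / K)" for z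
      using K by (simp add: joint_density_def prod_dividef)
    have nb: "norm (?F v z / K) \<le> 1" if "v \<in> V" "z \<in> mspace (prod_space X V)" for v z
      using fam_bounds[OF p that] K by simp
    have "\<bar>(\<Prod>v\<in>V. ?F v x / K) - (\<Prod>v\<in>V. ?F v y / K)\<bar> \<le> (\<Sum>v\<in>V. norm (?F v x / K - ?F v y / K))"
      using norm_prod_diff[of V "\<lambda>v. ?F v x / K" "\<lambda>v. ?F v y / K"] nb x y by simp
    also have "\<dots> \<le> (\<Sum>v\<in>V. e' / K)"
      using c K by (intro sum_mono)
        (simp add: diff_divide_distrib[symmetric] abs_divide divide_right_mono less_imp_le)
    also have "\<dots> = real ?n * e' / K" by simp
    finally have "K ^ ?n * \<bar>(\<Prod>v\<in>V. ?F v x / K) - (\<Prod>v\<in>V. ?F v y / K)\<bar> \<le> K ^ ?n * (real ?n * e' / K)"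
      using K by (intro mult_left_mono) auto
    moreover have "\<bar>joint_density p x - joint_density p y\<bar>
        = K ^ ?n * \<bar>(\<Prod>v\<in>V. ?F v x / K) - (\<Prod>v\<in>V. ?F v y / K)\<bar>"
      unfolding scale using K by (simp add: right_diff_distrib[symmetric] abs_mult)
    moreover have "K ^ ?n * (real ?n * e' / K) = real ?n / (real ?n + 1) * e"
      using K by (simp add: e'_def)
    moreover have "real ?n / (real ?n + 1) * e < 1 * e"
      using e by (intro mult_strict_right_mono) auto
    ultimately show ?thesis by linarith
  qed
  then show ?thesis using d by (intro exI[of _ d]) auto
qed

lemma eqb_class_joint_density:
  "eqb_class (prod_space X V) (PiM V ref) (K ^ card V) (joint_density ` {p. eqb_family K \<omega> p})"
  unfolding eqb_class_def
proof (intro conjI ballI allI impI)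
  fix f assume "f \<in> joint_density ` {p. eqb_family K \<omega> p}"
  then obtain p where p: "f = joint_density p" "eqb_family K \<omega> p" by auto
  show "f \<in> borel_measurable (borel_space (prod_space X V))"
    using joint_density_borel[OF p(2)] p(1) by (simp add: measurable_cong_sets[OF sets_prod[OF order_refl] refl])
  show "prob_space (density (PiM V ref) (\<lambda>x. ennreal (f x)))"
    using eqb_joint_prob(1)[OF p(2)] eqb_joint_eq[OF p(2)] p(1) by simp
  fix x assume "x \<in> mspace (prod_space X V)"
  then show "0 \<le> f x" "f x \<le> K ^ card V" using joint_density_bounds[OF p(2)] p(1) by auto
qed (rule joint_density_equicontinuous)

lemma second_countable_V: "second_countable (mtopology_of (prod_space X V))"
  using second_countable_X by (intro second_countable_prod_space finite_V) auto

lemma M_eqb_density: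
  assumes "P \<in> M_eqb V E X K \<omega> \<mu>"
  obtains p where "eqb_family K \<omega> p" "P = eqb_joint p"
proof -
  obtain k where k: "k \<in> BN_eqb V E X K \<omega> \<mu>" "P = BN_dist V E X k"
    using assms unfolding M_eqb_def by (elim imageE)
  show thesis
  proof (rule BN_eqb_density[OF \<omega> k(1)])
    fix p assume "eqb_family K \<omega> p" "BN_dist V E X k = eqb_joint p"
    then show thesis using that k(2) by simp
  qed
qed

lemma M_eqb_markov: "M_eqb V E X K \<omega> \<mu> \<subseteq> markov_dists V E X"
proof
  fix P assume "P \<in> M_eqb V E X K \<omega> \<mu>"
  then obtain p where "eqb_family K \<omega> p" "P = eqb_joint p" by (rule M_eqb_density)
  then show "P \<in> markov_dists V E X" using eqb_joint_prob(3) by simp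
qed

lemma M_eqb_borel_probs: "M_eqb V E X K \<omega> \<mu> \<subseteq> borel_probs (prod_space X V)"
  using M_eqb_markov by (auto simp: markov_dists_def)

text \<open>With \<open>weak_topology_coarser_tv\<close> this says that on the class the weak
  topology and that of total variation coincide.\<close>

lemma M_eqb_weak_neighbourhood:
  assumes P: "P \<in> M_eqb V E X K \<omega> \<mu>" and e: "e > 0"
  obtains U where "openin (weak_topology (prod_space X V)) U" "P \<in> U"
    "\<And>Q. Q \<in> M_eqb V E X K \<omega> \<mu> \<Longrightarrow> Q \<in> U \<Longrightarrow> tv_dist (prod_space X V) P Q < e"
proof -
  let ?FS = "joint_density ` {p. eqb_family K \<omega> p}"
  obtain p where p: "eqb_family K \<omega> p" "P = eqb_joint p" using M_eqb_density[OF P] .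
  have pF: "joint_density p \<in> ?FS" using p by auto
  obtain U where U: "openin (weak_topology (prod_space X V)) U"
    "density (PiM V ref) (\<lambda>z. ennreal (joint_density p z)) \<in> U"
    "\<And>f. f \<in> ?FS \<Longrightarrow> density (PiM V ref) (\<lambda>z. ennreal (f z)) \<in> U \<Longrightarrow>
      tv_dist (prod_space X V) (density (PiM V ref) (\<lambda>z. ennreal (joint_density p z)))
        (density (PiM V ref) (\<lambda>z. ennreal (f z))) < e"
    by (rule weak_neighbourhood_tv[OF second_countable_V locally_finite_ref eqb_class_joint_density pF e])
      (rule that)
  have PU: "P \<in> U" using U(2) p eqb_joint_eq by simp
  show thesis
  proof (rule that[OF U(1) PU])
    fix Q assume "Q \<in> M_eqb V E X K \<omega> \<mu>" "Q \<in> U"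
    moreover from this(1) obtain q where q: "eqb_family K \<omega> q" "Q = eqb_joint q"
      by (rule M_eqb_density)
    ultimately show "tv_dist (prod_space X V) P Q < e"
      using U(3)[of "joint_density q"] p q by (simp add: eqb_joint_eq)
  qed
qed

section \<open>Persistence of faithfulness\<close>

definition not_separated :: "('v set \<times> 'v set \<times> 'v set) set" where
  "not_separated = {(A, B, C). A \<subseteq> V \<and> B \<subseteq> V \<and> C \<subseteq> V \<and> \<not> d_separated V E A B C}"

text \<open>Finiteness allows taking the least of the radii for openness and uniting the finite sets
  of bad weights for density.\<close>

lemma finite_not_separated: "finite not_separated"
proof (rule finite_subset)
  show "not_separated \<subseteq> Pow V \<times> Pow V \<times> Pow V" by (auto simp: not_separated_def)
qed (simp add: finite_V)

lemma faithful_iff: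
  "P \<in> faithful_dists V E X \<longleftrightarrow>
    P \<in> markov_dists V E X \<and> (\<forall>(A, B, C)\<in>not_separated. \<not> cond_indep X P A B C)"
  by (auto simp: faithful_dists_def not_separated_def)

text \<open>One pair of events witnesses the dependence, and the same pair still does so nearby.
  \<open>sigma_coord\<close> uses only the space of the measure, so all the measures share
  it.\<close>

lemma not_cond_indep_tv_open:
  assumes P: "P \<in> borel_probs (prod_space X V)" and sub: "A \<subseteq> V" "B \<subseteq> V" "C \<subseteq> V"
    and nci: "\<not> cond_indep X P A B C"
  shows "\<exists>e>0. \<forall>Q\<in>borel_probs (prod_space X V). tv_dist (prod_space X V) P Q < e \<longrightarrow>
    \<not> cond_indep X Q A B C"
proof -
  let ?m = "prod_space X V"
  let ?F = "sigma_coord X (borel_space ?m) C"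
  have F: "subalgebra (borel_space ?m) ?F" by (rule subalgebra_sigma_coord[OF refl sub(3)])
  have FQ: "sigma_coord X Q C = ?F" if "Q \<in> borel_probs ?m" for Q
    using space_borel_probs[OF that] by (simp add: sigma_coord_def space_borel_space)
  obtain S T where S: "S \<in> sets (borel_space (prod_space X A))"
    and T: "T \<in> sets (borel_space (prod_space X B))"
    and n: "\<not> cond_indep_events P ?F (cyl A S) (cyl B T)"
    using nci FQ[OF P] cond_indep_iff_events[OF space_borel_probs[OF P]] by auto
  obtain e where "e > 0" and e: "\<And>Q. Q \<in> borel_probs ?m \<Longrightarrow> tv_dist ?m P Q < e \<Longrightarrow>
      \<not> cond_indep_events Q ?F (cyl A S) (cyl B T)"
    using not_cond_indep_events_tv_open[OF P F cyl_sets[OF sub(1) S] cyl_sets[OF sub(2) T] n] by blast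
  then show ?thesis
    using S T FQ cond_indep_iff_events[OF space_borel_probs] by (intro exI[of _ e]) metis
qed

lemma faithful_tv_neighbourhood:
  assumes P: "P \<in> faithful_dists V E X"
  obtains e where "e > 0"
    "\<And>Q. Q \<in> markov_dists V E X \<Longrightarrow> tv_dist (prod_space X V) P Q < e \<Longrightarrow> Q \<in> faithful_dists V E X"
proof -
  let ?m = "prod_space X V"
  have Pm: "P \<in> borel_probs ?m" using P by (auto simp: faithful_dists_def markov_dists_def)
  have "\<forall>t\<in>not_separated. \<exists>e>0. case t of (A, B, C) \<Rightarrow> \<forall>Q\<in>borel_probs ?m. tv_dist ?m P Q < e \<longrightarrow>
      \<not> cond_indep X Q A B C"
    using P not_cond_indep_tv_open[OF Pm] by (auto simp: faithful_iff not_separated_def)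
  then obtain e where e: "\<And>t. t \<in> not_separated \<Longrightarrow> e t > 0"
    "\<And>A B C Q. (A, B, C) \<in> not_separated \<Longrightarrow> Q \<in> borel_probs ?m \<Longrightarrow> tv_dist ?m P Q < e (A, B, C) \<Longrightarrow>
      \<not> cond_indep X Q A B C"
    by (metis (mono_tags, lifting) case_prodD)
  define d where "d = Min (insert 1 (e ` not_separated))"
  have d: "d > 0" "\<And>t. t \<in> not_separated \<Longrightarrow> d \<le> e t"
    using e(1) finite_not_separated by (auto simp: d_def)
  show thesis
  proof (rule that[OF d(1)])
    fix Q assume Q: "Q \<in> markov_dists V E X" and lt: "tv_dist ?m P Q < d"
    have "Q \<in> borel_probs ?m" using Q by (simp add: markov_dists_def)
    then have "\<not> cond_indep X Q A B C" if "(A, B, C) \<in> not_separated" for A B C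
      using e(2)[OF that] d(2)[OF that] lt by auto
    then show "Q \<in> faithful_dists V E X" using Q by (auto simp: faithful_iff)
  qed
qed

section \<open>Mixtures of conditional densities\<close>

definition mix :: "real \<Rightarrow> ('v \<Rightarrow> 'a \<times> ('v \<Rightarrow> 'a) \<Rightarrow> real) \<Rightarrow> ('v \<Rightarrow> 'a \<times> ('v \<Rightarrow> 'a) \<Rightarrow> real)
    \<Rightarrow> ('v \<Rightarrow> 'a \<times> ('v \<Rightarrow> 'a) \<Rightarrow> real)" where
  "mix l p q v z = (1 - l) * p v z + l * q v z"

lemma fam_density_mix:
  "fam_density v (mix l p q v) z = (1 - l) * fam_density v (p v) z + l * fam_density v (q v) z"
  by (simp add: fam_density_def mix_def)

lemma eqb_density_section:
  assumes p: "eqb_family K \<omega> p" and v: "v \<in> V" and x: "x \<in> mspace (prod_space X (pa E v))"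
  shows "y \<in> space (ref v) \<Longrightarrow> 0 \<le> p v (y, x)" "(\<lambda>y. p v (y, x)) \<in> borel_measurable (ref v)"
    "(\<integral>\<^sup>+y. ennreal (p v (y, x)) \<partial>ref v) = 1"
proof -
  show "(\<lambda>y. p v (y, x)) \<in> borel_measurable (ref v)"
    by (rule density_section_measurable[OF \<omega> _ v x]) (use p v in \<open>auto simp: eqb_family_def\<close>)
qed (use p v x in \<open>auto simp: eqb_family_def eqb_density_def space_ref\<close>)

lemma nn_integral_mix:
  assumes p: "eqb_family K \<omega> p" and q: "eqb_family K \<omega> q" and l: "l \<in> {0..1}"
    and v: "v \<in> V" and x: "x \<in> mspace (prod_space X (pa E v))" and S: "S \<in> sets (ref v)"
  shows "(\<integral>\<^sup>+y. ennreal (mix l p q v (y, x)) * indicator S y \<partial>ref v)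
    = ennreal (1 - l) * (\<integral>\<^sup>+y. ennreal (p v (y, x)) * indicator S y \<partial>ref v)
      + ennreal l * (\<integral>\<^sup>+y. ennreal (q v (y, x)) * indicator S y \<partial>ref v)"
proof -
  note m = eqb_density_section(2)[OF p v x, measurable] eqb_density_section(2)[OF q v x, measurable]
  note S [measurable]
  have "(\<integral>\<^sup>+y. ennreal (mix l p q v (y, x)) * indicator S y \<partial>ref v)
    = (\<integral>\<^sup>+y. ennreal (1 - l) * (ennreal (p v (y, x)) * indicator S y)
        + ennreal l * (ennreal (q v (y, x)) * indicator S y) \<partial>ref v)"
    using eqb_density_section(1)[OF p v x] eqb_density_section(1)[OF q v x] l
    by (intro nn_integral_cong)
      (simp add: mix_def ennreal_plus ennreal_mult distrib_right mult.assoc)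
  also have "\<dots> = (\<integral>\<^sup>+y. ennreal (1 - l) * (ennreal (p v (y, x)) * indicator S y) \<partial>ref v)
      + (\<integral>\<^sup>+y. ennreal l * (ennreal (q v (y, x)) * indicator S y) \<partial>ref v)"
    by (intro nn_integral_add) measurable
  finally show ?thesis using S by (simp add: nn_integral_cmult)
qed

text \<open>Bound, modulus and normalisation are all preserved by convex combinations. Mixing is
  done vertex by vertex, because a mixture of the two joint distributions would in general not
  factorise along the graph.\<close>

lemma eqb_family_mix:
  assumes p: "eqb_family K \<omega> p" and q: "eqb_family K \<omega> q" and l: "l \<in> {0..1}"
  shows "eqb_family K \<omega> (mix l p q)"
  unfolding eqb_family_def
proof (intro ballI conjI)
  fix v assume v: "v \<in> V"
  let ?m = "prod_metric (X v) (prod_space X (pa E v))"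
  have pv: "eqb_density K \<omega> v (p v)" "eqb_density K \<omega> v (q v)"
    using p q v by (auto simp: eqb_family_def)
  show "eqb_density K \<omega> v (mix l p q v)"
    unfolding eqb_density_def admits_modulus_def
  proof (intro conjI ballI)
    fix z assume z: "z \<in> mspace ?m"
    have b: "0 \<le> p v z" "p v z \<le> K" "0 \<le> q v z" "q v z \<le> K"
      using pv z unfolding eqb_density_def by blast+
    show "0 \<le> mix l p q v z" using b l by (simp add: mix_def)
    have "mix l p q v z \<le> (1 - l) * K + l * K"
      unfolding mix_def using b l by (intro add_mono mult_left_mono) auto
    then show "mix l p q v z \<le> K" by (simp add: algebra_simps)
    fix w assume w: "w \<in> mspace ?m"
    have a: "\<bar>p v z - p v w\<bar> \<le> \<omega> (mdist ?m z w)" "\<bar>q v z - q v w\<bar> \<le> \<omega> (mdist ?m z w)"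
      using pv z w unfolding eqb_density_def admits_modulus_def by blast+
    have "mix l p q v z - mix l p q v w = (1 - l) * (p v z - p v w) + l * (q v z - q v w)"
      by (simp add: mix_def algebra_simps)
    also have "\<bar>\<dots>\<bar> \<le> (1 - l) * \<bar>p v z - p v w\<bar> + l * \<bar>q v z - q v w\<bar>"
      using l by (intro order_trans[OF abs_triangle_ineq]) (simp add: abs_mult)
    also have "\<dots> \<le> (1 - l) * \<omega> (mdist ?m z w) + l * \<omega> (mdist ?m z w)"
      using a l by (intro add_mono mult_left_mono) auto
    finally show "\<bar>mix l p q v z - mix l p q v w\<bar> \<le> \<omega> (mdist ?m z w)" by (simp add: algebra_simps)
  qed
  fix x assume x: "x \<in> mspace (prod_space X (pa E v))"
  have r: "(\<integral>\<^sup>+y. g y * indicator (space (ref v)) y \<partial>ref v) = (\<integral>\<^sup>+y. g y \<partial>ref v)" for g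
    by (intro nn_integral_cong) simp
  show "(\<integral>\<^sup>+y. ennreal (mix l p q v (y, x)) \<partial>ref v) = 1"
    using nn_integral_mix[OF p q l v x sets.top] eqb_density_section(3)[OF p v x]
      eqb_density_section(3)[OF q v x] l
    unfolding r by (simp add: ennreal_plus[symmetric] del: ennreal_plus)
qed

text \<open>Membership requires measurable kernels. The probability that a mixed kernel gives to an
  event is a convex combination of those given by the two old kernels, hence measurable in the
  parents.\<close>

lemma mix_in_M_eqb:
  assumes k: "k \<in> BN_eqb V E X K \<omega> \<mu>" and k': "k' \<in> BN_eqb V E X K \<omega> \<mu>"
    and p: "eqb_family K \<omega> p" and q: "eqb_family K \<omega> q"
    and kp: "\<And>v x. v \<in> V \<Longrightarrow> x \<in> mspace (prod_space X (pa E v)) \<Longrightarrow>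
      k v x = density (ref v) (\<lambda>y. ennreal (p v (y, x)))"
    and kq: "\<And>v x. v \<in> V \<Longrightarrow> x \<in> mspace (prod_space X (pa E v)) \<Longrightarrow>
      k' v x = density (ref v) (\<lambda>y. ennreal (q v (y, x)))"
    and l: "l \<in> {0..1}"
  shows "eqb_joint (mix l p q) \<in> M_eqb V E X K \<omega> \<mu>"
proof -
  let ?r = "mix l p q"
  have r: "eqb_family K \<omega> ?r" by (rule eqb_family_mix[OF p q l])
  define kk where "kk = (\<lambda>v\<in>V. \<lambda>x. density (ref v) (\<lambda>y. ennreal (?r v (y, x))))"
  have kk: "kk v x = density (ref v) (\<lambda>y. ennreal (?r v (y, x)))" if "v \<in> V" for v x
    using that by (simp add: kk_def)
  have prob: "prob_space (kk v x)" if v: "v \<in> V" and x: "x \<in> mspace (prod_space X (pa E v))" for v x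
  proof
    show "emeasure (kk v x) (space (kk v x)) = 1"
      using eqb_density_section(2,3)[OF r v x] unfolding kk[OF v]
      by (subst emeasure_density) (auto cong: nn_integral_cong)
  qed
  have meas: "kk v \<in> measurable (borel_space (prod_space X (pa E v))) (prob_algebra (borel_space (X v)))"
    if v: "v \<in> V" for v
  proof (rule measurable_prob_algebraI)
    let ?B = "borel_space (prod_space X (pa E v))"
    show "prob_space (kk v x)" if "x \<in> space ?B" for x
      using prob[OF v, of x] that by (simp add: space_borel_space)
  next
    let ?B = "borel_space (prod_space X (pa E v))"
    have mk: "k v \<in> measurable ?B (subprob_algebra (borel_space (X v)))"
      "k' v \<in> measurable ?B (subprob_algebra (borel_space (X v)))"
      using k k' v by (auto simp: BN_eqb_def BN_def intro!: measurable_prob_algebraD)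
    show "kk v \<in> measurable ?B (subprob_algebra (borel_space (X v)))"
    proof (rule measurable_subprob_algebra)
      fix x assume "x \<in> space ?B"
      then show "subprob_space (kk v x)"
        using prob[OF v, of x] by (simp add: space_borel_space prob_space_imp_subprob_space)
      show "sets (kk v x) = sets (borel_space (X v))" by (simp add: kk[OF v] sets_ref[OF v])
    next
      fix S assume S: "S \<in> sets (borel_space (X v))"
      then have S': "S \<in> sets (ref v)" by (simp add: sets_ref[OF v])
      have eq: "emeasure (kk v x) S = ennreal (1 - l) * emeasure (k v x) S + ennreal l * emeasure (k' v x) S"
        if "x \<in> space ?B" for x
      proof -
        have x: "x \<in> mspace (prod_space X (pa E v))" using that by (simp add: space_borel_space)
        have em: "emeasure (density (ref v) (\<lambda>y. ennreal (g v (y, x)))) S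
            = (\<integral>\<^sup>+y. ennreal (g v (y, x)) * indicator S y \<partial>ref v)" if "eqb_family K \<omega> g" for g
          using eqb_density_section(2)[OF that v x] S' by (intro emeasure_density) auto
        show ?thesis unfolding kk[OF v] kp[OF v x] kq[OF v x] em[OF p] em[OF q] em[OF r]
          by (rule nn_integral_mix[OF p q l v x S'])
      qed
      have "(\<lambda>x. ennreal (1 - l) * emeasure (k v x) S + ennreal l * emeasure (k' v x) S) \<in> borel_measurable ?B"
        using measurable_emeasure_kernel[OF mk(1) S] measurable_emeasure_kernel[OF mk(2) S] by measurable
      then show "(\<lambda>x. emeasure (kk v x) S) \<in> borel_measurable ?B"
        by (subst measurable_cong[OF eq])
    qed
  qed
  have kkBN: "kk \<in> BN V E X" unfolding BN_def using meas by (auto simp: kk_def)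
  have "kk \<in> BN_eqb V E X K \<omega> \<mu>"
    unfolding BN_eqb_def
  proof (intro CollectI conjI ballI kkBN)
    fix v assume v: "v \<in> V"
    have "eqb_density K \<omega> v (?r v)" using r v by (simp add: eqb_family_def)
    then show "\<exists>p. (\<forall>z\<in>mspace (prod_metric (X v) (prod_space X (pa E v))). 0 \<le> p z \<and> p z \<le> K) \<and>
        admits_modulus (prod_metric (X v) (prod_space X (pa E v))) \<omega> p \<and>
        (\<forall>x\<in>mspace (prod_space X (pa E v)). kk v x = density (\<mu> v) (\<lambda>y. ennreal (p (y, x))))"
      using v kk[OF v] by (intro exI[of _ "?r v"]) (simp add: eqb_density_def ref_def)
  qed
  moreover have "BN_dist V E X kk = eqb_joint ?r"
    by (rule BN_dist_joint[OF kkBN])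
      (use r in \<open>auto simp: eqb_family_def fam_density_upd kk intro!: cpd_fam_density[OF \<omega>]\<close>)
  ultimately show ?thesis unfolding M_eqb_def by (metis imageI)
qed

lemma mix_0: "mix 0 p q = p" and mix_1: "mix 1 p q = q"
  by (auto simp: mix_def fun_eq_iff)

context
  fixes p q :: "'v \<Rightarrow> 'a \<times> ('v \<Rightarrow> 'a) \<Rightarrow> real"
  assumes p: "eqb_family K \<omega> p" and q: "eqb_family K \<omega> q"
begin

text \<open>Each factor is half the sum of the factors of \<open>p\<close> and \<open>q\<close>.
  Where the product is 0, some vertex has both factors 0 and every mixture vanishes; this makes the
  law with density \<open>mid\<close> dominate them all.\<close>

definition mid :: "('v \<Rightarrow> 'a) \<Rightarrow> real" where
  "mid = joint_density (mix (1/2) p q)"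

text \<open>Expanding the product of \<open>P + l * (Q - P)\<close> over the vertices, with
  \<open>P\<close> and \<open>Q\<close> the two factors, gives one term per set \<open>S\<close> of
  vertices where the second summand is taken; this is its coefficient relative to
  \<open>mid\<close>. Sets of equal size share a power of \<open>l\<close>.\<close>

definition coef :: "'v set \<Rightarrow> ('v \<Rightarrow> 'a) \<Rightarrow> real" where
  "coef S z = (\<Prod>v\<in>S. fam_density v (q v) z - fam_density v (p v) z)
     * (\<Prod>v\<in>V - S. fam_density v (p v) z) / mid z"

definition ratio :: "real \<Rightarrow> ('v \<Rightarrow> 'a) \<Rightarrow> real" where
  "ratio l z = (\<Sum>S\<in>Pow V. l ^ card S * coef S z)"

lemma mid_family: "eqb_family K \<omega> (mix (1/2) p q)"
  by (rule eqb_family_mix[OF p q]) simp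

lemma ratio_eq: "ratio l z = joint_density (mix l p q) z / mid z"
proof -
  let ?P = "\<lambda>v. fam_density v (p v) z" and ?Q = "\<lambda>v. fam_density v (q v) z"
  have "joint_density (mix l p q) z = (\<Prod>v\<in>V. l * (?Q v - ?P v) + ?P v)"
    by (simp add: joint_density_def fam_density_mix algebra_simps)
  also have "\<dots> = (\<Sum>S\<in>Pow V. (\<Prod>v\<in>S. l * (?Q v - ?P v)) * (\<Prod>v\<in>V - S. ?P v))"
    by (rule prod_add[OF finite_V])
  also have "\<dots> = (\<Sum>S\<in>Pow V. l ^ card S * ((\<Prod>v\<in>S. ?Q v - ?P v) * (\<Prod>v\<in>V - S. ?P v)))"
    by (simp add: prod.distrib mult.assoc)
  finally show ?thesis by (simp add: ratio_def coef_def sum_divide_distrib)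
qed

lemma mid_eq: "mid z = (\<Prod>v\<in>V. (fam_density v (p v) z + fam_density v (q v) z) / 2)"
  by (simp add: mid_def joint_density_def fam_density_mix add_divide_distrib)

lemma ratio_times_mid:
  assumes z: "z \<in> mspace (prod_space X V)"
  shows "mid z * ratio l z = joint_density (mix l p q) z"
proof (cases "mid z = 0")
  case True
  then obtain v where v: "v \<in> V" "fam_density v (p v) z + fam_density v (q v) z = 0"
    unfolding mid_eq using finite_V by (auto simp: prod_zero_iff)
  then have "fam_density v (p v) z = 0" "fam_density v (q v) z = 0"
    using fam_bounds(1)[OF p v(1) z] fam_bounds(1)[OF q v(1) z] by auto
  then have "joint_density (mix l p q) z = 0"
    unfolding joint_density_def using v(1) finite_V
    by (intro prod_zero) (auto simp: fam_density_mix intro!: bexI[of _ v])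
  then show ?thesis using True by simp
qed (simp add: ratio_eq)

lemma mid_nonneg: "z \<in> mspace (prod_space X V) \<Longrightarrow> 0 \<le> mid z"
  unfolding mid_def using joint_density_bounds[OF mid_family] by simp

lemma ratio_nonneg:
  assumes "z \<in> mspace (prod_space X V)" "l \<in> {0..1}"
  shows "0 \<le> ratio l z"
  unfolding ratio_eq using joint_density_bounds[OF eqb_family_mix[OF p q assms(2)] assms(1)] mid_nonneg assms
  by (intro divide_nonneg_nonneg) auto

lemma coef_measurable: "S \<subseteq> V \<Longrightarrow> coef S \<in> borel_measurable (PiM V ref)"
  unfolding coef_def[abs_def] mid_def
  using joint_density_borel[OF mid_family]
  by (intro borel_measurable_divide borel_measurable_times borel_measurable_prod borel_measurable_diff
      fam_measurable p q) auto

lemma ratio_measurable: "ratio l \<in> borel_measurable (PiM V ref)"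
  unfolding ratio_def[abs_def]
  by (intro borel_measurable_sum borel_measurable_times coef_measurable) auto

text \<open>Both \<open>\<bar>Q - P\<bar>\<close> and \<open>P\<close> are at most
  \<open>P + Q\<close>, twice the factor of \<open>mid\<close>; this yields one 2 per vertex. Where
  \<open>mid\<close> is 0 division makes the coefficient 0.\<close>

lemma coef_bound:
  assumes z: "z \<in> mspace (prod_space X V)" and S: "S \<subseteq> V"
  shows "\<bar>coef S z\<bar> \<le> 2 ^ card V"
proof (cases "mid z = 0")
  case False
  let ?P = "\<lambda>v. fam_density v (p v) z" and ?Q = "\<lambda>v. fam_density v (q v) z"
  have nn: "0 \<le> ?P v" "0 \<le> ?Q v" if "v \<in> V" for v
    using fam_bounds(1)[OF p that z] fam_bounds(1)[OF q that z] by auto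
  have "\<bar>(\<Prod>v\<in>S. ?Q v - ?P v) * (\<Prod>v\<in>V - S. ?P v)\<bar>
      = (\<Prod>v\<in>S. \<bar>?Q v - ?P v\<bar>) * (\<Prod>v\<in>V - S. \<bar>?P v\<bar>)"
    by (simp add: abs_mult abs_prod)
  also have "\<dots> \<le> (\<Prod>v\<in>S. ?P v + ?Q v) * (\<Prod>v\<in>V - S. ?P v + ?Q v)"
    using nn S by (intro mult_mono prod_mono prod_nonneg) (auto simp: subset_iff abs_le_iff)
  also have "\<dots> = (\<Prod>v\<in>V. ?P v + ?Q v)"
    using prod.subset_diff[OF S finite_V, of "\<lambda>v. ?P v + ?Q v"] by (simp add: mult.commute)
  also have "\<dots> = 2 ^ card V * mid z"
    by (simp add: mid_eq prod_dividef)
  finally show ?thesis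
    using mid_nonneg[OF z] False by (simp add: coef_def abs_divide divide_le_eq)
qed (simp add: coef_def)

lemma eqb_joint_mix:
  assumes l: "l \<in> {0..1}"
  shows "eqb_joint (mix l p q) = density (eqb_joint (mix (1/2) p q)) (\<lambda>z. ennreal (ratio l z))"
proof -
  have "density (density (PiM V ref) (\<lambda>z. ennreal (mid z))) (\<lambda>z. ennreal (ratio l z))
      = density (PiM V ref) (\<lambda>z. ennreal (mid z) * ennreal (ratio l z))"
    using joint_density_borel[OF mid_family] ratio_measurable
    by (intro density_density_eq) (auto simp: mid_def)
  also have "\<dots> = density (PiM V ref) (\<lambda>z. ennreal (joint_density (mix l p q) z))"
  proof (rule density_cong)
    show "(\<lambda>z. ennreal (mid z) * ennreal (ratio l z)) \<in> borel_measurable (PiM V ref)"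
      using joint_density_borel[OF mid_family] ratio_measurable by (simp add: mid_def)
    show "(\<lambda>z. ennreal (joint_density (mix l p q) z)) \<in> borel_measurable (PiM V ref)"
      using joint_density_borel[OF eqb_family_mix[OF p q l]] by simp
    show "AE z in PiM V ref. ennreal (mid z) * ennreal (ratio l z) = ennreal (joint_density (mix l p q) z)"
      using ratio_times_mid mid_nonneg ratio_nonneg[OF _ l]
      by (intro AE_I2) (simp add: space_prod ennreal_mult[symmetric])
  qed
  finally show ?thesis
    unfolding eqb_joint_eq[OF mid_family] eqb_joint_eq[OF eqb_family_mix[OF p q l]] mid_def[symmetric]
    by simp
qed

lemma coef_integrable:
  assumes "S \<subseteq> V" shows "integrable (eqb_joint (mix (1/2) p q)) (coef S)"
proof -
  interpret R: prob_space "eqb_joint (mix (1/2) p q)" by (rule eqb_joint_prob(1)[OF mid_family])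
  show ?thesis
    using coef_measurable[OF assms] coef_bound[OF _ assms]
    by (intro R.integrable_const_bound[of _ "2 ^ card V"])
      (auto simp: space_joint eqb_joint_eq[OF mid_family] space_prod)
qed

text \<open>As \<open>0 ^ 0 = 1\<close>, the term of the empty set cancels in
  \<open>ratio l - ratio 0\<close>. The remaining powers are at most \<open>l\<close>, and 2^n sets
  with coefficients bounded by 2^n give 4^n, for \<open>n\<close> vertices.\<close>

lemma tv_dist_mix:
  assumes l: "l \<in> {0..1}"
  shows "tv_dist (prod_space X V) (eqb_joint p) (eqb_joint (mix l p q)) \<le> l * 4 ^ card V"
proof -
  let ?R = "eqb_joint (mix (1/2) p q)"
  interpret R: prob_space ?R by (rule eqb_joint_prob(1)[OF mid_family])
  have spR: "space ?R = mspace (prod_space X V)" by (rule space_joint)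
  have ri: "integrable ?R (ratio t)" for t
    unfolding ratio_def[abs_def]
    by (intro Bochner_Integration.integrable_sum integrable_mult_right coef_integrable) auto
  have diff: "\<bar>ratio l z - ratio 0 z\<bar> \<le> l * 4 ^ card V" if z: "z \<in> mspace (prod_space X V)" for z
  proof -
    have "\<bar>ratio l z - ratio 0 z\<bar> = \<bar>\<Sum>S\<in>Pow V. (l ^ card S - 0 ^ card S) * coef S z\<bar>"
      by (simp add: ratio_def sum_subtractf[symmetric] left_diff_distrib)
    also have "\<dots> \<le> (\<Sum>S\<in>Pow V. \<bar>(l ^ card S - 0 ^ card S) * coef S z\<bar>)" by (rule sum_abs)
    also have "\<dots> \<le> (\<Sum>S\<in>Pow V. l * 2 ^ card V)"
    proof (rule sum_mono)
      fix S assume S: "S \<in> Pow V"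
      have "\<bar>l ^ card S - 0 ^ card S\<bar> \<le> l"
      proof (cases "card S")
        case (Suc k)
        then show ?thesis using l by (simp add: mult_left_le power_le_one)
      qed (use l in simp)
      then show "\<bar>(l ^ card S - 0 ^ card S) * coef S z\<bar> \<le> l * 2 ^ card V"
        unfolding abs_mult using coef_bound[OF z] S l by (intro mult_mono) auto
    qed
    also have "\<dots> = l * (2 ^ card V * 2 ^ card V)" by (simp add: card_Pow finite_V)
    also have "\<dots> = l * 4 ^ card V" by (simp add: power_mult_distrib[symmetric])
    finally show ?thesis .
  qed
  have pr: "measure (eqb_joint (mix t p q)) U = (\<integral>z. ratio t z * indicator U z \<partial>?R)"
    if t: "t \<in> {0..1}" and U: "U \<in> sets (borel_space (prod_space X V))" for t U
  proof -
    have UR: "U \<in> sets ?R" using U by (simp add: sets_joint)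
    have "measure (eqb_joint (mix t p q)) U = (\<integral>z. indicator U z \<partial>eqb_joint (mix t p q))"
      using sets.sets_into_space[OF UR] by (simp add: space_joint Int_absorb2)
    also have "\<dots> = (\<integral>z. ratio t z * indicator U z \<partial>?R)"
      unfolding eqb_joint_mix[OF t] using UR ratio_nonneg[OF _ t] borel_measurable_integrable[OF ri]
      by (subst integral_real_density) (auto simp: spR)
    finally show ?thesis .
  qed
  have "\<bar>measure (eqb_joint p) U - measure (eqb_joint (mix l p q)) U\<bar> \<le> l * 4 ^ card V"
    if U: "U \<in> sets (borel_space (prod_space X V))" for U
  proof -
    have UR: "U \<in> sets ?R" using U by (simp add: sets_joint)
    have i: "integrable ?R (\<lambda>z. ratio t z * indicator U z)" for t
      by (rule integrable_real_mult_indicator[OF UR ri])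
    have "\<bar>measure (eqb_joint (mix 0 p q)) U - measure (eqb_joint (mix l p q)) U\<bar>
      = \<bar>\<integral>z. ratio 0 z * indicator U z - ratio l z * indicator U z \<partial>?R\<bar>"
      using pr[OF _ U, of 0] pr[OF l U] i by simp
    also have "\<dots> \<le> (\<integral>z. \<bar>ratio 0 z * indicator U z - ratio l z * indicator U z\<bar> \<partial>?R)"
      by (rule integral_abs_bound)
    also have "\<dots> \<le> (\<integral>z. l * 4 ^ card V \<partial>?R)"
    proof (rule integral_mono)
      fix z assume "z \<in> space ?R"
      then show "\<bar>ratio 0 z * indicator U z - ratio l z * indicator U z\<bar> \<le> l * 4 ^ card V"
        using diff[of z] l by (auto simp: spR indicator_def abs_minus_commute)
    qed (use i in auto)
    also have "\<dots> = l * 4 ^ card V" using R.prob_space by simp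
    finally show ?thesis by (simp add: mix_0)
  qed
  moreover have "eqb_joint p \<in> borel_probs (prod_space X V)"
    "eqb_joint (mix l p q) \<in> borel_probs (prod_space X V)"
    using eqb_joint_prob(2) p eqb_family_mix[OF p q l] by auto
  ultimately show ?thesis unfolding tv_dist_def
    by (auto intro!: cSUP_least simp: ex_in_conv[symmetric] intro: sets.empty_sets)
qed

text \<open>The events \<open>S\<close> and \<open>T\<close> are fixed once, as witnesses of
  dependence at weight 1. Independence for infinitely many weights would extend to weight 1 for this
  very pair.\<close>

lemma finite_cond_indep_mix:
  assumes sub: "A \<subseteq> V" "B \<subseteq> V" "C \<subseteq> V" and nci: "\<not> cond_indep X (eqb_joint q) A B C"
  shows "finite {l\<in>{0..1}. cond_indep X (eqb_joint (mix l p q)) A B C}"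
proof -
  let ?R = "eqb_joint (mix (1/2) p q)"
  define F where "F = sigma_coord X ?R C"
  interpret R: prob_space ?R by (rule eqb_joint_prob(1)[OF mid_family])
  have F: "subalgebra ?R F" unfolding F_def by (rule subalgebra_sigma_coord[OF sets_joint sub(3)])
  have Fl: "sigma_coord X (joint f) C = F" for f
    by (simp add: F_def sigma_coord_def space_joint)
  obtain S T where S: "S \<in> sets (borel_space (prod_space X A))"
    and T: "T \<in> sets (borel_space (prod_space X B))"
    and n: "\<not> cond_indep_events (eqb_joint q) F (cyl A S) (cyl B T)"
    using nci unfolding cond_indep_iff_events[OF space_joint] Fl by blast
  have "finite {l\<in>{0..1}. cond_indep_events (eqb_joint (mix l p q)) F (cyl A S) (cyl B T)}"
  proof (rule ccontr)
    assume inf: "infinite {l\<in>{0..1}. cond_indep_events (eqb_joint (mix l p q)) F (cyl A S) (cyl B T)}"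
    have "cond_indep_events (eqb_joint (mix 1 p q)) F (cyl A S) (cyl B T)"
    proof (rule R.cond_indep_events_polynomial[where I = "Pow V" and d = card and a = coef, OF F])
      show "eqb_joint (mix l p q) = density ?R (\<lambda>z. ennreal (\<Sum>S\<in>Pow V. l ^ card S * coef S z))"
        if "l \<in> {0..1}" for l
        using eqb_joint_mix[OF that] by (simp add: ratio_def)
      show "0 \<le> (\<Sum>S\<in>Pow V. l ^ card S * coef S z)" if "l \<in> {0..1}" "z \<in> space ?R" for l z
        using ratio_nonneg[of z l] that by (simp add: ratio_def space_joint)
      show "cyl A S \<in> R.events" "cyl B T \<in> R.events"
        using cyl_sets[OF sub(1) S] cyl_sets[OF sub(2) T] by (simp_all add: sets_joint)
      show "prob_space (eqb_joint (mix l p q))" if "l \<in> {0..1}" for l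
        by (rule eqb_joint_prob(1)[OF eqb_family_mix[OF p q that]])
    qed (use inf finite_V coef_integrable in auto)
    then show False using n by (simp add: mix_1)
  qed
  moreover have "{l\<in>{0..1}. cond_indep X (eqb_joint (mix l p q)) A B C}
      \<subseteq> {l\<in>{0..1}. cond_indep_events (eqb_joint (mix l p q)) F (cyl A S) (cyl B T)}"
    unfolding cond_indep_iff_events[OF space_joint] Fl using S T by blast
  ultimately show ?thesis by (rule finite_subset[rotated])
qed

end

section \<open>Proof of openness and density\<close>

lemma F_eqb_tv_dense:
  assumes P: "P \<in> M_eqb V E X K \<omega> \<mu>" and Q: "Q \<in> F_eqb V E X K \<omega> \<mu>" and e: "e > 0"
  obtains P' where "P' \<in> F_eqb V E X K \<omega> \<mu>" "tv_dist (prod_space X V) P P' < e"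
proof -
  obtain k where k: "k \<in> BN_eqb V E X K \<omega> \<mu>" "P = BN_dist V E X k"
    using P unfolding M_eqb_def by (elim imageE)
  have "Q \<in> M_eqb V E X K \<omega> \<mu>" using Q by (simp add: F_eqb_def)
  then obtain k' where k': "k' \<in> BN_eqb V E X K \<omega> \<mu>" "Q = BN_dist V E X k'"
    unfolding M_eqb_def by (elim imageE)
  obtain p where p: "eqb_family K \<omega> p" "BN_dist V E X k = eqb_joint p"
    "\<And>v x. v \<in> V \<Longrightarrow> x \<in> mspace (prod_space X (pa E v)) \<Longrightarrow>
      k v x = density (ref v) (\<lambda>y. ennreal (p v (y, x)))"
    by (rule BN_eqb_density[OF \<omega> k(1)]) (rule that)
  obtain q where q: "eqb_family K \<omega> q" "BN_dist V E X k' = eqb_joint q"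
    "\<And>v x. v \<in> V \<Longrightarrow> x \<in> mspace (prod_space X (pa E v)) \<Longrightarrow>
      k' v x = density (ref v) (\<lambda>y. ennreal (q v (y, x)))"
    by (rule BN_eqb_density[OF \<omega> k'(1)]) (rule that)
  have nci: "\<not> cond_indep X (eqb_joint q) A B C" if "(A, B, C) \<in> not_separated" for A B C
    using Q that k'(2) q(2) by (auto simp: F_eqb_def faithful_iff)
  \<comment> \<open>The weights for which some non-separated triple becomes independent. They are
    finitely many, whereas every interval to the right of 0 is infinite.\<close>
  define Bad where "Bad = (\<Union>(A, B, C)\<in>not_separated.
    {l\<in>{0..1}. cond_indep X (eqb_joint (mix l p q)) A B C})"
  have "finite Bad" unfolding Bad_def
  proof (rule finite_UN_I[OF finite_not_separated], clarify)
    fix A B C assume t: "(A, B, C) \<in> not_separated"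
    then show "finite {l\<in>{0..1}. cond_indep X (eqb_joint (mix l p q)) A B C}"
      using nci[OF t] by (intro finite_cond_indep_mix[OF p(1) q(1)]) (auto simp: not_separated_def)
  qed
  \<comment> \<open>By \<open>tv_dist_mix\<close> a weight below \<open>e / 4 ^ card V\<close> moves
    the model by less than \<open>e\<close>; the 1 keeps the mixture convex.\<close>
  moreover define b where "b = min 1 (e / 4 ^ card V)"
  have "b > 0" using e by (simp add: b_def)
  then have "infinite {0<..<b}" by simp
  ultimately obtain l where l: "l \<in> {0<..<b}" "l \<notin> Bad" by (meson finite_subset subsetI)
  then have l01: "l \<in> {0..1}" and le: "l < e / 4 ^ card V" by (auto simp: b_def)
  let ?P' = "eqb_joint (mix l p q)"
  have "?P' \<in> M_eqb V E X K \<omega> \<mu>" by (rule mix_in_M_eqb[OF k(1) k'(1) p(1) q(1) p(3) q(3) l01])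
  moreover have "?P' \<in> faithful_dists V E X"
    unfolding faithful_iff
    using eqb_joint_prob(3)[OF eqb_family_mix[OF p(1) q(1) l01]] l(2) l01 by (auto simp: Bad_def)
  moreover have "tv_dist (prod_space X V) P ?P' \<le> l * 4 ^ card V"
    using tv_dist_mix[OF p(1) q(1) l01] k(2) p(2) by simp
  moreover have "l * 4 ^ card V < e" using le by (simp add: pos_less_divide_eq)
  ultimately show thesis by (intro that[of ?P']) (auto simp: F_eqb_def)
qed

text \<open>A faithful model has a total variation ball of faithful ones, and within the class a
  weak neighbourhood fits into that ball. Weak density follows from density in total variation,
  since weakly open sets are open there.\<close>

lemma F_eqb_open_dense:
  assumes "k \<in> BN_eqb V E X K \<omega> \<mu>" "BN_dist V E X k \<in> faithful_dists V E X"
  shows "open_dense_in (weak_topology (prod_space X V)) (M_eqb V E X K \<omega> \<mu>) (F_eqb V E X K \<omega> \<mu>)"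
    and "open_dense_in (mtopology_of (tv_metric (prod_space X V)))
      (M_eqb V E X K \<omega> \<mu>) (F_eqb V E X K \<omega> \<mu>)"
proof -
  let ?m = "prod_space X V" and ?M = "M_eqb V E X K \<omega> \<mu>" and ?F = "F_eqb V E X K \<omega> \<mu>"
  have Q: "BN_dist V E X k \<in> ?F" using assms by (auto simp: F_eqb_def M_eqb_def)
  have FM: "?F \<subseteq> ?M" by (auto simp: F_eqb_def)
  have ball: "\<exists>e>0. \<forall>Q\<in>?M. tv_dist ?m P Q < e \<longrightarrow> Q \<in> ?F" if P: "P \<in> ?F" for P
  proof -
    have "P \<in> faithful_dists V E X" using P by (simp add: F_eqb_def)
    then obtain e where "e > 0" "\<And>Q. Q \<in> markov_dists V E X \<Longrightarrow> tv_dist ?m P Q < e \<Longrightarrow>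
        Q \<in> faithful_dists V E X"
      by (rule faithful_tv_neighbourhood) (rule that)
    then show ?thesis using M_eqb_markov by (intro exI[of _ e]) (auto simp: F_eqb_def)
  qed
  have dense: "\<exists>Q\<in>?F. Q \<in> U" if P: "P \<in> ?M" "P \<in> U" and U: "openin (mtopology_of (tv_metric ?m)) U" for P U
  proof -
    obtain e where e: "e > 0" "\<And>Q. Q \<in> borel_probs ?m \<Longrightarrow> tv_dist ?m P Q < e \<Longrightarrow> Q \<in> U"
      using U P(2) unfolding openin_tv_iff by blast
    obtain P' where "P' \<in> ?F" "tv_dist ?m P P' < e" by (rule F_eqb_tv_dense[OF P(1) Q e(1)])
    then show ?thesis using e(2) FM M_eqb_borel_probs by blast
  qed
  show "open_dense_in (weak_topology ?m) ?M ?F"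
  proof (rule open_dense_inI[OF FM])
    show "?M \<subseteq> topspace (weak_topology ?m)"
      using M_eqb_borel_probs by (simp add: topspace_weak_topology)
    fix P assume P: "P \<in> ?F"
    then obtain e where e: "e > 0" "\<forall>Q\<in>?M. tv_dist ?m P Q < e \<longrightarrow> Q \<in> ?F" using ball by blast
    have PM: "P \<in> ?M" using P FM by auto
    obtain U where "openin (weak_topology ?m) U" "P \<in> U"
      "\<And>Q. Q \<in> ?M \<Longrightarrow> Q \<in> U \<Longrightarrow> tv_dist ?m P Q < e"
      by (rule M_eqb_weak_neighbourhood[OF PM e(1)]) (rule that)
    then show "\<exists>U. openin (weak_topology ?m) U \<and> P \<in> U \<and> U \<inter> ?M \<subseteq> ?F"
      using e(2) by (intro exI[of _ U]) auto
  next
    fix P U assume "P \<in> ?M" "openin (weak_topology ?m) U" "P \<in> U"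
    then show "\<exists>Q\<in>?F. Q \<in> U" using dense weak_topology_coarser_tv by blast
  qed
  show "open_dense_in (mtopology_of (tv_metric ?m)) ?M ?F"
  proof (rule open_dense_inI[OF FM])
    show "?M \<subseteq> topspace (mtopology_of (tv_metric ?m))"
      using M_eqb_borel_probs by (simp add: mspace_tv_metric)
    fix P assume P: "P \<in> ?F"
    then obtain e where e: "e > 0" "\<forall>Q\<in>?M. tv_dist ?m P Q < e \<longrightarrow> Q \<in> ?F" using ball by blast
    have Pm: "P \<in> mspace (tv_metric ?m)"
      using P FM M_eqb_borel_probs by (auto simp: mspace_tv_metric)
    interpret Metric_space "mspace (tv_metric ?m)" "mdist (tv_metric ?m)"
      by (rule Metric_space_mspace_mdist)
    show "\<exists>U. openin (mtopology_of (tv_metric ?m)) U \<and> P \<in> U \<and> U \<inter> ?M \<subseteq> ?F"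
      using e[folded mdist_tv_metric] Pm by (intro exI[of _ "mball P e"]) (auto simp: mtopology_of_def)
  next
    fix P U assume "P \<in> ?M" "openin (mtopology_of (tv_metric ?m)) U" "P \<in> U"
    then show "\<exists>Q\<in>?F. Q \<in> U" using dense by blast
  qed
qed

end

end

theorem mainTheorem7:
  fixes V :: "'v set" and E :: "('v \<times> 'v) set"
    and X :: "'v \<Rightarrow> 'a metric" and K :: real and \<omega> :: "real \<Rightarrow> real"
    and \<mu> :: "'v \<Rightarrow> 'a measure"
  assumes "dag V E"
    and "\<And>v. v \<in> V \<Longrightarrow> mcomplete_of (X v)"
    and "\<And>v. v \<in> V \<Longrightarrow> separable_space (mtopology_of (X v))"
    and "\<And>v. v \<in> V \<Longrightarrow> \<exists>x\<in>mspace (X v). \<exists>y\<in>mspace (X v). x \<noteq> y"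
    and "K > 0"
    and "modulus_of_continuity \<omega>" and "concave_on {0..} \<omega>"
    and "\<And>v. v \<in> V \<Longrightarrow> locally_finite_measure (X v) (\<mu> v)"
    and "\<exists>k\<in>BN_eqb V E X K \<omega> \<mu>. BN_dist V E X k \<in> faithful_dists V E X"
  shows "open_dense_in (weak_topology (prod_space X V))
           (M_eqb V E X K \<omega> \<mu>) (F_eqb V E X K \<omega> \<mu>) \<and>
         open_dense_in (mtopology_of (tv_metric (prod_space X V)))
           (M_eqb V E X K \<omega> \<mu>) (F_eqb V E X K \<omega> \<mu>)"
proof -
  interpret bayes_space V E X \<mu>
    using assms(1,3,4,8) by unfold_locales auto
  obtain k where "k \<in> BN_eqb V E X K \<omega> \<mu>" "BN_dist V E X k \<in> faithful_dists V E X"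
    using assms(9) by blast
  from F_eqb_open_dense[OF assms(5,6) this] show ?thesis by blast
qed

end
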